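(* Let $\mathcal{P}=(P_i)_{1\le i\le r}\in\mathcal{F}^{\mathrm I}$ and $Q_{\mathcal P}\in(\pi^{\mathrm I})^{-1}(\mathcal P)$, and let $$\widetilde{\mathcal V}_{\mathcal P}=\left\{(R_i)_i\in\mathcal{F}^{\mathrm I}:R_i\in G_{q_i}\setminus\mathrm{Cut}(P_i),\ 1\le i\le r\right\}.$$ For any $\mathcal R=(R_i)_i\in\widetilde{\mathcal V}_{\mathcal P}$, let $\mathfrak{S}_{\mathcal P}(\mathcal R)\in O(n)$ be the orthogonal matrix whose $q_i$-block is $$\left(\mathfrak{S}_{\mathcal P}(\mathcal R)\right)^{(i)}=\mathcal{H}^{\pi^i}_{(P_i,R_i)}\left(Q_{\mathcal P}^{(i)}\right),\qquad1\le i\le r.$$ Then the map $\mathfrak{S}_{\mathcal P}:\widetilde{\mathcal V}_{\mathcal P}\to O(n)$ is a smooth local section of $\pi^{\mathrm I}$. Furthermore, for all $1\le i\le r$, the holonomy map is given explicitly, for $U\in\mathrm{St}_{q_i}$ with $UU^T=P_i$, by $$\mathcal{H}^{\pi^i}_{(P_i,R_i)}(U)=\begin{pmatrix}U&\Delta U\end{pmatrix}\exp_m\begin{pmatrix}A&-C\\ I_{q_i}&A\end{pmatrix}\begin{pmatrix}I_{q_i}\\ 0_{q_i}\end{pmatrix}\exp_m(-A),$$ with $\Delta=\mathrm{Log}^{G_{q_i}}_{P_i}(R_i)$, $A=U^T\Delta U$, $C=U^T\Delta^2U$.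
   Context: A type is $\mathrm I=(q_i)_{1\le i\le r}$, $r\ge2$, of positive integers with $\sum_iq_i=n$. $G_q=\{P\in\mathbb{R}^{n\times n}:P^2=P=P^T,\ \mathrm{rank}(P)=q\}$, $\mathcal{F}^{\mathrm I}=\{(P_i)_i\in\prod_iG_{q_i}:P_iP_j=0,\ i\ne j\}$. With $P_0^i=\mathrm{Diag}[0_{q_1},\dots,I_{q_i},\dots,0_{q_r}]$, the map $\pi^{\mathrm I}:O(n)\to\mathcal{F}^{\mathrm I}$ is $\pi^{\mathrm I}(Q)=(QP_0^iQ^T)_i$. An $n\times n$ matrix $M$ is partitioned into consecutive column blocks $M=(M^{(1)}\ \dots\ M^{(r)})$ with $q_i$-block $M^{(i)}\in\mathbb{R}^{n\times q_i}$. $\mathrm{St}_q=\{U\in\mathbb{R}^{n\times q}:U^TU=I_q\}$ has the Euclidean metric $g^{\mathrm{St}}_U(D_1,D_2)=\mathrm{tr}(D_1^TD_2)$. $\pi^{SG}_q:\mathrm{St}_q\to G_q$, $U\mapsto UU^T$, is a Riemannian submersion, where $G_q$ has the metric $\frac12\mathrm{tr}(\Delta\Delta')$; the horizontal lift at $U$ of $\Delta\in T_PG_q$ is $\Delta^\sharp_U=\Delta U$. Write $\pi^i=\pi^{SG}_{q_i}$. The cut locus of $P=UU^T$ in $G_q$ is $\mathrm{Cut}(P)=\{YY^T:Y\in\mathrm{St}_q,\ \mathrm{rank}(U^TY)<q\}$, and for $R\notin\mathrm{Cut}(P)$ the Riemannian logarithm is $\mathrm{Log}^{G_q}_P(R)=\Omega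 P-P\Omega$ with $\Omega=\frac12\log_m((I_n-2R)(I_n-2P))\in\mathfrak{so}(n)$ (principal matrix logarithm). The holonomy map is $\mathcal{H}^{\pi^{SG}_q}_{(P,R)}(U)=\mathrm{Exp}^{\mathrm{St}_q}_U\left((\mathrm{Log}^{G_q}_P(R))^\sharp_U\right)$ for $U\in(\pi^{SG}_q)^{-1}(P)$: the endpoint of the horizontal lift through $U$ of the unique minimal geodesic from $P$ to $R$; it lies in $(\pi^{SG}_q)^{-1}(R)$. $\exp_m$ is the matrix exponential. *)

theory Defs
  imports
    "HOL-Analysis.Function_Topology"
    "Jordan_Normal_Form.Char_Poly"
    "Jordan_Normal_Form.DL_Rank"
begin

text \<open>
  The block sizes of a flag are unrelated natural numbers, so matrices are taken from
  \<^verbatim>\<open>Jordan_Normal_Form\<close> (explicit dimensions) instead of \<^verbatim>\<open>real^'m^'n\<close>.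
  A type is a list \<open>qs\<close>; its entries, and families of matrices, are indexed from 0.
\<close>

definition mat_exp :: "real mat \<Rightarrow> real mat" where
  "mat_exp A = mat (dim_row A) (dim_row A) (\<lambda>(i, j). \<Sum>k. (A ^\<^sub>m k) $$ (i, j) / fact k)"

text \<open>
  The principal logarithm of a real matrix without eigenvalues in \<open>(-\<infinity>, 0]\<close> is its
  unique real logarithm all of whose complex eigenvalues lie in the strip \<open>-\<pi> < Im z < \<pi>\<close>.
\<close>

definition is_principal_log :: "real mat \<Rightarrow> real mat \<Rightarrow> bool" where
  "is_principal_log M X \<longleftrightarrow>
     X \<in> carrier_mat (dim_row M) (dim_row M) \<and> mat_exp X = M \<and>
     (\<forall>z. eigenvalue (map_mat complex_of_real X) z \<longrightarrow> \<bar>Im z\<bar> < pi)"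

definition mat_log :: "real mat \<Rightarrow> real mat" where
  "mat_log M = (THE X. is_principal_log M X)"

definition mat_inner :: "real mat \<Rightarrow> real mat \<Rightarrow> real" where
  "mat_inner A B = sum_list (diag_mat (A\<^sup>T * B))"

definition has_mat_derivative :: "(real \<Rightarrow> real mat) \<Rightarrow> real mat \<Rightarrow> real \<Rightarrow> bool" where
  "has_mat_derivative c D t \<longleftrightarrow>
     (\<forall>s. c s \<in> carrier_mat (dim_row D) (dim_col D)) \<and>
     (\<forall>i<dim_row D. \<forall>j<dim_col D.
        ((\<lambda>s. c s $$ (i, j)) has_real_derivative D $$ (i, j)) (at t))"

definition tangent_vectors :: "real mat set \<Rightarrow> real mat \<Rightarrow> real mat set" where
  "tangent_vectors M X =
     {D. \<exists>c. (\<forall>t. c t \<in> M) \<and> c 0 = X \<and> has_mat_derivative c D 0}"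

text \<open>
  For the metric induced by \<^const>\<open>mat_inner\<close>, the covariant derivative of a curve's velocity is
  the tangential projection of its acceleration; a geodesic is a curve with normal acceleration.
\<close>

definition is_geodesic :: "real mat set \<Rightarrow> (real \<Rightarrow> real mat) \<Rightarrow> bool" where
  "is_geodesic M c \<longleftrightarrow>
     (\<forall>t. c t \<in> M) \<and>
     (\<exists>c' c''. \<forall>t. has_mat_derivative c (c' t) t \<and> has_mat_derivative c' (c'' t) t \<and>
        (\<forall>E \<in> tangent_vectors M (c t). mat_inner (c'' t) E = 0))"

definition riem_exp :: "real mat set \<Rightarrow> real mat \<Rightarrow> real mat \<Rightarrow> real mat" where
  "riem_exp M X D =
     (THE Y. \<exists>c. is_geodesic M c \<and> c 0 = X \<and> has_mat_derivative c D 0 \<and> c 1 = Y)"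

definition orthogonal_group :: "nat \<Rightarrow> real mat set" where
  "orthogonal_group n = {Q \<in> carrier_mat n n. Q\<^sup>T * Q = 1\<^sub>m n}"

definition stiefel :: "nat \<Rightarrow> nat \<Rightarrow> real mat set" where
  "stiefel n q = {U \<in> carrier_mat n q. U\<^sup>T * U = 1\<^sub>m q}"

definition grassmann :: "nat \<Rightarrow> nat \<Rightarrow> real mat set" where
  "grassmann n q = {P \<in> carrier_mat n n. P * P = P \<and> P\<^sup>T = P \<and> vec_space.rank n P = q}"

definition stiefel_proj :: "real mat \<Rightarrow> real mat" where
  "stiefel_proj U = U * U\<^sup>T"

definition horizontal_lift :: "real mat \<Rightarrow> real mat \<Rightarrow> real mat" where
  "horizontal_lift \<Delta> U = \<Delta> * U"

text \<open>The rank condition does not depend on the representative \<open>U\<close> of \<open>P\<close>.\<close>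

definition cut_locus :: "nat \<Rightarrow> nat \<Rightarrow> real mat \<Rightarrow> real mat set" where
  "cut_locus n q P =
     {stiefel_proj Y | Y U. Y \<in> stiefel n q \<and> U \<in> stiefel n q \<and> stiefel_proj U = P \<and>
        vec_space.rank q (U\<^sup>T * Y) < q}"

definition grassmann_log :: "nat \<Rightarrow> real mat \<Rightarrow> real mat \<Rightarrow> real mat" where
  "grassmann_log n P R =
     (let \<Omega> = (1/2) \<cdot>\<^sub>m mat_log ((1\<^sub>m n - 2 \<cdot>\<^sub>m R) * (1\<^sub>m n - 2 \<cdot>\<^sub>m P))
      in \<Omega> * P - P * \<Omega>)"

definition holonomy :: "nat \<Rightarrow> nat \<Rightarrow> real mat \<Rightarrow> real mat \<Rightarrow> real mat \<Rightarrow> real mat" where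
  "holonomy n q P R U = riem_exp (stiefel n q) U (horizontal_lift (grassmann_log n P R) U)"

definition flag_type :: "nat \<Rightarrow> nat list \<Rightarrow> bool" where
  "flag_type n qs \<longleftrightarrow> length qs \<ge> 2 \<and> (\<forall>q \<in> set qs. q \<ge> 1) \<and> sum_list qs = n"

definition flag_manifold :: "nat \<Rightarrow> nat list \<Rightarrow> real mat list set" where
  "flag_manifold n qs =
     {Ps. length Ps = length qs \<and>
          (\<forall>i<length qs. Ps ! i \<in> grassmann n (qs ! i)) \<and>
          (\<forall>i<length qs. \<forall>j<length qs. i \<noteq> j \<longrightarrow> Ps ! i * Ps ! j = 0\<^sub>m n n)}"

definition standard_proj :: "nat list \<Rightarrow> nat \<Rightarrow> real mat" where
  "standard_proj qs i =
     diag_block_mat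
       (map (\<lambda>k. if k = i then 1\<^sub>m (qs ! k) else 0\<^sub>m (qs ! k) (qs ! k)) [0..<length qs])"

definition flag_proj :: "nat list \<Rightarrow> real mat \<Rightarrow> real mat list" where
  "flag_proj qs Q = map (\<lambda>i. Q * standard_proj qs i * Q\<^sup>T) [0..<length qs]"

definition col_block :: "nat list \<Rightarrow> nat \<Rightarrow> real mat \<Rightarrow> real mat" where
  "col_block qs i M =
     mat (dim_row M) (qs ! i) (\<lambda>(a, b). M $$ (a, sum_list (take i qs) + b))"

definition join_cols :: "nat \<Rightarrow> real mat list \<Rightarrow> real mat" where
  "join_cols n Ms = mat_of_cols n (concat (map cols Ms))"

text \<open>
  \<open>\<real>\<^sup>I\<close> for a finite set \<open>I\<close> is the topological space of extensional functions on \<open>I\<close>.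
  A function is \<open>C\<^sup>k\<close> on an open set if it is continuous there and, for \<open>k > 0\<close>,
  has partial derivatives in all coordinates that are \<open>C\<^sup>k\<^sup>-\<^sup>1\<close> there.
\<close>

abbreviation coord_space :: "'i set \<Rightarrow> ('i \<Rightarrow> real) topology" where
  "coord_space I \<equiv> product_topology (\<lambda>_. euclideanreal) I"

fun Ck_on :: "nat \<Rightarrow> 'i set \<Rightarrow> ('i \<Rightarrow> real) set \<Rightarrow> (('i \<Rightarrow> real) \<Rightarrow> real) \<Rightarrow> bool" where
  "Ck_on 0 I W F \<longleftrightarrow> continuous_map (subtopology (coord_space I) W) euclideanreal F"
| "Ck_on (Suc k) I W F \<longleftrightarrow>
     continuous_map (subtopology (coord_space I) W) euclideanreal F \<and>
     (\<forall>i\<in>I. \<exists>G. Ck_on k I W G \<and>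
        (\<forall>x\<in>W. ((\<lambda>t. F (x(i := t))) has_real_derivative G x) (at (x i))))"

definition coord_index :: "nat \<Rightarrow> nat \<Rightarrow> (nat \<times> nat \<times> nat) set" where
  "coord_index r n = {..<r} \<times> {..<n} \<times> {..<n}"

definition tuple_coords :: "nat \<Rightarrow> nat \<Rightarrow> real mat list \<Rightarrow> nat \<times> nat \<times> nat \<Rightarrow> real" where
  "tuple_coords r n Rs = restrict (\<lambda>(k, i, j). Rs ! k $$ (i, j)) (coord_index r n)"

text \<open>
  A map defined on a set \<open>V\<close> of \<open>r\<close>-tuples of \<open>n \<times> n\<close> matrices is smooth if near each point of
  \<open>V\<close> every entry of it is the restriction of a smooth function on an open set of the ambient
  space. For open subsets \<open>V\<close> of an embedded submanifold this is smoothness in charts.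
\<close>

definition smooth_mat_map_on ::
  "nat \<Rightarrow> nat \<Rightarrow> real mat list set \<Rightarrow> (real mat list \<Rightarrow> real mat) \<Rightarrow> bool" where
  "smooth_mat_map_on r n V S \<longleftrightarrow>
     (\<forall>a<n. \<forall>b<n. \<forall>Ps\<in>V. \<exists>W F.
        openin (coord_space (coord_index r n)) W \<and> tuple_coords r n Ps \<in> W \<and>
        (\<forall>k. Ck_on k (coord_index r n) W F) \<and>
        (\<forall>Rs\<in>V. tuple_coords r n Rs \<in> W \<longrightarrow> S Rs $$ (a, b) = F (tuple_coords r n Rs)))"

definition open_in_flags :: "nat \<Rightarrow> nat list \<Rightarrow> real mat list set \<Rightarrow> bool" where
  "open_in_flags n qs V \<longleftrightarrow>
     (\<exists>W. openin (coord_space (coord_index (length qs) n)) W \<and>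
          V = {Rs \<in> flag_manifold n qs. tuple_coords (length qs) n Rs \<in> W})"

definition smooth_local_section ::
  "nat \<Rightarrow> nat list \<Rightarrow> real mat list set \<Rightarrow> (real mat list \<Rightarrow> real mat) \<Rightarrow> bool" where
  "smooth_local_section n qs V S \<longleftrightarrow>
     open_in_flags n qs V \<and>
     S \<in> V \<rightarrow> orthogonal_group n \<and>
     smooth_mat_map_on (length qs) n V S \<and>
     (\<forall>Rs\<in>V. flag_proj qs (S Rs) = Rs)"

definition section_domain :: "nat \<Rightarrow> nat list \<Rightarrow> real mat list \<Rightarrow> real mat list set" where
  "section_domain n qs Ps =
     {Rs \<in> flag_manifold n qs.
        \<forall>i<length qs. Rs ! i \<in> grassmann n (qs ! i) - cut_locus n (qs ! i) (Ps ! i)}"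

definition holonomy_section ::
  "nat \<Rightarrow> nat list \<Rightarrow> real mat list \<Rightarrow> real mat \<Rightarrow> real mat list \<Rightarrow> real mat" where
  "holonomy_section n qs Ps Q Rs =
     join_cols n
       (map (\<lambda>i. holonomy n (qs ! i) (Ps ! i) (Rs ! i) (col_block qs i Q)) [0..<length qs])"

end

theory Submission
  imports Defs "Jordan_Normal_Form.Schur_Decomposition" "HOL-Analysis.L2_Norm"
begin

text \<open>
  Since \<open>\<Delta>\<close> is horizontal, \<open>A = U\<^sup>T \<Delta> U\<close> vanishes. If \<open>R\<close> lies outside the cut locus of \<open>U U\<^sup>T\<close>,
  then \<open>S = U\<^sup>T R U\<close> is positive definite and \<open>Y = R U S\<^sup>-\<^sup>1\<^sup>/\<^sup>2\<close> is the representative of \<open>R\<close> aligned with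
  \<open>U\<close>. Principal angles between \<open>U\<close> and \<open>Y\<close> give a skew matrix \<open>\<Omega>\<close> with \<open>exp \<Omega> U = Y\<close> and
  \<open>exp (2\<Omega>) = (I - 2R)(I - 2UU\<^sup>T)\<close>; as the angles are smaller than \<open>\<pi>/2\<close>, \<open>2\<Omega>\<close> is the principal logarithm.
  The curve \<open>exp (t\<Omega>) U\<close> is a Stiefel geodesic with initial velocity \<open>\<Delta> U\<close>, so \<open>Y\<close> is the holonomy of
  \<open>U\<close>. The explicit formula follows because \<open>(U \<Delta>U)\<close> intertwines \<open>\<Omega>\<close> with the block matrix, and
  smoothness reduces to that of the positive definite square root, whose derivative solves a
  Sylvester equation.
\<close>

section \<open>Matrix algebra with dimension side conditions\<close>

text \<open>The Riemannian exponential and the matrix logarithm are definite descriptions, so every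
  value needs a uniqueness proof besides a witness. For the exponential the competitors are all
  Stiefel geodesics with the same initial data; horizontality makes their equation linear, and a
  conserved energy forces the difference of two solutions to vanish. For the logarithm the
  competitors are real matrices with spectrum in the strip. Nothing makes them skew or
  diagonalizable, so they are compared with 2\<Omega> on the eigenvectors of 2\<Omega>. Smoothness
  is asked for in ambient coordinates, hence of functions on open sets that contain tuples of
  arbitrary matrices. The closed form Y frees that question of exponential and logarithm,
  symmetrization extends it off the Grassmannian, and the square root is the one ingredient that is
  not rational. Its partial derivatives are rational in its own entries, so a single algebra of
  functions is closed under differentiation, and all orders of smoothness follow by
  induction.\<close>

lemma mat_mult_assoc:
  fixes A :: "'a::semiring_0 mat"
  shows "dim_col A = dim_row B \<Longrightarrow> dim_col B = dim_row C \<Longrightarrow> A * B * C = A * (B * C)"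
  by (rule assoc_mult_mat[of _ "dim_row A" "dim_row B" _ "dim_row C" _ "dim_col C"]) auto

lemma mat_add_mult:
  fixes A :: "'a::semiring_0 mat"
  shows "dim_row A = dim_row B \<Longrightarrow> dim_col A = dim_col B \<Longrightarrow> dim_col A = dim_row C \<Longrightarrow>
    (A + B) * C = A * C + B * C"
  by (rule add_mult_distrib_mat[of _ "dim_row A" "dim_col A" _ _ "dim_col C"]) auto

lemma mat_mult_add:
  fixes A :: "'a::semiring_0 mat"
  shows "dim_row B = dim_row C \<Longrightarrow> dim_col B = dim_col C \<Longrightarrow> dim_col A = dim_row B \<Longrightarrow>
    A * (B + C) = A * B + A * C"
  by (rule mult_add_distrib_mat[of _ "dim_row A" "dim_col A" _ "dim_col C"]) auto

lemma mat_minus_mult: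
  fixes A :: "'a::ring mat"
  shows "dim_row A = dim_row B \<Longrightarrow> dim_col A = dim_col B \<Longrightarrow> dim_col A = dim_row C \<Longrightarrow>
    (A - B) * C = A * C - B * C"
  by (rule minus_mult_distrib_mat[of _ "dim_row A" "dim_col A" _ _ "dim_col C"]) auto

lemma mat_mult_minus:
  fixes A :: "'a::ring mat"
  shows "dim_row B = dim_row C \<Longrightarrow> dim_col B = dim_col C \<Longrightarrow> dim_col A = dim_row B \<Longrightarrow>
    A * (B - C) = A * B - A * C"
  by (rule mult_minus_distrib_mat[of _ "dim_row A" "dim_col A" _ "dim_col C"]) auto

lemma mat_smult_mult:
  fixes A :: "'a::comm_semiring_0 mat"
  shows "dim_col A = dim_row B \<Longrightarrow> (k \<cdot>\<^sub>m A) * B = k \<cdot>\<^sub>m (A * B)"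
  by (rule eq_matI) auto

lemma mat_mult_smult:
  fixes A :: "'a::comm_semiring_0 mat"
  shows "dim_col A = dim_row B \<Longrightarrow> A * (k \<cdot>\<^sub>m B) = k \<cdot>\<^sub>m (A * B)"
  by (rule eq_matI) auto

lemma mat_transpose_mult:
  fixes A :: "'a::comm_semiring_0 mat"
  shows "dim_col A = dim_row B \<Longrightarrow> (A * B)\<^sup>T = B\<^sup>T * A\<^sup>T"
  by (rule transpose_mult[of _ "dim_row A" "dim_col A" _ "dim_col B"]) auto

lemma mat_transpose_add: 
  "dim_row A = dim_row B \<Longrightarrow> dim_col A = dim_col B \<Longrightarrow> (A + B)\<^sup>T = A\<^sup>T + B\<^sup>T"
  by (rule eq_matI) auto

lemma mat_transpose_minus: 
  "dim_row A = dim_row B \<Longrightarrow> dim_col A = dim_col B \<Longrightarrow> (A - B)\<^sup>T = A\<^sup>T - B\<^sup>T"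
  by (rule eq_matI) auto

lemma mat_transpose_smult: "(k \<cdot>\<^sub>m A)\<^sup>T = k \<cdot>\<^sub>m A\<^sup>T"
  by (rule eq_matI) auto

lemma mat_zero_add [simp]:
  fixes A :: "'a::monoid_add mat"
  shows "dim_row A = n \<Longrightarrow> dim_col A = m \<Longrightarrow> 0\<^sub>m n m + A = A"
    "dim_row A = n \<Longrightarrow> dim_col A = m \<Longrightarrow> A + 0\<^sub>m n m = A"
  by (auto intro!: eq_matI)

lemma mat_minus_self [simp]:
  fixes A :: "'a::group_add mat"
  shows "dim_row A = n \<Longrightarrow> dim_col A = m \<Longrightarrow> A - 0\<^sub>m n m = A"
    "A - A = 0\<^sub>m (dim_row A) (dim_col A)" "A + - A = 0\<^sub>m (dim_row A) (dim_col A)"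
    "- A + A = 0\<^sub>m (dim_row A) (dim_col A)"
  by (auto intro!: eq_matI)

lemma zero_smult_mat [simp]:
  fixes A :: "'a::semiring_0 mat"
  shows "0 \<cdot>\<^sub>m A = 0\<^sub>m (dim_row A) (dim_col A)"
  by (intro eq_matI) auto

lemma one_smult_mat [simp]:
  fixes A :: "'a::semiring_1 mat"
  shows "1 \<cdot>\<^sub>m A = A"
  by (intro eq_matI) auto

text \<open>The side conditions are equations between dimensions instead of carrier memberships:
  they introduce no new dimension variables, so the simplifier can discharge them while it
  normalizes products.\<close>

lemmas mat_distrib = mat_mult_assoc mat_add_mult mat_mult_add mat_minus_mult mat_mult_minus
  mat_smult_mult mat_mult_smult
lemmas mat_transpose = mat_transpose_mult mat_transpose_add mat_transpose_minus
  mat_transpose_smult transpose_uminus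

text \<open>In right-associated form a known product \<open>A * B\<close> is no longer a subterm of
  \<open>A * (B * X)\<close>; this version lets an equation for it act at the head of a longer
  product.\<close>

lemma mat_mult_assoc_eq:
  fixes A :: "'a::semiring_0 mat"
  assumes "A * B = C" "dim_col A = dim_row B" "dim_col B = dim_row X"
  shows "A * (B * X) = C * X"
  using assms by (metis mat_mult_assoc)

lemma mat_mult_vec_assoc:
  fixes A :: "'a::semiring_0 mat"
  shows "dim_col A = dim_row B \<Longrightarrow> dim_col B = dim_vec v \<Longrightarrow> A * B *\<^sub>v v = A *\<^sub>v (B *\<^sub>v v)"
  by (rule assoc_mult_mat_vec[of _ "dim_row A" "dim_row B" _ "dim_vec v"]) auto

lemma mat_mult_index_sum:
  fixes A :: "'a::semiring_0 mat"
  assumes "i < dim_row A" "j < dim_col B" "dim_col A = dim_row B"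
  shows "(A * B) $$ (i, j) = (\<Sum>k<dim_row B. A $$ (i, k) * B $$ (k, j))"
  using assms by (auto simp: scalar_prod_def atLeast0LessThan intro!: sum.cong)

lemma mat_mult_vec_index_sum:
  fixes A :: "'a::semiring_0 mat"
  assumes "i < dim_row A" "dim_col A = dim_vec v"
  shows "(A *\<^sub>v v) $ i = (\<Sum>k<dim_vec v. A $$ (i, k) * v $ k)"
  using assms by (auto simp: scalar_prod_def atLeast0LessThan intro!: sum.cong)

section \<open>The Frobenius inner product\<close>

lemma mat_inner_sum:
  assumes "dim_row A = n" "dim_row B = n" "dim_col A = q" "dim_col B = q"
  shows "mat_inner A B = (\<Sum>j<q. \<Sum>i<n. A $$ (i, j) * B $$ (i, j))"
proof -
  have "mat_inner A B = (\<Sum>j<q. (A\<^sup>T * B) $$ (j, j))"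
    using assms unfolding mat_inner_def diag_mat_def
    by (simp add: interv_sum_list_conv_sum_set_nat atLeast0LessThan del: index_mult_mat(1))
  then show ?thesis
    using assms by (simp add: mat_mult_index_sum del: index_mult_mat(1))
qed

lemma mat_inner_self_ge_0: "0 \<le> mat_inner A A"
  by (simp add: mat_inner_sum[OF refl refl refl refl] sum_nonneg)

lemma mat_inner_self_eq_0:
  assumes "mat_inner A A = 0"
  shows "A = 0\<^sub>m (dim_row A) (dim_col A)"
proof (rule eq_matI; clarsimp)
  fix i j assume ij: "i < dim_row A" "j < dim_col A"
  have "(\<Sum>j<dim_col A. \<Sum>i<dim_row A. A $$ (i, j) * A $$ (i, j)) = 0"
    using assms by (simp add: mat_inner_sum[OF refl refl refl refl])
  then have "\<forall>j\<in>{..<dim_col A}. (\<Sum>i<dim_row A. A $$ (i, j) * A $$ (i, j)) = 0"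
    by (subst (asm) sum_nonneg_eq_0_iff) (auto intro: sum_nonneg)
  then have "(\<Sum>i<dim_row A. A $$ (i, j) * A $$ (i, j)) = 0" using ij by auto
  then have "\<forall>i\<in>{..<dim_row A}. A $$ (i, j) * A $$ (i, j) = 0"
    by (subst (asm) sum_nonneg_eq_0_iff) auto
  then show "A $$ (i, j) = 0" using ij by auto
qed

lemma mat_inner_comm:
  "dim_row A = dim_row B \<Longrightarrow> dim_col A = dim_col B \<Longrightarrow> mat_inner A B = mat_inner B A"
  by (subst (1 2) mat_inner_sum[OF _ _ _ refl]) (auto simp: mult.commute)

lemma mat_inner_add_left:
  assumes "dim_row A = dim_row C" "dim_row B = dim_row C" "dim_col A = dim_col C" "dim_col B = dim_col C"
  shows "mat_inner (A + B) C = mat_inner A C + mat_inner B C"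
  using assms
  by (simp add: mat_inner_sum[where n="dim_row C" and q="dim_col C"] algebra_simps sum.distrib)

lemma mat_inner_minus_left:
  assumes "dim_row A = dim_row C" "dim_row B = dim_row C" "dim_col A = dim_col C" "dim_col B = dim_col C"
  shows "mat_inner (A - B) C = mat_inner A C - mat_inner B C"
  using assms
  by (simp add: mat_inner_sum[where n="dim_row C" and q="dim_col C"] algebra_simps sum_subtractf)

lemma mat_inner_uminus_left:
  assumes "dim_row A = dim_row C" "dim_col A = dim_col C"
  shows "mat_inner (- A) C = - mat_inner A C"
  using assms
  by (simp add: mat_inner_sum[where n="dim_row C" and q="dim_col C"] sum_negf)

lemma mat_inner_transpose:
  assumes "dim_row A = dim_row B" "dim_col A = dim_col B"
  shows "mat_inner A\<^sup>T B\<^sup>T = mat_inner A B"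
  using assms
  by (simp add: mat_inner_sum[where n="dim_row B" and q="dim_col B"]
      mat_inner_sum[where n="dim_col B" and q="dim_row B"]) (rule sum.swap)

lemma mat_inner_mult_left:
  assumes "dim_row A = dim_row C" "dim_col A = dim_row B" "dim_col B = dim_col C"
  shows "mat_inner (A * B) C = mat_inner B (A\<^sup>T * C)"
proof -
  have "mat_inner (A * B) C = sum_list (diag_mat ((A * B)\<^sup>T * C))" by (simp add: mat_inner_def)
  also have "(A * B)\<^sup>T * C = B\<^sup>T * (A\<^sup>T * C)"
    using assms by (simp add: mat_transpose_mult mat_mult_assoc)
  finally show ?thesis by (simp add: mat_inner_def)
qed

lemma mat_inner_mult_right:
  assumes "dim_row A = dim_row C" "dim_col A = dim_row B" "dim_col B = dim_col C"
  shows "mat_inner (A * B) C = mat_inner A (C * B\<^sup>T)"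
proof -
  have "mat_inner (A * B) C = mat_inner (A * B)\<^sup>T C\<^sup>T"
    using assms by (simp add: mat_inner_transpose)
  also have "\<dots> = mat_inner (B\<^sup>T * A\<^sup>T) C\<^sup>T" using assms by (simp add: mat_transpose_mult)
  also have "\<dots> = mat_inner A\<^sup>T (B * C\<^sup>T)"
    using assms by (subst mat_inner_mult_left) auto
  also have "\<dots> = mat_inner A\<^sup>T (C * B\<^sup>T)\<^sup>T" using assms by (simp add: mat_transpose_mult)
  also have "\<dots> = mat_inner A (C * B\<^sup>T)" using assms by (subst mat_inner_transpose) auto
  finally show ?thesis .
qed

text \<open>Transposing both arguments preserves the inner product, yet changes its sign here. This
  is what separates normal from tangent directions of the Stiefel manifold.\<close>

lemma mat_inner_sym_skew:
  assumes S: "S\<^sup>T = S" and A: "A\<^sup>T = - A" and d: "dim_row S = dim_row A"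
  shows "mat_inner S A = 0"
proof -
  have dims: "dim_col S = dim_row S" "dim_col A = dim_row A"
    using arg_cong[OF S, of dim_row] arg_cong[OF A, of dim_row] by auto
  have "mat_inner S A = mat_inner S\<^sup>T A\<^sup>T" using d dims by (simp add: mat_inner_transpose)
  also have "\<dots> = mat_inner S (- A)" by (simp only: S A)
  also have "\<dots> = mat_inner (- A) S" using d dims by (intro mat_inner_comm) auto
  also have "\<dots> = - mat_inner A S" using d dims by (intro mat_inner_uminus_left) auto
  also have "mat_inner A S = mat_inner S A" using d dims by (intro mat_inner_comm) auto
  finally show ?thesis by simp
qed

lemma mat_inner_zero_right [simp]: "mat_inner A (0\<^sub>m (dim_row A) (dim_col A)) = 0"
  by (simp add: mat_inner_sum[where n="dim_row A" and q="dim_col A"])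

section \<open>The matrix exponential\<close>

lemma mat_pow_transpose:
  fixes A :: "'a::comm_semiring_1 mat"
  assumes A: "A \<in> carrier_mat n n"
  shows "(A ^\<^sub>m k)\<^sup>T = A\<^sup>T ^\<^sub>m k"
proof (induction k)
  case (Suc k)
  have comm: "B * B ^\<^sub>m j = B ^\<^sub>m j * B" if "B \<in> carrier_mat n n" for B :: "'a mat" and j
    using that by (induction j) (auto simp: mat_mult_assoc[symmetric])
  show ?case
    using A Suc comm[of "A\<^sup>T" k] by (simp add: mat_transpose_mult)
qed (use A in auto)

lemma mat_pow_smult:
  fixes A :: "'a::comm_semiring_1 mat"
  assumes A: "A \<in> carrier_mat n n"
  shows "(t \<cdot>\<^sub>m A) ^\<^sub>m k = t ^ k \<cdot>\<^sub>m A ^\<^sub>m k"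
proof (induction k)
  case (Suc k)
  have "(t \<cdot>\<^sub>m A) ^\<^sub>m Suc k = (t ^ k \<cdot>\<^sub>m A ^\<^sub>m k) * (t \<cdot>\<^sub>m A)" using Suc by simp
  also have "\<dots> = t \<cdot>\<^sub>m (t ^ k \<cdot>\<^sub>m (A ^\<^sub>m k * A))"
    using A by (simp add: mat_smult_mult mat_mult_smult)
  also have "\<dots> = t ^ Suc k \<cdot>\<^sub>m A ^\<^sub>m Suc k"
    using A by (intro eq_matI) (auto simp: ac_simps)
  finally show ?case .
qed (use A in auto)

lemma mat_pow_intertwine:
  fixes A :: "'a::semiring_1 mat"
  assumes A: "A \<in> carrier_mat n n" and K: "K \<in> carrier_mat m m" and J: "J \<in> carrier_mat n m"
    and AJ: "A * J = J * K"
  shows "A ^\<^sub>m k * J = J * K ^\<^sub>m k"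
proof (induction k)
  case (Suc k)
  have "A ^\<^sub>m Suc k * J = A ^\<^sub>m k * (A * J)" using A K J by (simp add: mat_mult_assoc)
  also have "\<dots> = (A ^\<^sub>m k * J) * K" using A K J by (simp add: AJ mat_mult_assoc)
  also have "\<dots> = J * K ^\<^sub>m Suc k" using A K J by (simp add: Suc mat_mult_assoc)
  finally show ?case .
qed (use A K J in auto)

text \<open>Each multiplication sums n products and so costs a factor n c. The bound is crude, but
  it lets the exponential series of a number dominate every entry.\<close>

lemma mat_pow_entry_bound:
  fixes A :: "real mat"
  assumes A: "A \<in> carrier_mat n n" and c: "\<And>i j. i < n \<Longrightarrow> j < n \<Longrightarrow> \<bar>A $$ (i, j)\<bar> \<le> c"
    and "i < n" "j < n"
  shows "\<bar>(A ^\<^sub>m k) $$ (i, j)\<bar> \<le> (real n * c) ^ k"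
  using \<open>j < n\<close>
proof (induction k arbitrary: j)
  case (Suc k)
  have c0: "0 \<le> c" using c[OF \<open>i < n\<close> \<open>i < n\<close>] by linarith
  have "(A ^\<^sub>m Suc k) $$ (i, j) = (\<Sum>l<n. (A ^\<^sub>m k) $$ (i, l) * A $$ (l, j))"
    using A \<open>i < n\<close> Suc.prems by (simp add: mat_mult_index_sum del: index_mult_mat(1))
  also have "\<bar>\<dots>\<bar> \<le> (\<Sum>l<n. (real n * c) ^ k * c)"
    using c c0 Suc by (intro order.trans[OF sum_abs] sum_mono) (auto simp: abs_mult intro!: mult_mono)
  finally show ?case by (simp add: ac_simps)
qed (use A \<open>i < n\<close> in auto)

lemma mat_exp_carrier [simp]: "A \<in> carrier_mat n n \<Longrightarrow> mat_exp A \<in> carrier_mat n n"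
  by (auto simp: mat_exp_def)

lemma mat_exp_dim [simp]: "dim_row (mat_exp A) = dim_row A" "dim_col (mat_exp A) = dim_row A"
  by (auto simp: mat_exp_def)

lemma mat_exp_abs_summable:
  fixes A :: "real mat"
  assumes A: "A \<in> carrier_mat n n" and "i < n" "j < n"
  shows "summable (\<lambda>k. \<bar>(A ^\<^sub>m k) $$ (i, j) / fact k * t ^ k\<bar>)"
proof -
  define c where "c = Max ((\<lambda>(i, j). \<bar>A $$ (i, j)\<bar>) ` ({..<n} \<times> {..<n}))"
  have c: "\<bar>A $$ (i, j)\<bar> \<le> c" if "i < n" "j < n" for i j
    unfolding c_def using that by (intro Max_ge) auto
  have "summable (\<lambda>k. (real n * c * \<bar>t\<bar>) ^ k / fact k)"
    using summable_exp[of "real n * c * \<bar>t\<bar>"] by (simp add: divide_inverse mult.commute)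
  then show ?thesis
  proof (rule summable_comparison_test'[where N = 0])
    fix k
    have "\<bar>(A ^\<^sub>m k) $$ (i, j)\<bar> \<le> (real n * c) ^ k"
      using mat_pow_entry_bound[OF A, of c i j k] c assms(2,3) by blast
    then have "\<bar>(A ^\<^sub>m k) $$ (i, j)\<bar> * \<bar>t\<bar> ^ k / fact k \<le> (real n * c) ^ k * \<bar>t\<bar> ^ k / fact k"
      by (intro divide_right_mono mult_right_mono) auto
    then show "norm \<bar>(A ^\<^sub>m k) $$ (i, j) / fact k * t ^ k\<bar> \<le> (real n * c * \<bar>t\<bar>) ^ k / fact k"
      by (simp add: abs_mult power_abs power_mult_distrib)
  qed
qed

lemma mat_exp_sums:
  assumes A: "A \<in> carrier_mat n n" and "i < n" "j < n"
  shows "(\<lambda>k. (A ^\<^sub>m k) $$ (i, j) / fact k) sums (mat_exp A $$ (i, j))"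
proof -
  have "summable (\<lambda>k. (A ^\<^sub>m k) $$ (i, j) / fact k)"
    using mat_exp_abs_summable[OF assms, of 1]
    by (subst summable_rabs_cancel) simp_all
  then show ?thesis using assms by (simp add: mat_exp_def summable_sums)
qed

lemma mat_exp_zero [simp]: "mat_exp (0\<^sub>m n n) = 1\<^sub>m n"
proof (rule eq_matI)
  fix i j assume "i < dim_row (1\<^sub>m n :: real mat)" "j < dim_col (1\<^sub>m n :: real mat)"
  then have ij: "i < n" "j < n" by auto
  have pow: "(0\<^sub>m n n :: real mat) ^\<^sub>m k = (if k = 0 then 1\<^sub>m n else 0\<^sub>m n n)" for k
    by (induction k) auto
  have "(\<lambda>k. ((0\<^sub>m n n :: real mat) ^\<^sub>m k) $$ (i, j) / fact k) =
    (\<lambda>k. if k = 0 then (1\<^sub>m n :: real mat) $$ (i, j) else 0)"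
    using ij by (auto simp: pow)
  then have "(\<lambda>k. ((0\<^sub>m n n :: real mat) ^\<^sub>m k) $$ (i, j) / fact k) sums ((1\<^sub>m n :: real mat) $$ (i, j))"
    using sums_If_finite_set[of "{0::nat}" "\<lambda>_. (1\<^sub>m n :: real mat) $$ (i, j)"] by simp
  from sums_unique2[OF mat_exp_sums[OF zero_carrier_mat ij] this]
  show "mat_exp (0\<^sub>m n n) $$ (i, j) = (1\<^sub>m n :: real mat) $$ (i, j)" .
qed auto

lemma mat_exp_transpose:
  assumes A: "A \<in> carrier_mat n n"
  shows "(mat_exp A)\<^sup>T = mat_exp A\<^sup>T"
proof (rule eq_matI; insert A; simp)
  fix i j assume ij: "i < n" "j < n"
  have "(A\<^sup>T ^\<^sub>m k) $$ (i, j) = (A ^\<^sub>m k) $$ (j, i)" for k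
    using ij A by (subst mat_pow_transpose[OF A, symmetric]) auto
  then show "mat_exp A $$ (j, i) = mat_exp A\<^sup>T $$ (i, j)"
    using mat_exp_sums[OF A ij(2,1)] mat_exp_sums[of "A\<^sup>T" n i j] A ij
    by (auto intro: sums_unique2)
qed

text \<open>Powers intertwine, and so do their series. A rectangular \<open>J\<close> covers
  commutation, conjugation by a reflection and the passage from an n x n generator to a small block
  matrix alike.\<close>

lemma mat_exp_intertwine:
  assumes A: "A \<in> carrier_mat n n" and K: "K \<in> carrier_mat m m" and J: "J \<in> carrier_mat n m"
    and AJ: "A * J = J * K"
  shows "mat_exp A * J = J * mat_exp K"
proof (rule eq_matI)
  fix i j assume "i < dim_row (J * mat_exp K)" "j < dim_col (J * mat_exp K)"
  then have ij: "i < n" "j < m" using J K by auto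
  have "(\<lambda>k. \<Sum>l<n. (A ^\<^sub>m k) $$ (i, l) / fact k * J $$ (l, j)) sums
      (\<Sum>l<n. mat_exp A $$ (i, l) * J $$ (l, j))"
    using A ij by (intro sums_sum sums_mult2 mat_exp_sums) auto
  moreover have "(\<lambda>k. \<Sum>l<m. J $$ (i, l) * ((K ^\<^sub>m k) $$ (l, j) / fact k)) sums
      (\<Sum>l<m. J $$ (i, l) * mat_exp K $$ (l, j))"
    using K ij by (intro sums_sum sums_mult mat_exp_sums) auto
  moreover have "(\<Sum>l<n. (A ^\<^sub>m k) $$ (i, l) / fact k * J $$ (l, j)) =
      (\<Sum>l<m. J $$ (i, l) * ((K ^\<^sub>m k) $$ (l, j) / fact k))" for k
  proof -
    have "(\<Sum>l<n. (A ^\<^sub>m k) $$ (i, l) * J $$ (l, j)) = (A ^\<^sub>m k * J) $$ (i, j)"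
      using A J ij by (simp add: mat_mult_index_sum del: index_mult_mat(1))
    also have "\<dots> = (J * K ^\<^sub>m k) $$ (i, j)"
      by (simp only: mat_pow_intertwine[OF assms])
    also have "\<dots> = (\<Sum>l<m. J $$ (i, l) * (K ^\<^sub>m k) $$ (l, j))"
      using K J ij by (simp add: mat_mult_index_sum del: index_mult_mat(1))
    finally show ?thesis by (simp add: sum_divide_distrib[symmetric])
  qed
  ultimately have "(\<Sum>l<n. mat_exp A $$ (i, l) * J $$ (l, j)) = (\<Sum>l<m. J $$ (i, l) * mat_exp K $$ (l, j))"
    by (auto intro: sums_unique2)
  then show "(mat_exp A * J) $$ (i, j) = (J * mat_exp K) $$ (i, j)"
    using A K J ij by (simp add: mat_mult_index_sum del: index_mult_mat(1))
qed (use A K J in auto)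

section \<open>Entrywise derivatives of matrix-valued curves\<close>

lemma has_mat_derivativeI:
  assumes "\<And>s. c s \<in> carrier_mat n q" "D \<in> carrier_mat n q"
    and "\<And>i j. i < n \<Longrightarrow> j < q \<Longrightarrow> ((\<lambda>s. c s $$ (i, j)) has_real_derivative D $$ (i, j)) (at t)"
  shows "has_mat_derivative c D t"
  using assms by (auto simp: has_mat_derivative_def)

lemma has_mat_derivativeD:
  assumes "has_mat_derivative c D t"
  shows "dim_row (c s) = dim_row D" "dim_col (c s) = dim_col D"
    "i < dim_row D \<Longrightarrow> j < dim_col D \<Longrightarrow>
      ((\<lambda>s. c s $$ (i, j)) has_real_derivative D $$ (i, j)) (at t)"
  using assms unfolding has_mat_derivative_def by (auto dest: carrier_matD)

lemma has_mat_derivative_unique: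
  assumes "has_mat_derivative c D t" "has_mat_derivative c D' t"
  shows "D = D'"
  using has_mat_derivativeD(1,2)[OF assms(1), of 0] has_mat_derivativeD(1,2)[OF assms(2), of 0]
  by (intro eq_matI)
    (auto intro: DERIV_unique[OF has_mat_derivativeD(3)[OF assms(1)] has_mat_derivativeD(3)[OF assms(2)]])

lemma has_mat_derivative_const: "has_mat_derivative (\<lambda>_. A) (0\<^sub>m (dim_row A) (dim_col A)) t"
  by (rule has_mat_derivativeI) auto

lemma has_mat_derivative_transpose:
  assumes "has_mat_derivative c D t"
  shows "has_mat_derivative (\<lambda>s. (c s)\<^sup>T) D\<^sup>T t"
  using has_mat_derivativeD[OF assms]
  by (intro has_mat_derivativeI[of _ "dim_col D" "dim_row D"]) auto

lemma has_mat_derivative_add: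
  assumes "has_mat_derivative c D t" "has_mat_derivative e E t"
    and "dim_row D = dim_row E" "dim_col D = dim_col E"
  shows "has_mat_derivative (\<lambda>s. c s + e s) (D + E) t"
  using has_mat_derivativeD[OF assms(1)] has_mat_derivativeD[OF assms(2)] assms(3,4)
  by (intro has_mat_derivativeI[of _ "dim_row D" "dim_col D"]) (auto intro!: DERIV_add)

lemma has_mat_derivative_mult:
  assumes c: "has_mat_derivative c D t" and e: "has_mat_derivative e E t"
    and "dim_col D = dim_row E"
  shows "has_mat_derivative (\<lambda>s. c s * e s) (D * e t + c t * E) t"
proof -
  note dims = has_mat_derivativeD(1,2)[OF c] has_mat_derivativeD(1,2)[OF e] assms(3)
  show ?thesis
  proof (rule has_mat_derivativeI[of _ "dim_row D" "dim_col E"])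
    fix i j assume ij: "i < dim_row D" "j < dim_col E"
    have "((\<lambda>s. \<Sum>k<dim_row E. c s $$ (i, k) * e s $$ (k, j)) has_real_derivative
        (\<Sum>k<dim_row E. D $$ (i, k) * e t $$ (k, j) + E $$ (k, j) * c t $$ (i, k))) (at t)"
      using ij dims
      by (intro DERIV_sum DERIV_mult has_mat_derivativeD(3)[OF c] has_mat_derivativeD(3)[OF e]) auto
    then show "((\<lambda>s. (c s * e s) $$ (i, j)) has_real_derivative (D * e t + c t * E) $$ (i, j)) (at t)"
      using ij dims
      by (simp add: mat_mult_index_sum sum.distrib mult.commute del: index_mult_mat(1))
  qed (use dims in auto)
qed

lemma has_mat_derivative_mult_const:
  assumes c: "has_mat_derivative c D t" and "dim_col D = dim_row B"
  shows "has_mat_derivative (\<lambda>s. c s * B) (D * B) t"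
  using has_mat_derivative_mult[OF c has_mat_derivative_const[of B]] has_mat_derivativeD(1,2)[OF c] assms(2)
  by simp

lemma has_mat_derivative_const_mult:
  assumes c: "has_mat_derivative c D t" and "dim_col B = dim_row D"
  shows "has_mat_derivative (\<lambda>s. B * c s) (B * D) t"
  using has_mat_derivative_mult[OF has_mat_derivative_const[of B] c] has_mat_derivativeD(1,2)[OF c] assms(2)
  by simp

lemma has_mat_derivative_zero_imp_const:
  assumes "\<And>t. has_mat_derivative c (0\<^sub>m n q) t"
  shows "c t = c 0"
proof (rule eq_matI)
  fix i j assume "i < dim_row (c 0)" "j < dim_col (c 0)"
  then show "c t $$ (i, j) = c 0 $$ (i, j)"
    using has_mat_derivativeD[OF assms]
    by (intro DERIV_isconst_all[of "\<lambda>t. c t $$ (i, j)" t 0]) auto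
qed (use has_mat_derivativeD(1,2)[OF assms] in auto)

lemma DERIV_mat_inner:
  assumes c: "has_mat_derivative c D t" and e: "has_mat_derivative e E t"
    and "dim_row D = dim_row E" "dim_col D = dim_col E"
  shows "((\<lambda>s. mat_inner (c s) (e s)) has_real_derivative mat_inner D (e t) + mat_inner (c t) E) (at t)"
proof -
  note dims = has_mat_derivativeD(1,2)[OF c] has_mat_derivativeD(1,2)[OF e] assms(3,4)
  have "((\<lambda>s. \<Sum>j<dim_col E. \<Sum>i<dim_row E. c s $$ (i, j) * e s $$ (i, j)) has_real_derivative
        (\<Sum>j<dim_col E. \<Sum>i<dim_row E. D $$ (i, j) * e t $$ (i, j) + E $$ (i, j) * c t $$ (i, j))) (at t)"
    using dims
    by (intro DERIV_sum DERIV_mult has_mat_derivativeD(3)[OF c] has_mat_derivativeD(3)[OF e]) auto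
  then show ?thesis
    using dims by (simp add: mat_inner_sum[where n="dim_row E" and q="dim_col E"] sum.distrib mult.commute)
qed

section \<open>The exponential as a flow\<close>

lemma mat_exp_derivative:
  assumes A: "A \<in> carrier_mat n n"
  shows "has_mat_derivative (\<lambda>t. mat_exp (t \<cdot>\<^sub>m A)) (A * mat_exp (t \<cdot>\<^sub>m A)) t"
proof (rule has_mat_derivativeI[of _ n n])
  fix i j assume ij: "i < n" "j < n"
  define c where "c i k = (A ^\<^sub>m k) $$ (i, j) / fact k" for i k
  have sums: "(\<lambda>k. c i k * t ^ k) sums (mat_exp (t \<cdot>\<^sub>m A) $$ (i, j))" if "i < n" for i t
  proof -
    have "((t \<cdot>\<^sub>m A) ^\<^sub>m k) $$ (i, j) / fact k = c i k * t ^ k" for k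
      using that ij A by (simp add: mat_pow_smult[OF A] c_def)
    then show ?thesis using mat_exp_sums[of "t \<cdot>\<^sub>m A" n i j] that ij A by simp
  qed
  have "((\<lambda>t. \<Sum>k. c i k * t ^ k) has_field_derivative (\<Sum>k. diffs (c i) k * t ^ k)) (at t)"
    using sums[OF ij(1)] by (intro termdiffs_strong_converges_everywhere) (rule sums_summable)
  moreover have "(\<lambda>t. \<Sum>k. c i k * t ^ k) = (\<lambda>t. mat_exp (t \<cdot>\<^sub>m A) $$ (i, j))"
    using sums[OF ij(1)] by (auto simp: sums_iff)
  \<comment> \<open>\<open>diffs\<close> turns the coefficient at k into the entry of
    \<open>A ^\<^sub>m Suc k\<close> divided by \<open>fact k\<close>; the additional factor A is
    split off on the left.\<close>
  moreover have "(\<Sum>k. diffs (c i) k * t ^ k) = (A * mat_exp (t \<cdot>\<^sub>m A)) $$ (i, j)"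
  proof -
    have "(\<lambda>k. \<Sum>l<n. A $$ (i, l) * (c l k * t ^ k)) sums (\<Sum>l<n. A $$ (i, l) * mat_exp (t \<cdot>\<^sub>m A) $$ (l, j))"
      by (intro sums_sum sums_mult sums) auto
    moreover have "(\<Sum>l<n. A $$ (i, l) * (c l k * t ^ k)) = diffs (c i) k * t ^ k" for k
    proof -
      have "(\<Sum>l<n. A $$ (i, l) * (A ^\<^sub>m k) $$ (l, j)) = (A * A ^\<^sub>m k) $$ (i, j)"
        using A ij by (simp add: mat_mult_index_sum del: index_mult_mat(1))
      also have "A * A ^\<^sub>m k = A ^\<^sub>m Suc k"
        using mat_pow_intertwine[OF A A A refl, of k] by simp
      finally have eq: "(\<Sum>l<n. A $$ (i, l) * (A ^\<^sub>m k) $$ (l, j)) = (A ^\<^sub>m Suc k) $$ (i, j)" .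
      have "(\<Sum>l<n. A $$ (i, l) * (c l k * t ^ k)) = (\<Sum>l<n. A $$ (i, l) * (A ^\<^sub>m k) $$ (l, j)) / fact k * t ^ k"
        by (simp add: c_def sum_divide_distrib sum_distrib_right mult.assoc)
      also have "\<dots> = diffs (c i) k * t ^ k"
        unfolding eq by (simp add: diffs_def c_def fact_Suc del: pow_mat.simps of_nat_Suc)
      finally show ?thesis .
    qed
    ultimately show ?thesis
      using A ij by (simp add: mat_mult_index_sum sums_iff del: index_mult_mat(1))
  qed
  ultimately show "((\<lambda>s. mat_exp (s \<cdot>\<^sub>m A) $$ (i, j)) has_real_derivative
      (A * mat_exp (t \<cdot>\<^sub>m A)) $$ (i, j)) (at t)" by simp
qed (use A in auto)

lemma mat_exp_commute:
  assumes A: "A \<in> carrier_mat n n"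
  shows "mat_exp (t \<cdot>\<^sub>m A) * A = A * mat_exp (t \<cdot>\<^sub>m A)"
  using A by (intro mat_exp_intertwine[of _ n _ n]) (auto simp: mat_smult_mult mat_mult_smult)

text \<open>For skew-symmetric \<open>\<Omega>\<close> the flow of \<open>X' = \<Omega> X\<close> preserves the Frobenius norm, which makes
  the initial value problem uniquely solvable without any Gronwall estimate.\<close>

lemma mat_exp_skew_ode_unique:
  assumes \<Omega>: "\<Omega> \<in> carrier_mat n n" "\<Omega>\<^sup>T = - \<Omega>"
    and F: "\<And>t. has_mat_derivative F (\<Omega> * F t) t"
  shows "F t = mat_exp (t \<cdot>\<^sub>m \<Omega>) * F 0"
proof -
  define q where "q = dim_col (F 0)"
  have dF: "dim_row (F t) = n" "dim_col (F t) = q" for t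
    using has_mat_derivativeD(1)[OF F, of t 0] has_mat_derivativeD(2)[OF F, of 0 t]
    unfolding q_def using \<Omega> by auto
  \<comment> \<open>The difference of the two solutions, written as a sum with a scalar factor
    because sums and products are what the derivative rules cover.\<close>
  define G where "G t = F t + (-1) \<cdot>\<^sub>m (mat_exp (t \<cdot>\<^sub>m \<Omega>) * F 0)" for t
  have dG: "dim_row (G t) = n" "dim_col (G t) = q" for t
    using \<Omega> dF by (auto simp: G_def)
  have G': "has_mat_derivative G (\<Omega> * G t) t" for t
  proof -
    have "has_mat_derivative (\<lambda>t. mat_exp (t \<cdot>\<^sub>m \<Omega>) * F 0) (\<Omega> * mat_exp (t \<cdot>\<^sub>m \<Omega>) * F 0) t"
      using \<Omega> dF by (intro has_mat_derivative_mult_const mat_exp_derivative) auto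
    then have "has_mat_derivative (\<lambda>t. ((-1) \<cdot>\<^sub>m 1\<^sub>m n) * (mat_exp (t \<cdot>\<^sub>m \<Omega>) * F 0))
        (((-1) \<cdot>\<^sub>m 1\<^sub>m n) * (\<Omega> * mat_exp (t \<cdot>\<^sub>m \<Omega>) * F 0)) t"
      using \<Omega> by (intro has_mat_derivative_const_mult) auto
    then have "has_mat_derivative (\<lambda>t. (-1) \<cdot>\<^sub>m (mat_exp (t \<cdot>\<^sub>m \<Omega>) * F 0))
        ((-1) \<cdot>\<^sub>m (\<Omega> * mat_exp (t \<cdot>\<^sub>m \<Omega>) * F 0)) t"
      using \<Omega> by (simp add: mat_smult_mult)
    from has_mat_derivative_add[OF F this]
    show ?thesis using \<Omega> dF unfolding G_def by (simp add: mat_distrib)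
  qed
  have "((\<lambda>t. mat_inner (G t) (G t)) has_real_derivative 0) (at t)" for t
  proof -
    have "mat_inner (\<Omega> * G t) (G t) = mat_inner (G t) (\<Omega>\<^sup>T * G t)"
      using \<Omega> dG by (subst mat_inner_mult_left) auto
    also have "\<dots> = mat_inner (- (\<Omega> * G t)) (G t)"
      using \<Omega> dG by (subst mat_inner_comm) auto
    also have "\<dots> = - mat_inner (\<Omega> * G t) (G t)"
      using \<Omega> dG by (subst mat_inner_uminus_left) auto
    finally have 0: "mat_inner (\<Omega> * G t) (G t) = 0" by simp
    then have "mat_inner (G t) (\<Omega> * G t) = 0"
      using \<Omega> dG by (subst mat_inner_comm) auto
    with 0 show ?thesis using DERIV_mat_inner[OF G'[of t] G'[of t]] by simp
  qed
  then have "mat_inner (G t) (G t) = mat_inner (G 0) (G 0)"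
    by (intro DERIV_isconst_all[of "\<lambda>t. mat_inner (G t) (G t)"]) auto
  moreover have "G 0 = 0\<^sub>m n q" using dF \<Omega> by (intro eq_matI) (auto simp: G_def)
  ultimately have "mat_inner (G t) (G t) = 0"
    using mat_inner_zero_right[of "0\<^sub>m n q"] by simp
  then have G0: "G t = 0\<^sub>m n q" using mat_inner_self_eq_0[of "G t"] dG by simp
  show ?thesis
  proof (rule eq_matI)
    fix i j assume "i < dim_row (mat_exp (t \<cdot>\<^sub>m \<Omega>) * F 0)" "j < dim_col (mat_exp (t \<cdot>\<^sub>m \<Omega>) * F 0)"
    then show "F t $$ (i, j) = (mat_exp (t \<cdot>\<^sub>m \<Omega>) * F 0) $$ (i, j)"
      using arg_cong[OF G0, of "\<lambda>M. M $$ (i, j)"] dF \<Omega> by (simp add: G_def)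
  qed (use \<Omega> dF in auto)
qed

text \<open>In the derivative of \<open>E\<^sup>T * E\<close> only the symmetric part of \<Omega>
  survives, and that is zero.\<close>

lemma mat_exp_skew_orthogonal:
  assumes \<Omega>: "\<Omega> \<in> carrier_mat n n" "\<Omega>\<^sup>T = - \<Omega>"
  shows "(mat_exp (t \<cdot>\<^sub>m \<Omega>))\<^sup>T * mat_exp (t \<cdot>\<^sub>m \<Omega>) = 1\<^sub>m n"
proof -
  define E where "E t = mat_exp (t \<cdot>\<^sub>m \<Omega>)" for t
  have dE: "dim_row (E t) = n" "dim_col (E t) = n" for t using \<Omega> by (auto simp: E_def)
  have E': "has_mat_derivative E (\<Omega> * E t) t" for t
    unfolding E_def by (rule mat_exp_derivative[OF \<Omega>(1)])
  have "has_mat_derivative (\<lambda>t. (E t)\<^sup>T * E t) ((\<Omega> * E t)\<^sup>T * E t + (E t)\<^sup>T * (\<Omega> * E t)) t" for t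
    using \<Omega> dE by (intro has_mat_derivative_mult has_mat_derivative_transpose E') auto
  moreover have "(\<Omega> * E t)\<^sup>T * E t + (E t)\<^sup>T * (\<Omega> * E t) = 0\<^sub>m n n" for t
    using \<Omega> dE by (simp add: mat_transpose mat_distrib)
  ultimately have "has_mat_derivative (\<lambda>t. (E t)\<^sup>T * E t) (0\<^sub>m n n) t" for t by simp
  from has_mat_derivative_zero_imp_const[OF this, of t]
  have "(E t)\<^sup>T * E t = (E 0)\<^sup>T * E 0" .
  then show ?thesis using \<Omega> by (simp add: E_def)
qed

text \<open>The square of the flow of \<Omega> and the flow of 2\<Omega> solve the same initial
  value problem; uniqueness for skew generators takes the place of an addition formula.\<close>

lemma mat_exp_skew_double:
  assumes \<Omega>: "\<Omega> \<in> carrier_mat n n" "\<Omega>\<^sup>T = - \<Omega>"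
  shows "mat_exp (2 \<cdot>\<^sub>m \<Omega>) = mat_exp \<Omega> * mat_exp \<Omega>"
proof -
  define E where "E t = mat_exp (t \<cdot>\<^sub>m \<Omega>)" for t
  have dE: "dim_row (E t) = n" "dim_col (E t) = n" for t using \<Omega> by (auto simp: E_def)
  have E': "has_mat_derivative E (\<Omega> * E t) t" for t
    unfolding E_def by (rule mat_exp_derivative[OF \<Omega>(1)])
  have comm: "E t * \<Omega> = \<Omega> * E t" for t unfolding E_def by (rule mat_exp_commute[OF \<Omega>(1)])
  have comm': "E t * (\<Omega> * X) = \<Omega> * (E t * X)" if "dim_row X = n" for t X
    using mat_mult_assoc_eq[OF comm[of t], of X] \<Omega> dE that by (simp add: mat_mult_assoc)
  have "has_mat_derivative (\<lambda>t. E t * E t) (\<Omega> * E t * E t + E t * (\<Omega> * E t)) t" for t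
    using \<Omega> dE by (intro has_mat_derivative_mult E') auto
  moreover have "\<Omega> * E t * E t + E t * (\<Omega> * E t) = (2 \<cdot>\<^sub>m \<Omega>) * (E t * E t)" for t
    using \<Omega> dE by (simp add: mat_distrib comm') (intro eq_matI, auto)
  ultimately have ode: "has_mat_derivative (\<lambda>t. E t * E t) ((2 \<cdot>\<^sub>m \<Omega>) * (E t * E t)) t" for t by simp
  have skew2: "(2 \<cdot>\<^sub>m \<Omega>)\<^sup>T = - (2 \<cdot>\<^sub>m \<Omega>)"
    using \<Omega> by (simp add: mat_transpose) (intro eq_matI, auto)
  from mat_exp_skew_ode_unique[OF _ skew2 ode, of n 1]
  have "E 1 * E 1 = mat_exp (1 \<cdot>\<^sub>m (2 \<cdot>\<^sub>m \<Omega>)) * (E 0 * E 0)"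
    using \<Omega> skew2 by simp
  then show ?thesis using \<Omega> by (simp add: E_def)
qed

section \<open>The real spectral theorem\<close>

text \<open>For a complex eigenvector a + i b with eigenvalue z, symmetry equates
  \<open>b\<^sup>T A a\<close> with \<open>a\<^sup>T A b\<close>, which leaves Im z (|a|^2 + |b|^2)
  = 0. Once z is real, whichever of a and b is nonzero is a real eigenvector.\<close>

lemma real_symmetric_eigenvector:
  fixes A :: "real mat"
  assumes A: "A \<in> carrier_mat n n" "A\<^sup>T = A" and n: "0 < n"
  obtains l v where "v \<in> carrier_vec n" "v \<bullet> v = 1" "A *\<^sub>v v = l \<cdot>\<^sub>v v"
proof -
  let ?A = "map_mat complex_of_real A"
  have cA: "?A \<in> carrier_mat n n" using A by simp
  have "degree (char_poly ?A) = n" using degree_monic_char_poly[OF cA] by simp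
  then have "\<not> constant (poly (char_poly ?A))" using n by (simp add: constant_degree)
  then obtain z where "poly (char_poly ?A) z = 0" using fundamental_theorem_of_algebra by blast
  then have "eigenvalue ?A z" using eigenvalue_root_char_poly[OF cA] by simp
  then obtain x where x: "x \<in> carrier_vec n" "x \<noteq> 0\<^sub>v n" "?A *\<^sub>v x = z \<cdot>\<^sub>v x"
    using cA unfolding eigenvalue_def eigenvector_def by auto
  define a where "a = map_vec Re x"
  define b where "b = map_vec Im x"
  have dab: "a \<in> carrier_vec n" "b \<in> carrier_vec n" using x by (auto simp: a_def b_def)
  have ev: "(\<Sum>j<n. complex_of_real (A $$ (i, j)) * x $ j) = z * x $ i" if "i < n" for i
    using arg_cong[OF x(3), of "\<lambda>v. v $ i"] that x(1) A
    by (simp add: mat_mult_vec_index_sum del: index_mult_mat_vec)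
  have Ra: "(\<Sum>j<n. A $$ (i, j) * a $ j) = Re z * a $ i - Im z * b $ i" if "i < n" for i
    using arg_cong[OF ev[OF that], of Re] that x by (simp add: a_def b_def)
  have Ib: "(\<Sum>j<n. A $$ (i, j) * b $ j) = Re z * b $ i + Im z * a $ i" if "i < n" for i
    using arg_cong[OF ev[OF that], of Im] that x by (simp add: a_def b_def)
  have sym: "A $$ (i, j) = A $$ (j, i)" if "i < n" "j < n" for i j
    using arg_cong[OF A(2), of "\<lambda>M. M $$ (i, j)"] that A(1) by simp
  have "(\<Sum>i<n. b $ i * (\<Sum>j<n. A $$ (i, j) * a $ j)) = (\<Sum>i<n. \<Sum>j<n. b $ i * (A $$ (i, j) * a $ j))"
    by (simp add: sum_distrib_left)
  also have "\<dots> = (\<Sum>j<n. \<Sum>i<n. b $ i * (A $$ (i, j) * a $ j))" by (rule sum.swap)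
  also have "\<dots> = (\<Sum>j<n. \<Sum>i<n. a $ j * (A $$ (j, i) * b $ i))"
    using sym by (intro sum.cong) (auto simp: ac_simps)
  also have "\<dots> = (\<Sum>i<n. a $ i * (\<Sum>j<n. A $$ (i, j) * b $ j))"
    by (simp add: sum_distrib_left)
  finally have "(\<Sum>i<n. b $ i * (Re z * a $ i - Im z * b $ i)) =
      (\<Sum>i<n. a $ i * (Re z * b $ i + Im z * a $ i))"
    by (simp add: Ra Ib)
  then have "(\<Sum>i<n. a $ i * (Re z * b $ i + Im z * a $ i) - b $ i * (Re z * a $ i - Im z * b $ i)) = 0"
    by (simp add: sum_subtractf)
  also have "(\<Sum>i<n. a $ i * (Re z * b $ i + Im z * a $ i) - b $ i * (Re z * a $ i - Im z * b $ i)) =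
      Im z * (\<Sum>i<n. a $ i * a $ i + b $ i * b $ i)"
    by (simp add: sum_distrib_left algebra_simps)
  finally have Im0: "Im z * (\<Sum>i<n. a $ i * a $ i + b $ i * b $ i) = 0" .
  obtain k where k: "k < n" "x $ k \<noteq> 0" using x(1,2) by (metis carrier_vecD eq_vecI index_zero_vec)
  have "0 < a $ k * a $ k + b $ k * b $ k"
    using k x by (simp add: a_def b_def complex_eq_iff sum_squares_gt_zero_iff)
  also have "\<dots> \<le> (\<Sum>i<n. a $ i * a $ i + b $ i * b $ i)"
    using k by (intro member_le_sum) auto
  finally have Imz: "Im z = 0" using Im0 by simp
  have eva: "A *\<^sub>v a = Re z \<cdot>\<^sub>v a" and evb: "A *\<^sub>v b = Re z \<cdot>\<^sub>v b"
    using Ra Ib Imz A dab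
    by (auto simp: mat_mult_vec_index_sum simp del: index_mult_mat_vec intro!: eq_vecI)
  define u where "u = (if a = 0\<^sub>v n then b else a)"
  have u: "u \<in> carrier_vec n" "A *\<^sub>v u = Re z \<cdot>\<^sub>v u" using eva evb dab by (auto simp: u_def)
  have "u \<noteq> 0\<^sub>v n"
  proof
    assume "u = 0\<^sub>v n"
    then have "a = 0\<^sub>v n" "b = 0\<^sub>v n" unfolding u_def by (auto split: if_splits)
    then have "a $ k = 0" "b $ k = 0" using k by auto
    then show False using k x by (simp add: a_def b_def complex_eq_iff)
  qed
  then obtain l where "l < n" "u $ l \<noteq> 0" using u(1) by (metis carrier_vecD eq_vecI index_zero_vec)
  then have "0 < (\<Sum>i<n. u $ i * u $ i)" by (intro sum_pos2[of _ l]) (auto simp: zero_less_mult_iff)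
  then have uu: "0 < u \<bullet> u" using u(1) by (simp add: scalar_prod_def atLeast0LessThan)
  define v where "v = (1 / sqrt (u \<bullet> u)) \<cdot>\<^sub>v u"
  have "v \<bullet> v = 1" using u(1) uu by (simp add: v_def)
  moreover have "A *\<^sub>v v = Re z \<cdot>\<^sub>v v"
    unfolding v_def using u A by (simp add: mult_mat_vec smult_smult_assoc mult.commute)
  moreover have "v \<in> carrier_vec n" using u by (simp add: v_def)
  ultimately show thesis using that by blast
qed

text \<open>The reflection in the hyperplane orthogonal to \<open>v - unit_vec n 0\<close>
  interchanges these two unit vectors.\<close>

lemma householder_reflection:
  fixes v :: "real vec"
  assumes v: "v \<in> carrier_vec n" "v \<bullet> v = 1" and n: "0 < n"
  obtains H where "H \<in> carrier_mat n n" "H\<^sup>T = H" "H * H = 1\<^sub>m n" "H *\<^sub>v unit_vec n 0 = v"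
proof
  define w where "w = v - unit_vec n 0"
  define s where "s = (\<Sum>i<n. w $ i * w $ i)"
  define W where "W = mat n 1 (\<lambda>(i, j). w $ i)"
  define N where "N = W * W\<^sup>T"
  \<comment> \<open>If v is the unit vector itself, then s = 0, and the convention
    \<open>2 / 0 = 0\<close> makes H the identity, which is the right choice in this case.\<close>
  define H where "H = 1\<^sub>m n - (2 / s) \<cdot>\<^sub>m N"
  have dW: "W \<in> carrier_mat n 1" and dN: "N \<in> carrier_mat n n" by (auto simp: W_def N_def)
  have Nij: "N $$ (i, j) = w $ i * w $ j" if "i < n" "j < n" for i j
    using that by (simp add: N_def W_def scalar_prod_def)
  have WW: "W\<^sup>T * W = s \<cdot>\<^sub>m 1\<^sub>m 1"
    by (auto simp: W_def s_def scalar_prod_def atLeast0LessThan intro!: eq_matI)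
  have NN: "N * N = s \<cdot>\<^sub>m N"
    using dW mat_mult_assoc_eq[OF WW, of "W\<^sup>T"] by (simp add: N_def mat_distrib)
  show "H \<in> carrier_mat n n" using dN by (simp add: H_def minus_carrier_mat)
  have "N\<^sup>T = N" using dW by (simp add: N_def mat_transpose)
  then show "H\<^sup>T = H" using dN by (simp add: H_def mat_transpose)
  show "H * H = 1\<^sub>m n"
    unfolding H_def using dN
    by (auto simp: mat_distrib NN intro!: eq_matI)
  have vv: "(\<Sum>i<n. v $ i * v $ i) = 1" using v by (simp add: scalar_prod_def atLeast0LessThan)
  have s: "s = 2 - 2 * v $ 0"
  proof -
    have "s = (\<Sum>i<n. v $ i * v $ i - (if i = 0 then 2 * v $ 0 else 0) + (if i = 0 then 1 else 0))"
      unfolding s_def using v by (intro sum.cong) (auto simp: w_def unit_vec_def algebra_simps)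
    also have "\<dots> = (\<Sum>i<n. v $ i * v $ i) - (\<Sum>i<n. if i = 0 then 2 * v $ 0 else 0) + (\<Sum>i<n. if i = 0 then 1 else 0)"
      by (simp add: sum.distrib sum_subtractf)
    also have "\<dots> = 2 - 2 * v $ 0" using n vv by (simp add: sum.delta)
    finally show ?thesis .
  qed
  have w0: "w $ 0 = v $ 0 - 1" using n v by (simp add: w_def)
  show "H *\<^sub>v unit_vec n 0 = v"
  proof (rule eq_vecI)
    fix i assume i: "i < dim_vec v"
    then have i': "i < n" using v by simp
    have "(H *\<^sub>v unit_vec n 0) $ i = H $$ (i, 0)"
      using i' n dN by (simp add: H_def)
    also have "\<dots> = (if i = 0 then 1 else 0) - 2 / s * (w $ i * w $ 0)"
      using i' n dN Nij by (simp add: H_def)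
    also have "\<dots> = v $ i"
    proof (cases "s = 0")
      case True
      then have "\<forall>i\<in>{..<n}. w $ i * w $ i = 0"
        unfolding s_def by (subst (asm) sum_nonneg_eq_0_iff) auto
      then have "w $ i = 0" using i' by simp
      then show ?thesis using i' n v by (simp add: w_def unit_vec_def split: if_splits)
    next
      case False
      then have "2 / s * (w $ i * w $ 0) = - w $ i" unfolding s w0 by (simp add: field_simps)
      then show ?thesis using i' n v by (simp add: w_def unit_vec_def)
    qed
    finally show "(H *\<^sub>v unit_vec n 0) $ i = v $ i" .
  qed (use v dN in \<open>auto simp: H_def\<close>)
qed

lemma mat_diag_dims [simp]: "dim_row (mat_diag n d) = n" "dim_col (mat_diag n d) = n"
  by (auto simp: mat_diag_def)

text \<open>Deflation: conjugation by a reflection that moves the first unit vector to an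
  eigenvector clears the first column off the diagonal, by symmetry also the first row, and the
  remaining block is again symmetric.\<close>

theorem real_spectral_theorem:
  fixes A :: "real mat"
  assumes "A \<in> carrier_mat n n" "A\<^sup>T = A"
  shows "\<exists>V d. V \<in> carrier_mat n n \<and> V\<^sup>T * V = 1\<^sub>m n \<and> A = V * mat_diag n d * V\<^sup>T"
  using assms
proof (induction n arbitrary: A)
  case 0
  then show ?case
    by (intro exI[of _ "1\<^sub>m 0"] exI[of _ "\<lambda>_. 0"]) (auto intro!: eq_matI)
next
  case (Suc n)
  let ?m = "Suc n"
  obtain l v where v: "v \<in> carrier_vec ?m" "v \<bullet> v = 1" "A *\<^sub>v v = l \<cdot>\<^sub>v v"
    using real_symmetric_eigenvector[OF Suc.prems] by blast
  obtain H where H: "H \<in> carrier_mat ?m ?m" "H\<^sup>T = H" "H * H = 1\<^sub>m ?m" "H *\<^sub>v unit_vec ?m 0 = v"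
    using householder_reflection[OF v(1,2)] by blast
  have HHX: "H * (H * X) = X" if "dim_row X = ?m" for X
    using mat_mult_assoc_eq[OF H(3), of X] H(1) that by simp
  define B where "B = H * A * H"
  have dB: "B \<in> carrier_mat ?m ?m" using H by (auto simp: B_def)
  have BT: "B\<^sup>T = B" using H Suc.prems by (simp add: B_def mat_transpose mat_mult_assoc)
  have "B *\<^sub>v unit_vec ?m 0 = l \<cdot>\<^sub>v unit_vec ?m 0"
  proof -
    have "H *\<^sub>v v = H * H *\<^sub>v unit_vec ?m 0" using H(1,4) by (simp add: mat_mult_vec_assoc)
    then have "H *\<^sub>v v = unit_vec ?m 0" unfolding H(3) by simp
    then show ?thesis
      using H v Suc.prems by (simp add: B_def mat_mult_vec_assoc mult_mat_vec)
  qed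
  note Be = this
  have B0: "B $$ (i, 0) = (if i = 0 then l else 0)" if "i < ?m" for i
    using arg_cong[OF Be, of "\<lambda>x. x $ i"] that dB by auto
  have B0': "B $$ (0, i) = (if i = 0 then l else 0)" if "i < ?m" for i
    using arg_cong[OF BT, of "\<lambda>M. M $$ (0, i)"] B0[OF that] that dB by simp
  define A' where "A' = mat n n (\<lambda>(i, j). B $$ (Suc i, Suc j))"
  have "A'\<^sup>T = A'"
  proof (rule eq_matI)
    fix i j assume "i < dim_row A'" "j < dim_col A'"
    then show "A'\<^sup>T $$ (i, j) = A' $$ (i, j)"
      using arg_cong[OF BT, of "\<lambda>M. M $$ (Suc i, Suc j)"] dB by (simp add: A'_def)
  qed (auto simp: A'_def)
  with Suc.IH[of A'] obtain V' d where V': "V' \<in> carrier_mat n n" "V'\<^sup>T * V' = 1\<^sub>m n"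
    and A'd: "A' = V' * mat_diag n d * V'\<^sup>T" by (auto simp: A'_def)
  define F where "F = four_block_mat (1\<^sub>m 1) (0\<^sub>m 1 n) (0\<^sub>m n 1) V'"
  define d' where "d' = case_nat l d"
  have dF: "F \<in> carrier_mat ?m ?m" using V' by (auto simp: F_def)
  have FT: "F\<^sup>T = four_block_mat (1\<^sub>m 1) (0\<^sub>m 1 n) (0\<^sub>m n 1) V'\<^sup>T"
    unfolding F_def using V' by (subst transpose_four_block_mat) auto
  have "F\<^sup>T * F = four_block_mat (1\<^sub>m 1) (0\<^sub>m 1 n) (0\<^sub>m n 1) (1\<^sub>m n)"
    unfolding FT unfolding F_def using V'
    by (subst mult_four_block_mat[of _ 1 1 _ n _ n _ _ 1 _ n]) auto
  then have FF: "F\<^sup>T * F = 1\<^sub>m ?m" by simp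
  have diag: "mat_diag ?m d' = four_block_mat (l \<cdot>\<^sub>m 1\<^sub>m 1) (0\<^sub>m 1 n) (0\<^sub>m n 1) (mat_diag n d)"
    by (rule eq_matI) (auto simp: mat_diag_def d'_def split: nat.split)
  have "F * mat_diag ?m d' = four_block_mat (l \<cdot>\<^sub>m 1\<^sub>m 1) (0\<^sub>m 1 n) (0\<^sub>m n 1) (V' * mat_diag n d)"
    unfolding diag unfolding F_def using V'
    by (subst mult_four_block_mat[of _ 1 1 _ n _ n _ _ 1 _ n]) auto
  then have "F * mat_diag ?m d' * F\<^sup>T = four_block_mat (l \<cdot>\<^sub>m 1\<^sub>m 1) (0\<^sub>m 1 n) (0\<^sub>m n 1) A'"
    unfolding FT A'd using V'
    by simp (subst mult_four_block_mat[of _ 1 1 _ n _ n _ _ 1 _ n], auto)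
  also have "\<dots> = B"
  proof (rule eq_matI)
    fix i j assume "i < dim_row B" "j < dim_col B"
    then show "four_block_mat (l \<cdot>\<^sub>m 1\<^sub>m 1) (0\<^sub>m 1 n) (0\<^sub>m n 1) A' $$ (i, j) = B $$ (i, j)"
      using dB B0[of i] B0'[of j] by (cases i; cases j) (auto simp: A'_def)
  qed (use dB in \<open>auto simp: A'_def\<close>)
  finally have B: "B = F * mat_diag ?m d' * F\<^sup>T" ..
  have "A = H * B * H" using H Suc.prems by (simp add: B_def mat_mult_assoc HHX)
  then have "A = (H * F) * mat_diag ?m d' * (H * F)\<^sup>T"
    using H dF by (simp add: B mat_transpose mat_mult_assoc mat_diag_def)
  moreover have "(H * F)\<^sup>T * (H * F) = 1\<^sub>m ?m"
    using H dF FF by (simp add: mat_transpose mat_mult_assoc HHX)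
  ultimately show ?case using H dF by (intro exI[of _ "H * F"] exI[of _ d']) auto
qed

section \<open>Uniqueness of the principal logarithm\<close>

abbreviation cmat :: "real mat \<Rightarrow> complex mat" where "cmat \<equiv> map_mat complex_of_real"

text \<open>Schur triangularization, repackaged. The vectors whose T-coordinates vanish beyond index
  k form a flag, and A - z k maps each member into the preceding one; this lowering property is the
  form that an induction along the flag uses.\<close>

lemma complex_triangular_flag:
  fixes A :: "complex mat"
  assumes A: "A \<in> carrier_mat n n"
  obtains T z where "T \<in> carrier_mat n n"
    "\<And>v. v \<in> carrier_vec n \<Longrightarrow> T *\<^sub>v v = 0\<^sub>v n \<Longrightarrow> v = 0\<^sub>v n"
    "\<And>v k j. v \<in> carrier_vec n \<Longrightarrow> k < n \<Longrightarrow> (\<And>j. j < n \<Longrightarrow> k < j \<Longrightarrow> (T *\<^sub>v v) $ j = 0) \<Longrightarrow>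
      j < n \<Longrightarrow> k \<le> j \<Longrightarrow> (T *\<^sub>v (A *\<^sub>v v - z k \<cdot>\<^sub>v v)) $ j = 0"
proof -
  obtain as where "char_poly A = (\<Prod>a\<leftarrow>as. [:- a, 1:])" using char_poly_factorized[OF A] by blast
  from schur_decomposition_exists[OF A this]
  obtain B where B: "B \<in> carrier_mat n n" "upper_triangular B" "similar_mat A B" by blast
  then obtain S T where "similar_mat_wit A B S T" unfolding similar_mat_def by blast
  from similar_mat_witD2[OF A this]
  have ST: "S * T = 1\<^sub>m n" "T * S = 1\<^sub>m n" "A = S * B * T" "S \<in> carrier_mat n n" "T \<in> carrier_mat n n"
    by auto
  show thesis
  proof
    show "T \<in> carrier_mat n n" by fact
  next
    fix v assume v: "v \<in> carrier_vec n" "T *\<^sub>v v = 0\<^sub>v n"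
    have "S * T *\<^sub>v v = S *\<^sub>v (T *\<^sub>v v)" using ST(4,5) v(1) by (simp add: mat_mult_vec_assoc)
    also have "\<dots> = 0\<^sub>v n" unfolding v(2) using ST(4) by (intro eq_vecI) auto
    finally show "v = 0\<^sub>v n" unfolding ST(1) using v(1) by simp
  next
    fix v k j assume v: "v \<in> carrier_vec n" and k: "k < n" and j: "j < n" "k \<le> j"
      and 0: "\<And>j. j < n \<Longrightarrow> k < j \<Longrightarrow> (T *\<^sub>v v) $ j = 0"
    define w where "w = T *\<^sub>v v"
    have w: "w \<in> carrier_vec n" using ST(5) v by (auto simp: w_def)
    have "T *\<^sub>v (A *\<^sub>v v) = T * S *\<^sub>v (B *\<^sub>v w)"
      unfolding ST(3) w_def using ST(4,5) B(1) v by (simp add: mat_mult_vec_assoc)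
    then have TA: "T *\<^sub>v (A *\<^sub>v v) = B *\<^sub>v w" unfolding ST(2) using B(1) w by (auto intro!: eq_vecI)
    have "T *\<^sub>v (A *\<^sub>v v - B $$ (k, k) \<cdot>\<^sub>v v) = B *\<^sub>v w - B $$ (k, k) \<cdot>\<^sub>v w"
      using ST(5) A v
      by (subst mult_minus_distrib_mat_vec[of _ n n]) (auto simp: TA mult_mat_vec w_def)
    then have "(T *\<^sub>v (A *\<^sub>v v - B $$ (k, k) \<cdot>\<^sub>v v)) $ j = (B *\<^sub>v w) $ j - B $$ (k, k) * w $ j"
      using j w B by simp
    also have "(B *\<^sub>v w) $ j = (\<Sum>l<n. B $$ (j, l) * w $ l)"
      using j w B by (simp add: mat_mult_vec_index_sum del: index_mult_mat_vec)
    also have "\<dots> = (\<Sum>l<n. if l = k then B $$ (j, k) * w $ k else 0)"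
    proof (intro sum.cong refl)
      fix l assume l: "l \<in> {..<n}"
      consider "l < k" | "l = k" | "k < l" by linarith
      then show "B $$ (j, l) * w $ l = (if l = k then B $$ (j, k) * w $ k else 0)"
      proof cases
        case 1
        then have "B $$ (j, l) = 0" using B j by auto
        then show ?thesis using 1 by simp
      next
        case 3
        then show ?thesis using 0[of l] l by (simp add: w_def)
      qed simp
    qed
    also have "\<dots> = B $$ (j, k) * w $ k" using k by simp
    also have "B $$ (j, k) * w $ k - B $$ (k, k) * w $ j = 0"
    proof (cases "j = k")
      case False
      then have "k < j" using j by simp
      then have "B $$ (j, k) = 0" "w $ j = 0" using B j 0[of j] by (auto simp: w_def)
      then show ?thesis by simp
    qed simp
    finally show "(T *\<^sub>v (A *\<^sub>v v - B $$ (k, k) \<cdot>\<^sub>v v)) $ j = 0" .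
  qed
qed

section \<open>The exponential on complex eigenvectors\<close>

lemma mat_exp_mult_vec_sums:
  assumes X: "X \<in> carrier_mat n n" and v: "v \<in> carrier_vec n" and i: "i < n"
  shows "(\<lambda>k. (cmat X ^\<^sub>m k *\<^sub>v v) $ i / fact k) sums (cmat (mat_exp X) *\<^sub>v v) $ i"
proof -
  have "(\<lambda>k. \<Sum>j<n. complex_of_real ((X ^\<^sub>m k) $$ (i, j) / fact k) * v $ j) sums
      (\<Sum>j<n. complex_of_real (mat_exp X $$ (i, j)) * v $ j)"
    using X i by (intro sums_sum sums_mult2 sums_of_real mat_exp_sums) auto
  moreover have "(\<Sum>j<n. complex_of_real ((X ^\<^sub>m k) $$ (i, j) / fact k) * v $ j) =
      (cmat X ^\<^sub>m k *\<^sub>v v) $ i / fact k" for k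
    using X v i
    by (simp add: mat_mult_vec_index_sum of_real_hom.mat_hom_pow[OF X, symmetric] sum_divide_distrib
        del: index_mult_mat_vec)
  ultimately show ?thesis
    using X v i by (simp add: mat_mult_vec_index_sum del: index_mult_mat_vec)
qed

text \<open>Here w is (X - z) v, so X acts on the span of v and w as a Jordan block of size at most
  2. The powers involve z^k and its derivative in z, and both series sum to exp z.\<close>

lemma mat_exp_generalized_eigenvector:
  assumes X: "X \<in> carrier_mat n n" and v: "v \<in> carrier_vec n" and w: "w \<in> carrier_vec n"
    and Xv: "cmat X *\<^sub>v v = z \<cdot>\<^sub>v v + w" and Xw: "cmat X *\<^sub>v w = z \<cdot>\<^sub>v w"
  shows "cmat (mat_exp X) *\<^sub>v v = exp z \<cdot>\<^sub>v (v + w)"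
proof (rule eq_vecI)
  fix i assume "i < dim_vec (exp z \<cdot>\<^sub>v (v + w))"
  then have i: "i < n" using v w by simp
  have cX: "cmat X \<in> carrier_mat n n" using X by simp
  \<comment> \<open>At k = 0 the truncated exponent \<open>k - 1\<close> is harmless, because its
    coefficient is 0.\<close>
  have pow: "cmat X ^\<^sub>m k *\<^sub>v v = z ^ k \<cdot>\<^sub>v v + (of_nat k * z ^ (k - 1)) \<cdot>\<^sub>v w" for k
  proof (induction k)
    case 0
    then show ?case using v w X by (auto intro!: eq_vecI)
  next
    case (Suc k)
    have "cmat X ^\<^sub>m Suc k = cmat X * cmat X ^\<^sub>m k"
      using mat_pow_intertwine[OF cX cX cX refl, of k] by simp
    then have "cmat X ^\<^sub>m Suc k *\<^sub>v v = cmat X *\<^sub>v (cmat X ^\<^sub>m k *\<^sub>v v)"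
      using X v by (simp add: mat_mult_vec_assoc del: pow_mat.simps)
    also have "\<dots> = z ^ k \<cdot>\<^sub>v (z \<cdot>\<^sub>v v + w) + (of_nat k * z ^ (k - 1)) \<cdot>\<^sub>v (z \<cdot>\<^sub>v w)"
      unfolding Suc using cX v w by (simp add: mult_add_distrib_mat_vec[OF cX] mult_mat_vec[OF cX] Xv Xw)
    also have "\<dots> = z ^ Suc k \<cdot>\<^sub>v v + (of_nat (Suc k) * z ^ (Suc k - 1)) \<cdot>\<^sub>v w"
      using v w by (cases k) (auto intro!: eq_vecI simp: algebra_simps)
    finally show ?case .
  qed
  have e1: "(\<lambda>k. z ^ k / fact k) sums exp z"
    using exp_converges[of z] by (simp add: scaleR_conv_of_real divide_inverse mult.commute)
  have e2: "(\<lambda>k. of_nat k * z ^ (k - 1) / fact k) sums exp z"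
  proof -
    have eq: "(\<lambda>k. of_nat (Suc k) * z ^ (Suc k - 1) / fact (Suc k)) = (\<lambda>k. z ^ k / fact k)"
      by (auto simp: fact_Suc simp del: of_nat_Suc)
    have "(\<lambda>k. of_nat (Suc k) * z ^ (Suc k - 1) / fact (Suc k)) sums exp z"
      unfolding eq by (rule e1)
    from sums_Suc[OF this] show ?thesis by simp
  qed
  have "(\<lambda>k. z ^ k / fact k * v $ i + of_nat k * z ^ (k - 1) / fact k * w $ i) sums
      (exp z * v $ i + exp z * w $ i)"
    by (intro sums_add sums_mult2 e1 e2)
  moreover have "z ^ k / fact k * v $ i + of_nat k * z ^ (k - 1) / fact k * w $ i =
      (cmat X ^\<^sub>m k *\<^sub>v v) $ i / fact k" for k
    using i v w by (simp add: pow add_divide_distrib)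
  ultimately have "(cmat (mat_exp X) *\<^sub>v v) $ i = exp z * v $ i + exp z * w $ i"
    using mat_exp_mult_vec_sums[OF X v i] by (simp add: sums_iff)
  then show "(cmat (mat_exp X) *\<^sub>v v) $ i = (exp z \<cdot>\<^sub>v (v + w)) $ i"
    using i v w by (simp add: algebra_simps)
qed (use X v w in auto)

lemma mat_exp_eigenvector:
  assumes X: "X \<in> carrier_mat n n" and v: "v \<in> carrier_vec n" and Xv: "cmat X *\<^sub>v v = z \<cdot>\<^sub>v v"
  shows "cmat (mat_exp X) *\<^sub>v v = exp z \<cdot>\<^sub>v v"
proof -
  have "cmat X *\<^sub>v v = z \<cdot>\<^sub>v v + 0\<^sub>v n" using Xv v by simp
  moreover have "cmat X *\<^sub>v 0\<^sub>v n = z \<cdot>\<^sub>v 0\<^sub>v n" using X by (auto intro!: eq_vecI)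
  ultimately have "cmat (mat_exp X) *\<^sub>v v = exp z \<cdot>\<^sub>v (v + 0\<^sub>v n)"
    by (rule mat_exp_generalized_eigenvector[OF X v zero_carrier_vec])
  then show ?thesis using v by simp
qed

text \<open>Logarithms of one number differ by 2 pi i k for an integer k, and the bound leaves only
  k = 0.\<close>

lemma exp_inj_strip:
  fixes w z :: complex
  assumes "exp w = exp z" "\<bar>Im w - Im z\<bar> < 2 * pi"
  shows "w = z"
proof -
  have "cmod (exp w) = cmod (exp z)" using assms(1) by simp
  then have re: "Re w = Re z" by simp
  have "exp (Re w) * sin (Im w) = exp (Re z) * sin (Im z)"
    "exp (Re w) * cos (Im w) = exp (Re z) * cos (Im z)"
    using arg_cong[OF assms(1), of Im] arg_cong[OF assms(1), of Re] by (simp_all add: Im_exp Re_exp)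
  then have "sin (Im w) = sin (Im z) \<and> cos (Im w) = cos (Im z)" using re by simp
  then obtain k :: int where k: "Im w = Im z + 2 * pi * of_int k"
    unfolding sin_cos_eq_iff by blast
  then have "\<bar>real_of_int k\<bar> < 1" using assms(2) by (simp add: abs_mult)
  then have "k = 0" by linarith
  then show ?thesis using re k by (simp add: complex_eq_iff)
qed

text \<open>The induction climbs a flag of subspaces on which \<open>X\<close> is triangular. A new diagonal entry
  \<open>z k\<close> different from \<open>\<zeta>\<close> is excluded because \<open>exp\<close> is injective on the strip; for
  \<open>z k = \<zeta>\<close> a Jordan block of size 2 would survive in \<open>exp X\<close>.\<close>

lemma mat_exp_eigenvector_strip:
  assumes X: "X \<in> carrier_mat n n"
    and strip: "\<And>z. eigenvalue (cmat X) z \<Longrightarrow> \<bar>Im z\<bar> < pi"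
    and v: "v \<in> carrier_vec n" and Ev: "cmat (mat_exp X) *\<^sub>v v = exp \<zeta> \<cdot>\<^sub>v v" and \<zeta>: "\<bar>Im \<zeta>\<bar> < pi"
  shows "cmat X *\<^sub>v v = \<zeta> \<cdot>\<^sub>v v"
proof -
  define A where "A = cmat X"
  define E where "E = cmat (mat_exp X)"
  have A: "A \<in> carrier_mat n n" and E: "E \<in> carrier_mat n n" using X by (auto simp: A_def E_def)
  have "mat_exp X * X = X * mat_exp X" using mat_exp_intertwine[OF X X X refl] .
  then have EA: "E * A = A * E"
    unfolding E_def A_def using X
    by (metis mat_exp_carrier of_real_hom.mat_hom_mult)
  \<comment> \<open>E commutes with A, so A - a maps every eigenspace of E into itself.\<close>
  have comm: "E *\<^sub>v (A *\<^sub>v x - a \<cdot>\<^sub>v x) = c \<cdot>\<^sub>v (A *\<^sub>v x - a \<cdot>\<^sub>v x)"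
    if x: "x \<in> carrier_vec n" "E *\<^sub>v x = c \<cdot>\<^sub>v x" for x a c
  proof -
    have "E *\<^sub>v (A *\<^sub>v x) = E * A *\<^sub>v x" using A E x(1) by (simp add: mat_mult_vec_assoc)
    also have "\<dots> = A *\<^sub>v (E *\<^sub>v x)" unfolding EA using A E x(1) by (simp add: mat_mult_vec_assoc)
    finally show ?thesis
      using A E x
      by (subst mult_minus_distrib_mat_vec[OF E]) (auto simp: mult_mat_vec intro!: eq_vecI simp: algebra_simps)
  qed
  obtain T z where T: "T \<in> carrier_mat n n"
    and T0: "\<And>v. v \<in> carrier_vec n \<Longrightarrow> T *\<^sub>v v = 0\<^sub>v n \<Longrightarrow> v = 0\<^sub>v n"
    and step: "\<And>v k j. v \<in> carrier_vec n \<Longrightarrow> k < n \<Longrightarrow> (\<And>j. j < n \<Longrightarrow> k < j \<Longrightarrow> (T *\<^sub>v v) $ j = 0) \<Longrightarrow>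
      j < n \<Longrightarrow> k \<le> j \<Longrightarrow> (T *\<^sub>v (A *\<^sub>v v - z k \<cdot>\<^sub>v v)) $ j = 0"
    using complex_triangular_flag[OF A] by blast
  have "A *\<^sub>v v = \<zeta> \<cdot>\<^sub>v v"
    if "k \<le> n" "v \<in> carrier_vec n" "\<And>j. j < n \<Longrightarrow> k \<le> j \<Longrightarrow> (T *\<^sub>v v) $ j = 0"
      "E *\<^sub>v v = exp \<zeta> \<cdot>\<^sub>v v" for k v
    using that
  proof (induction k arbitrary: v)
    case 0
    then have "T *\<^sub>v v = 0\<^sub>v n" using T by (intro eq_vecI) (auto simp del: index_mult_mat_vec)
    then have "v = 0\<^sub>v n" using T0 0 by blast
    then show ?case using A by (auto intro!: eq_vecI)
  next
    case (Suc k)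
    define v' where "v' = A *\<^sub>v v - z k \<cdot>\<^sub>v v"
    define y where "y = A *\<^sub>v v - \<zeta> \<cdot>\<^sub>v v"
    have v': "v' \<in> carrier_vec n" and y: "y \<in> carrier_vec n" using A Suc.prems by (auto simp: v'_def y_def)
    have "A *\<^sub>v v' = \<zeta> \<cdot>\<^sub>v v'"
    proof (rule Suc.IH[OF _ v'])
      show "k \<le> n" using Suc.prems by simp
      show "(T *\<^sub>v v') $ j = 0" if "j < n" "k \<le> j" for j
        unfolding v'_def using that Suc.prems by (intro step) auto
      show "E *\<^sub>v v' = exp \<zeta> \<cdot>\<^sub>v v'" unfolding v'_def by (rule comm) (use Suc.prems in auto)
    qed
    then have eq: "A *\<^sub>v (A *\<^sub>v v) - z k \<cdot>\<^sub>v (A *\<^sub>v v) = \<zeta> \<cdot>\<^sub>v (A *\<^sub>v v - z k \<cdot>\<^sub>v v)"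
      unfolding v'_def using A Suc.prems(2)
      by (simp add: mult_minus_distrib_mat_vec[OF A] mult_mat_vec[OF A])
    \<comment> \<open>(A - \<zeta>)(A - z k) v = 0 is rearranged to (A - z k)(A - \<zeta>) v = 0,
      which makes y an eigenvector for z k unless y = 0.\<close>
    have "A *\<^sub>v (A *\<^sub>v v) - \<zeta> \<cdot>\<^sub>v (A *\<^sub>v v) = z k \<cdot>\<^sub>v (A *\<^sub>v v - \<zeta> \<cdot>\<^sub>v v)"
    proof (rule eq_vecI)
      fix i assume "i < dim_vec (z k \<cdot>\<^sub>v (A *\<^sub>v v - \<zeta> \<cdot>\<^sub>v v))"
      then show "(A *\<^sub>v (A *\<^sub>v v) - \<zeta> \<cdot>\<^sub>v (A *\<^sub>v v)) $ i = (z k \<cdot>\<^sub>v (A *\<^sub>v v - \<zeta> \<cdot>\<^sub>v v)) $ i"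
        using arg_cong[OF eq, of "\<lambda>v. v $ i"] A Suc.prems(2)
        by (simp add: algebra_simps del: index_mult_mat_vec)
    qed (use A Suc.prems(2) in auto)
    then have Ay: "A *\<^sub>v y = z k \<cdot>\<^sub>v y"
      unfolding y_def using A Suc.prems(2)
      by (simp add: mult_minus_distrib_mat_vec[OF A] mult_mat_vec[OF A])
    have Ey: "E *\<^sub>v y = exp \<zeta> \<cdot>\<^sub>v y" unfolding y_def by (rule comm) (use Suc.prems in auto)
    have y_eq_0: "y = 0\<^sub>v n"
    proof (rule ccontr)
      assume y0: "y \<noteq> 0\<^sub>v n"
      then obtain l where l: "l < n" "y $ l \<noteq> 0" using y by (metis carrier_vecD eq_vecI index_zero_vec)
      have "eigenvalue A (z k)"
        using y0 y Ay A unfolding eigenvalue_def eigenvector_def by auto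
      then have im: "\<bar>Im (z k)\<bar> < pi" using strip A_def by simp
      have "E *\<^sub>v y = exp (z k) \<cdot>\<^sub>v y"
        using mat_exp_eigenvector[OF X y] Ay by (simp add: A_def E_def)
      with Ey have "exp \<zeta> \<cdot>\<^sub>v y = exp (z k) \<cdot>\<^sub>v y" by simp
      from arg_cong[OF this, of "\<lambda>v. v $ l"] have exp_eq: "exp (z k) = exp \<zeta>" using l y by simp
      have "\<bar>Im (z k) - Im \<zeta>\<bar> < 2 * pi" using im \<zeta> by linarith
      with exp_eq have zk: "z k = \<zeta>" by (rule exp_inj_strip)
      have "A *\<^sub>v v = \<zeta> \<cdot>\<^sub>v v + y" using A Suc.prems(2) by (auto simp: y_def intro!: eq_vecI)
      then have "E *\<^sub>v v = exp \<zeta> \<cdot>\<^sub>v (v + y)"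
        using mat_exp_generalized_eigenvector[OF X Suc.prems(2) y] Ay zk by (simp add: A_def E_def)
      with Suc.prems(4) have "exp \<zeta> \<cdot>\<^sub>v (v + y) = exp \<zeta> \<cdot>\<^sub>v v" by simp
      from arg_cong[OF this, of "\<lambda>v. v $ l"] show False
        using l y Suc.prems(2) by simp
    qed
    have "(A *\<^sub>v v) $ i = (\<zeta> \<cdot>\<^sub>v v) $ i" if "i < n" for i
      using arg_cong[OF y_eq_0, of "\<lambda>v. v $ i"] that A Suc.prems(2)
      by (simp add: y_def del: index_mult_mat_vec)
    then show ?case using A Suc.prems(2) by (intro eq_vecI) (auto simp del: index_mult_mat_vec)
  qed
  from this[of n v] show ?thesis using v Ev by (simp add: A_def E_def)
qed

section \<open>Horizontal geodesics of the Stiefel manifold\<close>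

lemma stiefelD:
  assumes "U \<in> stiefel n q"
  shows "U \<in> carrier_mat n q" "U\<^sup>T * U = 1\<^sub>m q" "dim_row U = n" "dim_col U = q"
  using assms by (auto simp: stiefel_def)

lemma stiefel_curve_derivative_skew:
  assumes c: "\<And>t. c t \<in> stiefel n q" and D: "has_mat_derivative c D t"
  shows "D \<in> carrier_mat n q" "D\<^sup>T * c t + (c t)\<^sup>T * D = 0\<^sub>m q q"
proof -
  have dims: "dim_row D = n" "dim_col D = q"
    using has_mat_derivativeD(1,2)[OF D, of t] stiefelD[OF c[of t]] by auto
  then show "D \<in> carrier_mat n q" by auto
  have "has_mat_derivative (\<lambda>t. (c t)\<^sup>T * c t) (D\<^sup>T * c t + (c t)\<^sup>T * D) t"
    using dims by (intro has_mat_derivative_mult has_mat_derivative_transpose D) auto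
  moreover have "(\<lambda>t. (c t)\<^sup>T * c t) = (\<lambda>_. 1\<^sub>m q)" using stiefelD(2)[OF c] by auto
  ultimately have "has_mat_derivative (\<lambda>_. 1\<^sub>m q) (D\<^sup>T * c t + (c t)\<^sup>T * D) t" by simp
  from has_mat_derivative_unique[OF this has_mat_derivative_const]
  show "D\<^sup>T * c t + (c t)\<^sup>T * D = 0\<^sub>m q q" by simp
qed

lemma mat_add_eq_0_iff:
  fixes A :: "'a::ab_group_add mat"
  assumes "A \<in> carrier_mat n m" "B \<in> carrier_mat n m"
  shows "A + B = 0\<^sub>m n m \<longleftrightarrow> A = - B"
  using assms by (auto simp: mat_eq_iff eq_neg_iff_add_eq_0)

lemma stiefel_tangent_skew:
  assumes "E \<in> tangent_vectors (stiefel n q) X"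
  shows "E \<in> carrier_mat n q" "(X\<^sup>T * E)\<^sup>T = - (X\<^sup>T * E)"
proof -
  obtain c where c: "\<And>t. c t \<in> stiefel n q" "c 0 = X" "has_mat_derivative c E 0"
    using assms by (auto simp: tangent_vectors_def)
  note E = stiefel_curve_derivative_skew[OF c(1,3)]
  show "E \<in> carrier_mat n q" by (rule E(1))
  have X: "X \<in> carrier_mat n q" using stiefelD(1)[OF c(1)[of 0]] c(2) by simp
  have "E\<^sup>T * X = - (X\<^sup>T * E)"
    using E X c(2) by (subst mat_add_eq_0_iff[of _ q q, symmetric]) auto
  then show "(X\<^sup>T * E)\<^sup>T = - (X\<^sup>T * E)" using E X by (simp add: mat_transpose)
qed

lemma skew_flow_stiefel:
  assumes "\<Omega> \<in> carrier_mat n n" "\<Omega>\<^sup>T = - \<Omega>" "U \<in> stiefel n q"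
  shows "mat_exp (t \<cdot>\<^sub>m \<Omega>) * U \<in> stiefel n q"
  using assms stiefelD[OF assms(3)] mat_mult_assoc_eq[OF mat_exp_skew_orthogonal[OF assms(1,2), of t], of U]
  by (auto simp: stiefel_def mat_transpose mat_mult_assoc)

text \<open>\<open>tangent_vectors\<close> asks for a curve that stays in the manifold for all
  times, so E is realized by a one-parameter group of rotations.\<close>

lemma stiefel_tangentI:
  assumes X: "X \<in> stiefel n q" and E: "E \<in> carrier_mat n q" and skew: "(X\<^sup>T * E)\<^sup>T = - (X\<^sup>T * E)"
  shows "E \<in> tangent_vectors (stiefel n q) X"
proof -
  note X' = stiefelD[OF X]
  define a where "a = X\<^sup>T * E"
  have a: "dim_row a = q" "dim_col a = q" "a\<^sup>T = - a" using X' E skew by (auto simp: a_def)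
  have EX: "E\<^sup>T * X = - a" using a(3) X' E by (simp add: a_def mat_transpose)
  \<comment> \<open>Chosen to give \<Omega> X = E: the first term yields E, the second contributes
    \<open>X * a\<close> because \<open>E\<^sup>T * X = - a\<close>, and the third cancels that
    contribution.\<close>
  define \<Omega> where "\<Omega> = E * X\<^sup>T - X * E\<^sup>T - X * a * X\<^sup>T"
  have \<Omega>: "\<Omega> \<in> carrier_mat n n" using X' E a by (auto simp: \<Omega>_def)
  have skew\<Omega>: "\<Omega>\<^sup>T = - \<Omega>"
    unfolding \<Omega>_def using X' E a by (simp add: mat_transpose mat_mult_assoc) (intro eq_matI, auto)
  have "\<Omega> * X = E + X * a - X * a"
    unfolding \<Omega>_def using X' E a by (simp add: mat_distrib EX) (intro eq_matI, auto)
  then have \<Omega>X: "\<Omega> * X = E" using X' E a by (auto intro!: eq_matI)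
  have "has_mat_derivative (\<lambda>t. mat_exp (t \<cdot>\<^sub>m \<Omega>) * X) (\<Omega> * mat_exp (0 \<cdot>\<^sub>m \<Omega>) * X) 0"
    using \<Omega> X' by (intro has_mat_derivative_mult_const mat_exp_derivative) auto
  then have "has_mat_derivative (\<lambda>t. mat_exp (t \<cdot>\<^sub>m \<Omega>) * X) E 0"
    using \<Omega> \<Omega>X by simp
  moreover have "mat_exp (0 \<cdot>\<^sub>m \<Omega>) * X = X" using \<Omega> X' by simp
  ultimately show ?thesis
    unfolding tangent_vectors_def using skew_flow_stiefel[OF \<Omega> skew\<Omega> X]
    by (intro CollectI exI[of _ "\<lambda>t. mat_exp (t \<cdot>\<^sub>m \<Omega>) * X"]) simp
qed

text \<open>\<Omega> commutes with its flow, so the acceleration along the curve c is -c C with C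
  symmetric. It is normal because \<open>c\<^sup>T * E\<close> is skew for every tangent E.\<close>

lemma stiefel_flow_geodesic:
  assumes \<Omega>: "\<Omega> \<in> carrier_mat n n" "\<Omega>\<^sup>T = - \<Omega>" and U: "U \<in> stiefel n q"
    and C: "C \<in> carrier_mat q q" "C\<^sup>T = C" and \<Omega>\<Omega>U: "\<Omega> * (\<Omega> * U) = - (U * C)"
  shows "is_geodesic (stiefel n q) (\<lambda>t. mat_exp (t \<cdot>\<^sub>m \<Omega>) * U)"
  unfolding is_geodesic_def
proof (intro conjI allI exI ballI)
  note U' = stiefelD[OF U]
  let ?E = "\<lambda>t. mat_exp (t \<cdot>\<^sub>m \<Omega>)"
  have comm: "\<Omega> * (?E t * X) = ?E t * (\<Omega> * X)" if "dim_row X = n" for t X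
    using mat_mult_assoc_eq[OF mat_exp_commute[OF \<Omega>(1), of t], of X] \<Omega> that by (simp add: mat_mult_assoc)
  fix t
  show "?E t * U \<in> stiefel n q" by (rule skew_flow_stiefel[OF \<Omega> U])
  have d: "has_mat_derivative (\<lambda>t. ?E t * U) (\<Omega> * ?E t * U) t"
    using \<Omega> U' by (intro has_mat_derivative_mult_const mat_exp_derivative) auto
  then show "has_mat_derivative (\<lambda>t. ?E t * U) (\<Omega> * (?E t * U)) t"
    using \<Omega> U' by (simp add: mat_mult_assoc)
  then show "has_mat_derivative (\<lambda>t. \<Omega> * (?E t * U)) (\<Omega> * (\<Omega> * (?E t * U))) t"
    using \<Omega> U' by (intro has_mat_derivative_const_mult) auto
  fix E assume "E \<in> tangent_vectors (stiefel n q) (?E t * U)"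
  note E = stiefel_tangent_skew[OF this]
  have dE: "dim_row E = n" "dim_col E = q" using E by auto
  have "\<Omega> * (\<Omega> * (?E t * U)) = - (?E t * U * C)"
    using \<Omega> U' C by (simp add: comm \<Omega>\<Omega>U mat_mult_assoc)
  then have "mat_inner (\<Omega> * (\<Omega> * (?E t * U))) E = - mat_inner (?E t * U * C) E"
    using \<Omega> U' C dE by (simp add: mat_inner_uminus_left)
  also have "mat_inner (?E t * U * C) E = mat_inner C ((?E t * U)\<^sup>T * E)"
    using \<Omega> U' C dE by (subst mat_inner_mult_left) auto
  also have "\<dots> = 0" using C E U' by (intro mat_inner_sym_skew) auto
  finally show "mat_inner (\<Omega> * (\<Omega> * (?E t * U))) E = 0" by simp
qed

text \<open>Subtracting X times the symmetric part of \<open>X\<^sup>T * N\<close> from N leaves a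
  tangent vector E. Both N and \<open>X * S\<close> are orthogonal to it, hence E is orthogonal to
  itself.\<close>

lemma stiefel_normal_form:
  assumes X: "X \<in> stiefel n q" and N: "N \<in> carrier_mat n q"
    and normal: "\<And>E. E \<in> tangent_vectors (stiefel n q) X \<Longrightarrow> mat_inner N E = 0"
  obtains S where "S \<in> carrier_mat q q" "S\<^sup>T = S" "N = X * S"
proof
  note X' = stiefelD[OF X]
  define S where "S = (1/2) \<cdot>\<^sub>m (X\<^sup>T * N + (X\<^sup>T * N)\<^sup>T)"
  define E where "E = N - X * S"
  show S: "S \<in> carrier_mat q q" using X' N by (auto simp: S_def)
  show ST: "S\<^sup>T = S"
    unfolding S_def using X' N by (auto simp: mat_transpose intro!: eq_matI)
  have E: "E \<in> carrier_mat n q" using X' N S by (auto simp: E_def)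
  have XXS: "X\<^sup>T * (X * S) = S" using mat_mult_assoc_eq[OF X'(2), of S] X' S by simp
  have XE: "X\<^sup>T * E = X\<^sup>T * N - S"
    unfolding E_def using X' N S by (simp add: mat_distrib XXS)
  have skew: "(X\<^sup>T * E)\<^sup>T = - (X\<^sup>T * E)"
  proof (rule eq_matI)
    fix i j assume "i < dim_row (- (X\<^sup>T * E))" "j < dim_col (- (X\<^sup>T * E))"
    then have ij: "i < q" "j < q" using X' E by auto
    define Z where "Z = X\<^sup>T * N"
    have Z: "dim_row Z = q" "dim_col Z = q" using X' N by (auto simp: Z_def)
    show "(X\<^sup>T * E)\<^sup>T $$ (i, j) = (- (X\<^sup>T * E)) $$ (i, j)"
      unfolding XE S_def Z_def[symmetric] using ij Z by (simp add: field_simps)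
  qed (use X' E in auto)
  have "mat_inner E E = mat_inner (N - X * S) E" by (simp only: E_def)
  also have "\<dots> = mat_inner N E - mat_inner (X * S) E"
    using X' N S E by (intro mat_inner_minus_left) auto
  also have "mat_inner N E = 0" by (intro normal stiefel_tangentI X E skew)
  also have "mat_inner (X * S) E = mat_inner S (X\<^sup>T * E)"
    using X' S E by (intro mat_inner_mult_left) auto
  also have "\<dots> = 0" using S X' by (intro mat_inner_sym_skew ST skew) auto
  finally have "mat_inner E E = 0" by simp
  from mat_inner_self_eq_0[OF this] have E0: "E = 0\<^sub>m n q" using E by simp
  show "N = X * S"
  proof (rule eq_matI)
    fix i j assume "i < dim_row (X * S)" "j < dim_col (X * S)"
    then show "N $$ (i, j) = (X * S) $$ (i, j)"
      using arg_cong[OF E0, of "\<lambda>M. M $$ (i, j)"] X' N S by (simp add: E_def del: index_mult_mat(1))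
  qed (use X' N S in auto)
qed

text \<open>Along a geodesic \<open>c\<^sup>T c'\<close> is constant, and if it vanishes then so is \<open>c'\<^sup>T c'\<close>.
  This turns the geodesic equation \<open>c'' = - c c'\<^sup>T c'\<close> into a linear one.\<close>

lemma stiefel_horizontal_geodesic_linear:
  assumes geo: "is_geodesic (stiefel n q) c" and D: "has_mat_derivative c D 0"
    and hor: "(c 0)\<^sup>T * D = 0\<^sub>m q q"
  obtains c' where "\<And>t. has_mat_derivative c (c' t) t"
    "\<And>t. has_mat_derivative c' (- (c t * (D\<^sup>T * D))) t" "c' 0 = D"
proof -
  obtain c' c'' where c: "\<And>t. c t \<in> stiefel n q"
    and c': "\<And>t. has_mat_derivative c (c' t) t" and c'': "\<And>t. has_mat_derivative c' (c'' t) t"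
    and normal: "\<And>t E. E \<in> tangent_vectors (stiefel n q) (c t) \<Longrightarrow> mat_inner (c'' t) E = 0"
    using geo unfolding is_geodesic_def by blast
  note ct = stiefelD[OF c]
  have c'0: "c' 0 = D" by (rule has_mat_derivative_unique[OF c' D])
  have dc': "c' t \<in> carrier_mat n q" for t by (rule stiefel_curve_derivative_skew(1)[OF c c'])
  have dc'': "c'' t \<in> carrier_mat n q" for t
    using has_mat_derivativeD(1)[OF c'', of t t] has_mat_derivativeD(2)[OF c'', of t t] dc'[of t] by auto
  have dims: "dim_row (c' t) = n" "dim_col (c' t) = q" "dim_row (c'' t) = n" "dim_col (c'' t) = q" for t
    using dc'[of t] dc''[of t] by auto
  define S where "S t = - ((c' t)\<^sup>T * c' t)" for t
  have S: "dim_row (S t) = q" "dim_col (S t) = q" "(S t)\<^sup>T = S t" for t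
    using dims by (auto simp: S_def mat_transpose)
  have acc: "c'' t = c t * S t" for t
  proof -
    obtain S' where S': "S' \<in> carrier_mat q q" "S'\<^sup>T = S'" "c'' t = c t * S'"
      using stiefel_normal_form[OF c dc'' normal] by blast
    \<comment> \<open>Differentiating \<open>c\<^sup>T * c = 1\<close> a second time determines the
      symmetric factor of the normal acceleration.\<close>
    have 1: "has_mat_derivative (\<lambda>t. (c' t)\<^sup>T * c t + (c t)\<^sup>T * c' t)
        (((c'' t)\<^sup>T * c t + (c' t)\<^sup>T * c' t) + ((c' t)\<^sup>T * c' t + (c t)\<^sup>T * c'' t)) t"
      using dims ct
      by (intro has_mat_derivative_add has_mat_derivative_mult has_mat_derivative_transpose c' c'') auto
    have "(\<lambda>t. (c' t)\<^sup>T * c t + (c t)\<^sup>T * c' t) = (\<lambda>_. 0\<^sub>m q q)"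
      using stiefel_curve_derivative_skew(2)[OF c c'] by auto
    with 1 have "has_mat_derivative (\<lambda>_. 0\<^sub>m q q)
        (((c'' t)\<^sup>T * c t + (c' t)\<^sup>T * c' t) + ((c' t)\<^sup>T * c' t + (c t)\<^sup>T * c'' t)) t" by simp
    from has_mat_derivative_unique[OF this has_mat_derivative_const]
    have 2: "((c'' t)\<^sup>T * c t + (c' t)\<^sup>T * c' t) + ((c' t)\<^sup>T * c' t + (c t)\<^sup>T * c'' t) = 0\<^sub>m q q" by simp
    have "(c t)\<^sup>T * c'' t = S'"
      unfolding S'(3) using mat_mult_assoc_eq[OF ct(2)[of t], of S'] ct S' by simp
    moreover have "(c'' t)\<^sup>T * c t = ((c t)\<^sup>T * c'' t)\<^sup>T" using dims ct by (simp add: mat_transpose)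
    ultimately have 3: "(c t)\<^sup>T * c'' t = S'" "(c'' t)\<^sup>T * c t = S'" using S' by auto
    define Z where "Z = (c' t)\<^sup>T * c' t"
    have Z: "dim_row Z = q" "dim_col Z = q" using dims by (auto simp: Z_def)
    have "S' = S t"
    proof (rule eq_matI)
      fix i j assume "i < dim_row (S t)" "j < dim_col (S t)"
      then have ij: "i < q" "j < q" using S by auto
      show "S' $$ (i, j) = S t $$ (i, j)"
        using arg_cong[OF 2, of "\<lambda>M. M $$ (i, j)"] ij Z S'(1)
        by (simp add: 3 S_def Z_def[symmetric])
    qed (use S S' in auto)
    then show ?thesis using S'(3) by simp
  qed
  have cT_acc: "(c t)\<^sup>T * c'' t = S t" for t
    unfolding acc using mat_mult_assoc_eq[OF ct(2)[of t], of "S t"] ct S by simp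
  have A0: "(c t)\<^sup>T * c' t = 0\<^sub>m q q" for t
  proof -
    have "has_mat_derivative (\<lambda>t. (c t)\<^sup>T * c' t) ((c' t)\<^sup>T * c' t + (c t)\<^sup>T * c'' t) t" for t
      using dims ct by (intro has_mat_derivative_mult has_mat_derivative_transpose c' c'') auto
    moreover have "(c' t)\<^sup>T * c' t + (c t)\<^sup>T * c'' t = 0\<^sub>m q q" for t
      unfolding cT_acc S_def using dims by simp
    ultimately have "has_mat_derivative (\<lambda>t. (c t)\<^sup>T * c' t) (0\<^sub>m q q) t" for t by metis
    from has_mat_derivative_zero_imp_const[OF this, of t] show ?thesis using c'0 hor by simp
  qed
  have A0': "(c' t)\<^sup>T * c t = 0\<^sub>m q q" for t
    using arg_cong[OF A0[of t], of transpose_mat] ct dims by (simp add: mat_transpose)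
  have C: "(c' t)\<^sup>T * c' t = D\<^sup>T * D" for t
  proof -
    have "has_mat_derivative (\<lambda>t. (c' t)\<^sup>T * c' t) ((c'' t)\<^sup>T * c' t + (c' t)\<^sup>T * c'' t) t" for t
      using dims ct by (intro has_mat_derivative_mult has_mat_derivative_transpose c'') auto
    moreover have "(c'' t)\<^sup>T * c' t + (c' t)\<^sup>T * c'' t = 0\<^sub>m q q" for t
      unfolding acc using dims ct S mat_mult_assoc_eq[OF A0'[of t], of "S t"]
      by (simp add: mat_transpose mat_mult_assoc A0)
    ultimately have "has_mat_derivative (\<lambda>t. (c' t)\<^sup>T * c' t) (0\<^sub>m q q) t" for t by metis
    from has_mat_derivative_zero_imp_const[OF this, of t] show ?thesis using c'0 by simp
  qed
  have "c'' t = - (c t * (D\<^sup>T * D))" for t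
    unfolding acc S_def C using ct[of t] dims[of 0] c'0 by simp
  with c'' have "has_mat_derivative c' (- (c t * (D\<^sup>T * D))) t" for t by metis
  then show thesis using that[of c'] c' c'0 by blast
qed

text \<open>Conservation of energy: the coefficient \<open>D\<^sup>T * D\<close> makes the potential
  the square of the norm of \<open>d * D\<^sup>T\<close>. The total energy stays 0, so d' vanishes
  and d is constant.\<close>

lemma linear_second_order_ode_zero:
  assumes d: "\<And>t. has_mat_derivative d (d' t) t"
    and d': "\<And>t. has_mat_derivative d' (- (d t * (D\<^sup>T * D))) t"
    and 0: "d 0 = 0\<^sub>m n q" "d' 0 = 0\<^sub>m n q" and D: "D \<in> carrier_mat m q"
  shows "d t = 0\<^sub>m n q"
proof -
  have dims: "dim_row (d t) = n" "dim_col (d t) = q" "dim_row (d' t) = n" "dim_col (d' t) = q" for t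
    using has_mat_derivativeD(1,2)[OF d, of 0 0] has_mat_derivativeD(1,2)[OF d, of t 0]
      has_mat_derivativeD(1,2)[OF d, of t t]  0 by auto
  have DT: "has_mat_derivative (\<lambda>t. d t * D\<^sup>T) (d' t * D\<^sup>T) t" for t
    using D dims by (intro has_mat_derivative_mult_const d) auto
  let ?e = "\<lambda>t. mat_inner (d' t) (d' t) + mat_inner (d t * D\<^sup>T) (d t * D\<^sup>T)"
  have "(?e has_real_derivative 0) (at t)" for t
  proof -
    have "(?e has_real_derivative (mat_inner (- (d t * (D\<^sup>T * D))) (d' t) + mat_inner (d' t) (- (d t * (D\<^sup>T * D)))) +
        (mat_inner (d' t * D\<^sup>T) (d t * D\<^sup>T) + mat_inner (d t * D\<^sup>T) (d' t * D\<^sup>T))) (at t)"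
      by (intro DERIV_add DERIV_mat_inner d' DT) auto
    moreover have "mat_inner (d' t) (- (d t * (D\<^sup>T * D))) = mat_inner (- (d t * (D\<^sup>T * D))) (d' t)"
      using dims D by (intro mat_inner_comm) auto
    moreover have "mat_inner (- (d t * (D\<^sup>T * D))) (d' t) = - mat_inner (d t * (D\<^sup>T * D)) (d' t)"
      using dims D by (intro mat_inner_uminus_left) auto
    moreover have "mat_inner (d t * (D\<^sup>T * D)) (d' t) = mat_inner (d t * D\<^sup>T) (d' t * D\<^sup>T)"
    proof -
      have "d t * (D\<^sup>T * D) = (d t * D\<^sup>T) * D" using dims D by (simp add: mat_mult_assoc)
      then show ?thesis using dims D by (simp only:) (subst mat_inner_mult_right, auto)
    qed
    moreover have "mat_inner (d' t * D\<^sup>T) (d t * D\<^sup>T) = mat_inner (d t * D\<^sup>T) (d' t * D\<^sup>T)"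
      using dims D by (intro mat_inner_comm) auto
    ultimately show ?thesis by simp
  qed
  then have "?e t = ?e 0" for t by (intro DERIV_isconst_all[of ?e]) auto
  moreover have "?e 0 = 0"
    using 0 D mat_inner_zero_right[of "0\<^sub>m n q"] mat_inner_zero_right[of "0\<^sub>m n m"] by simp
  ultimately have "?e t = 0" for t by simp
  then have "mat_inner (d' t) (d' t) = 0" for t
    using mat_inner_self_ge_0[of "d' t"] mat_inner_self_ge_0[of "d t * D\<^sup>T"] by (smt (verit))
  then have "d' t = 0\<^sub>m n q" for t using mat_inner_self_eq_0[of "d' t"] dims by simp
  then have "has_mat_derivative d (0\<^sub>m n q) t" for t using d[of t] by simp
  from has_mat_derivative_zero_imp_const[OF this, of t] show ?thesis using 0 by simp
qed

text \<open>The common initial velocity fixes the coefficient \<open>D\<^sup>T * D\<close>, so both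
  geodesics, and with them their difference, satisfy the same linear equation.\<close>

lemma stiefel_horizontal_geodesic_unique:
  assumes c: "is_geodesic (stiefel n q) c" "has_mat_derivative c D 0" "(c 0)\<^sup>T * D = 0\<^sub>m q q"
    and e: "is_geodesic (stiefel n q) e" "has_mat_derivative e D 0" "e 0 = c 0"
  shows "c t = e t"
proof -
  obtain c' where c': "\<And>t. has_mat_derivative c (c' t) t"
    "\<And>t. has_mat_derivative c' (- (c t * (D\<^sup>T * D))) t" "c' 0 = D"
    using stiefel_horizontal_geodesic_linear[OF c] by blast
  obtain e' where e': "\<And>t. has_mat_derivative e (e' t) t"
    "\<And>t. has_mat_derivative e' (- (e t * (D\<^sup>T * D))) t" "e' 0 = D"
    using stiefel_horizontal_geodesic_linear[OF e(1,2)] e(3) c(3) by auto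
  have in_st: "c t \<in> stiefel n q" "e t \<in> stiefel n q" for t
    using c(1) e(1) by (auto simp: is_geodesic_def)
  have D: "D \<in> carrier_mat n q" by (rule stiefel_curve_derivative_skew(1)[OF in_st(1) c(2)])
  have dims: "dim_row (c t) = n" "dim_col (c t) = q" "dim_row (e t) = n" "dim_col (e t) = q"
    "dim_row (c' t) = n" "dim_col (c' t) = q" "dim_row (e' t) = n" "dim_col (e' t) = q" for t
    using stiefelD[OF in_st(1)[of t]] stiefelD[OF in_st(2)[of t]]
      stiefel_curve_derivative_skew(1)[OF in_st(1) c'(1), of t]
      stiefel_curve_derivative_skew(1)[OF in_st(2) e'(1), of t] by auto
  define d where "d t = c t + (- 1\<^sub>m n) * e t" for t
  define d' where "d' t = c' t + (- 1\<^sub>m n) * e' t" for t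
  have "has_mat_derivative d (d' t) t" for t
    unfolding d_def[abs_def] d'_def using dims
    by (intro has_mat_derivative_add has_mat_derivative_const_mult c' e') auto
  moreover have "has_mat_derivative d' (- (d t * (D\<^sup>T * D))) t" for t
  proof -
    have "has_mat_derivative d' (- (c t * (D\<^sup>T * D)) + (- 1\<^sub>m n) * (- (e t * (D\<^sup>T * D)))) t"
      unfolding d'_def[abs_def] using dims D
      by (intro has_mat_derivative_add has_mat_derivative_const_mult c' e') auto
    moreover have "- (c t * (D\<^sup>T * D)) + (- 1\<^sub>m n) * (- (e t * (D\<^sup>T * D))) = - (d t * (D\<^sup>T * D))"
      unfolding d_def using dims D by (simp add: mat_add_mult) (intro eq_matI, auto)
    ultimately show ?thesis by simp
  qed
  moreover have "d 0 = 0\<^sub>m n q" "d' 0 = 0\<^sub>m n q"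
    unfolding d_def d'_def using e(3) c'(3) e'(3) dims D by auto
  ultimately have d0: "d t = 0\<^sub>m n q" using linear_second_order_ode_zero[of d d' D] D by blast
  show ?thesis
  proof (rule eq_matI)
    fix i j assume "i < dim_row (e t)" "j < dim_col (e t)"
    then show "c t $$ (i, j) = e t $$ (i, j)"
      using arg_cong[OF d0, of "\<lambda>M. M $$ (i, j)"] dims by (simp add: d_def)
  qed (use dims in auto)
qed

text \<open>The premise on \<open>\<Omega> * (\<Omega> * U)\<close> makes the flow line of \<Omega>
  a geodesic, and the last premise makes it horizontal. Uniqueness of horizontal geodesics then
  evaluates the description in \<open>riem_exp\<close>.\<close>

theorem riem_exp_stiefel_horizontal:
  assumes \<Omega>: "\<Omega> \<in> carrier_mat n n" "\<Omega>\<^sup>T = - \<Omega>" and U: "U \<in> stiefel n q"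
    and C: "C \<in> carrier_mat q q" "C\<^sup>T = C" and \<Omega>\<Omega>U: "\<Omega> * (\<Omega> * U) = - (U * C)"
    and hor: "U\<^sup>T * (\<Omega> * U) = 0\<^sub>m q q"
  shows "riem_exp (stiefel n q) U (\<Omega> * U) = mat_exp \<Omega> * U"
  unfolding riem_exp_def
proof (rule the_equality)
  note U' = stiefelD[OF U]
  let ?c = "\<lambda>t. mat_exp (t \<cdot>\<^sub>m \<Omega>) * U"
  have geo: "is_geodesic (stiefel n q) ?c" by (rule stiefel_flow_geodesic[OF \<Omega> U C \<Omega>\<Omega>U])
  have "has_mat_derivative ?c (\<Omega> * mat_exp (0 \<cdot>\<^sub>m \<Omega>) * U) 0"
    using \<Omega> U' by (intro has_mat_derivative_mult_const mat_exp_derivative) auto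
  then have d: "has_mat_derivative ?c (\<Omega> * U) 0" using \<Omega> by simp
  have c0: "?c 0 = U" and c1: "?c 1 = mat_exp \<Omega> * U" using \<Omega> U' by simp_all
  show "\<exists>c. is_geodesic (stiefel n q) c \<and> c 0 = U \<and> has_mat_derivative c (\<Omega> * U) 0 \<and> c 1 = mat_exp \<Omega> * U"
    using geo d c0 c1 by (intro exI[of _ ?c]) simp
  fix Y assume "\<exists>c. is_geodesic (stiefel n q) c \<and> c 0 = U \<and> has_mat_derivative c (\<Omega> * U) 0 \<and> c 1 = Y"
  then obtain c where c: "is_geodesic (stiefel n q) c" "c 0 = U" "has_mat_derivative c (\<Omega> * U) 0" "c 1 = Y"
    by blast
  have "?c 1 = c 1"
    by (rule stiefel_horizontal_geodesic_unique[OF geo d _ c(1,3)]) (use c0 c(2) hor in auto)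
  then show "Y = mat_exp \<Omega> * U" using c(4) c1 by simp
qed

section \<open>Positive definite matrices and their square roots\<close>

lemma mat_diag_transpose [simp]: "(mat_diag q d)\<^sup>T = mat_diag q d"
  by (auto simp: mat_diag_def intro!: eq_matI)

lemma mat_diag_index [simp]: "i < q \<Longrightarrow> j < q \<Longrightarrow> mat_diag q d $$ (i, j) = (if i = j then d j else 0)"
  by (simp add: mat_diag_def)

lemma mult_mat_diag_index:
  fixes A :: "'a::semiring_0 mat"
  assumes "i < dim_row A" "j < q" "dim_col A = q"
  shows "(A * mat_diag q d) $$ (i, j) = A $$ (i, j) * d j"
  using assms by (subst mat_diag_mult_right[of A "dim_row A" q d]) auto

lemma mat_diag_mult_index:
  fixes A :: "'a::semiring_0 mat"
  assumes "i < q" "j < dim_col A" "dim_row A = q"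
  shows "(mat_diag q d * A) $$ (i, j) = d i * A $$ (i, j)"
  using assms by (subst mat_diag_mult_left[of A q "dim_col A" d]) auto

lemma orthogonal_mat_right_inverse:
  fixes V :: "'a::field mat"
  assumes "V \<in> carrier_mat n n" "V\<^sup>T * V = 1\<^sub>m n"
  shows "V * V\<^sup>T = 1\<^sub>m n"
  using assms by (intro mat_mult_left_right_inverse[of "V\<^sup>T" n V]) auto

text \<open>Encoded by an orthogonal diagonalization with positive eigenvalues, from which square
  root, inverse and lower bound are read off. The criterion by the quadratic form is
  \<open>pos_defI\<close>, where row vectors are 1 x q matrices.\<close>

definition pos_def :: "nat \<Rightarrow> real mat \<Rightarrow> bool" where
  "pos_def q S \<longleftrightarrow> (\<exists>V d. V \<in> carrier_mat q q \<and> V\<^sup>T * V = 1\<^sub>m q \<and> (\<forall>k<q. 0 < d k) \<and>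
     S = V * mat_diag q d * V\<^sup>T)"

lemma pos_defE:
  assumes "pos_def q S"
  obtains V d where "V \<in> carrier_mat q q" "V\<^sup>T * V = 1\<^sub>m q" "V * V\<^sup>T = 1\<^sub>m q" "\<And>k. k < q \<Longrightarrow> 0 < d k"
     "S = V * mat_diag q d * V\<^sup>T"
  using assms orthogonal_mat_right_inverse unfolding pos_def_def by blast

lemma pos_def_sym:
  assumes "pos_def q S"
  shows "S \<in> carrier_mat q q" "S\<^sup>T = S"
  using assms unfolding pos_def_def by (auto simp: mat_transpose mat_mult_assoc)

lemma pos_defI:
  assumes S: "S \<in> carrier_mat q q" "S\<^sup>T = S"
    and pos: "\<And>D. D \<in> carrier_mat 1 q \<Longrightarrow> D \<noteq> 0\<^sub>m 1 q \<Longrightarrow> 0 < mat_inner D (D * S)"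
  shows "pos_def q S"
proof -
  obtain V d where V: "V \<in> carrier_mat q q" "V\<^sup>T * V = 1\<^sub>m q" and Sd: "S = V * mat_diag q d * V\<^sup>T"
    using real_spectral_theorem[OF S] by blast
  have "0 < d k" if k: "k < q" for k
  proof -
    \<comment> \<open>The k-th unit row. \<open>e * V\<^sup>T\<close> is the k-th eigenvector as a
      row, at which the quadratic form takes the value d k.\<close>
    define e :: "real mat" where "e = mat 1 q (\<lambda>(i, j). if j = k then 1 else 0)"
    have e: "e \<in> carrier_mat 1 q" by (simp add: e_def)
    define D where "D = e * V\<^sup>T"
    have D: "D \<in> carrier_mat 1 q" using e V by (auto simp: D_def)
    have "D * V = e" using e V by (simp add: D_def mat_mult_assoc)
    moreover have "e \<noteq> 0\<^sub>m 1 q"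
    proof
      assume "e = 0\<^sub>m 1 q"
      from arg_cong[OF this, of "\<lambda>M. M $$ (0, k)"] show False using k by (simp add: e_def)
    qed
    ultimately have "D \<noteq> 0\<^sub>m 1 q" using V by auto
    then have "0 < mat_inner D (D * S)" using pos D by blast
    also have "D * S = (e * mat_diag q d) * V\<^sup>T"
      using \<open>D * V = e\<close> D V e by (simp add: Sd mat_mult_assoc[symmetric])
    also have "mat_inner D ((e * mat_diag q d) * V\<^sup>T) = mat_inner ((e * mat_diag q d) * V\<^sup>T) D"
      using D V e by (intro mat_inner_comm) auto
    also have "\<dots> = mat_inner (e * mat_diag q d) (D * V)"
      using D V e by (subst mat_inner_mult_right) auto
    also have "\<dots> = mat_inner (e * mat_diag q d) e" using \<open>D * V = e\<close> by simp
    also have "\<dots> = (\<Sum>j<q. e $$ (0, j) * d j * e $$ (0, j))"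
      using e by (simp add: mat_inner_sum[where n=1 and q=q] mult_mat_diag_index del: index_mult_mat(1))
    also have "\<dots> = (\<Sum>j<q. if j = k then d k else 0)" by (intro sum.cong) (auto simp: e_def)
    also have "\<dots> = d k" using k by simp
    finally show ?thesis .
  qed
  then show ?thesis unfolding pos_def_def using V Sd by blast
qed

text \<open>D may have any number of rows because the inner product adds up the quadratic form over
  the rows.\<close>

lemma pos_def_lower_bound:
  assumes "pos_def q S"
  obtains l where "0 < l"
    "\<And>D m. D \<in> carrier_mat m q \<Longrightarrow> l * mat_inner D D \<le> mat_inner D (D * S)"
proof -
  obtain V d where V: "V \<in> carrier_mat q q" "V\<^sup>T * V = 1\<^sub>m q" "V * V\<^sup>T = 1\<^sub>m q" and d: "\<And>k. k < q \<Longrightarrow> 0 < d k"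
    and S: "S = V * mat_diag q d * V\<^sup>T" using pos_defE[OF assms] by metis
  \<comment> \<open>The smallest eigenvalue, capped at 1: the inserted 1 keeps the set nonempty when
    q = 0.\<close>
  define l where "l = Min (insert 1 (d ` {..<q}))"
  have l0: "0 < l" unfolding l_def using d by (subst Min_gr_iff) auto
  have ld: "l \<le> d k" if "k < q" for k unfolding l_def using that by (intro Min_le) auto
  show thesis
  proof (rule that[OF l0])
    fix D :: "real mat" and m assume D: "D \<in> carrier_mat m q"
    define G where "G = D * V"
    have G: "dim_row G = m" "dim_col G = q" using D V by (auto simp: G_def)
    have DG: "D = G * V\<^sup>T" using D V by (simp add: G_def mat_mult_assoc)
    have "l * mat_inner D D = l * mat_inner G (D * V)"
      using D V G by (subst DG, subst mat_inner_mult_right) auto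
    also have "\<dots> = l * mat_inner G G" by (simp add: G_def)
    also have "\<dots> = (\<Sum>j<q. \<Sum>i<m. l * (G $$ (i, j) * G $$ (i, j)))"
      using G by (simp add: mat_inner_sum[where n=m and q=q] sum_distrib_left)
    also have "\<dots> \<le> (\<Sum>j<q. \<Sum>i<m. G $$ (i, j) * d j * G $$ (i, j))"
    proof (intro sum_mono)
      fix j i assume "j \<in> {..<q}"
      then have "l * (G $$ (i, j) * G $$ (i, j)) \<le> d j * (G $$ (i, j) * G $$ (i, j))"
        using ld by (intro mult_right_mono) auto
      then show "l * (G $$ (i, j) * G $$ (i, j)) \<le> G $$ (i, j) * d j * G $$ (i, j)"
        by (simp add: mult_ac)
    qed
    also have "\<dots> = mat_inner (G * mat_diag q d) G"
      using G by (simp add: mat_inner_sum[where n=m and q=q] mult_mat_diag_index del: index_mult_mat(1))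
    also have "\<dots> = mat_inner (G * mat_diag q d) (D * V)" by (simp add: G_def)
    also have "\<dots> = mat_inner (G * mat_diag q d * V\<^sup>T) D"
      using G V D by (subst mat_inner_mult_right) auto
    also have "G * mat_diag q d * V\<^sup>T = D * S" using D V by (simp add: G_def S mat_mult_assoc)
    also have "mat_inner (D * S) D = mat_inner D (D * S)"
      using D V by (intro mat_inner_comm) (auto simp: S)
    finally show "l * mat_inner D D \<le> mat_inner D (D * S)" .
  qed
qed

lemma pos_def_det:
  assumes "pos_def q S"
  shows "det S \<noteq> 0"
proof -
  obtain V d where V: "V \<in> carrier_mat q q" "V\<^sup>T * V = 1\<^sub>m q" "V * V\<^sup>T = 1\<^sub>m q" and d: "\<And>k. k < q \<Longrightarrow> 0 < d k"
    and S: "S = V * mat_diag q d * V\<^sup>T" using pos_defE[OF assms] by metis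
  define X where "X = V * mat_diag q (\<lambda>k. 1 / d k) * V\<^sup>T"
  have X: "X \<in> carrier_mat q q" using V by (auto simp: X_def)
  have dd: "mat_diag q d * mat_diag q (\<lambda>k. 1 / d k) = 1\<^sub>m q"
    unfolding mat_diag_diag using d by (intro eq_matI) (auto simp: less_imp_neq[THEN not_sym])
  have VVX: "V\<^sup>T * (V * Y) = Y" if "dim_row Y = q" for Y
    using mat_mult_assoc_eq[OF V(2), of Y] V that by simp
  have ddX: "mat_diag q d * (mat_diag q (\<lambda>k. 1 / d k) * Y) = Y" if "dim_row Y = q" for Y
    using mat_mult_assoc_eq[OF dd, of Y] that by simp
  have "S * X = 1\<^sub>m q"
    unfolding S X_def using V by (simp add: mat_mult_assoc VVX ddX)
  then have "det S * det X = 1"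
    using det_mult[OF pos_def_sym(1)[OF assms] X] by simp
  then show ?thesis by auto
qed

lemma pos_def_sqrt_exists:
  assumes "pos_def q S"
  shows "\<exists>Z. pos_def q Z \<and> Z * Z = S"
proof -
  obtain V d where V: "V \<in> carrier_mat q q" "V\<^sup>T * V = 1\<^sub>m q" and d: "\<And>k. k < q \<Longrightarrow> 0 < d k"
    and S: "S = V * mat_diag q d * V\<^sup>T" using pos_defE[OF assms] by metis
  define Z where "Z = V * mat_diag q (\<lambda>k. sqrt (d k)) * V\<^sup>T"
  have VVX: "V\<^sup>T * (V * Y) = Y" if "dim_row Y = q" for Y
    using mat_mult_assoc_eq[OF V(2), of Y] V that by simp
  have dd: "mat_diag q (\<lambda>k. sqrt (d k)) * mat_diag q (\<lambda>k. sqrt (d k)) = mat_diag q d"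
    unfolding mat_diag_diag using d by (intro eq_matI) (auto simp: mat_diag_def less_imp_le)
  have ddX: "mat_diag q (\<lambda>k. sqrt (d k)) * (mat_diag q (\<lambda>k. sqrt (d k)) * Y) = mat_diag q d * Y"
    if "dim_row Y = q" for Y
    using mat_mult_assoc_eq[OF dd, of Y] that by simp
  have "Z * Z = S" unfolding Z_def S using V by (simp add: mat_mult_assoc VVX ddX)
  moreover have "pos_def q Z" unfolding pos_def_def using V d
    by (intro exI[of _ V] exI[of _ "\<lambda>k. sqrt (d k)"]) (auto simp: Z_def)
  ultimately show ?thesis by blast
qed

section \<open>Norm estimates and the Sylvester equation\<close>

lemma mat_inner_Cauchy_Schwarz:
  assumes "A \<in> carrier_mat n q" "B \<in> carrier_mat n q"
  shows "(mat_inner A B)\<^sup>2 \<le> mat_inner A A * mat_inner B B"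
proof -
  have pair: "mat_inner A' B' = (\<Sum>(j, i)\<in>{..<q} \<times> {..<n}. A' $$ (i, j) * B' $$ (i, j))"
    if "A' \<in> carrier_mat n q" "B' \<in> carrier_mat n q" for A' B'
    using that by (simp add: mat_inner_sum[where n=n and q=q] sum.cartesian_product)
  let ?I = "{..<q} \<times> {..<n}" and ?a = "\<lambda>(j, i). A $$ (i, j)" and ?b = "\<lambda>(j, i). B $$ (i, j)"
  have "\<bar>mat_inner A B\<bar> \<le> (\<Sum>x\<in>?I. \<bar>?a x\<bar> * \<bar>?b x\<bar>)"
    unfolding pair[OF assms] by (rule order.trans[OF sum_abs]) (simp add: case_prod_unfold abs_mult)
  also have "\<dots> \<le> L2_set ?a ?I * L2_set ?b ?I" by (rule L2_set_mult_ineq)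
  also have "\<dots> = sqrt (mat_inner A A * mat_inner B B)"
    using assms by (simp add: pair L2_set_def case_prod_unfold power2_eq_square real_sqrt_mult)
  finally have "\<bar>mat_inner A B\<bar>\<^sup>2 \<le> (sqrt (mat_inner A A * mat_inner B B))\<^sup>2"
    by (intro power_mono) auto
  then show ?thesis
    using mat_inner_self_ge_0[of A] mat_inner_self_ge_0[of B] by simp
qed

lemma mat_entry_le_mat_inner:
  assumes "D \<in> carrier_mat n q" "i < n" "j < q"
  shows "(D $$ (i, j))\<^sup>2 \<le> mat_inner D D"
proof -
  have "(D $$ (i, j))\<^sup>2 = (\<Sum>i\<in>{i}. D $$ (i, j) * D $$ (i, j))" by (simp add: power2_eq_square)
  also have "\<dots> \<le> (\<Sum>i<n. D $$ (i, j) * D $$ (i, j))" using assms by (intro sum_mono2) auto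
  also have "\<dots> = (\<Sum>j\<in>{j}. \<Sum>i<n. D $$ (i, j) * D $$ (i, j))" by simp
  also have "\<dots> \<le> (\<Sum>j<q. \<Sum>i<n. D $$ (i, j) * D $$ (i, j))"
    using assms by (intro sum_mono2) (auto intro: sum_nonneg)
  also have "\<dots> = mat_inner D D" using assms by (simp add: mat_inner_sum[where n=n and q=q])
  finally show ?thesis .
qed

text \<open>Paired with D, the term containing Z is nonnegative and the term containing Z' is at
  least l |D|^2; Cauchy-Schwarz does the rest. The constant comes from Z' alone, so the estimate is
  uniform in Z.\<close>

lemma sylvester_bound:
  assumes Z: "pos_def q Z" and Z': "Z' \<in> carrier_mat q q" and l: "0 < l"
    and bound: "\<And>D m. D \<in> carrier_mat m q \<Longrightarrow> l * mat_inner D D \<le> mat_inner D (D * Z')"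
    and D: "D \<in> carrier_mat q q"
  shows "l\<^sup>2 * mat_inner D D \<le> mat_inner (Z * D + D * Z') (Z * D + D * Z')"
proof -
  define E where "E = Z * D + D * Z'"
  note Zs = pos_def_sym[OF Z]
  have E: "E \<in> carrier_mat q q" using Zs Z' D by (auto simp: E_def)
  obtain k where k: "0 < k" "\<And>D m. D \<in> carrier_mat m q \<Longrightarrow> k * mat_inner D D \<le> mat_inner D (D * Z)"
    using pos_def_lower_bound[OF Z] by blast
  have "mat_inner D (Z * D) = mat_inner D\<^sup>T (Z * D)\<^sup>T" using Zs D by (subst mat_inner_transpose) auto
  also have "\<dots> = mat_inner D\<^sup>T (D\<^sup>T * Z)" using Zs D by (simp add: mat_transpose)
  finally have "0 \<le> mat_inner D (Z * D)"
    using k(2)[of "D\<^sup>T" q] k(1) mat_inner_self_ge_0[of "D\<^sup>T"] D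
    by (metis (no_types, lifting) mult_nonneg_nonneg less_imp_le order_trans transpose_carrier_mat)
  moreover have "mat_inner D E = mat_inner E D" using D E by (intro mat_inner_comm) auto
  moreover have "mat_inner E D = mat_inner (Z * D) D + mat_inner (D * Z') D"
    unfolding E_def using Zs Z' D by (intro mat_inner_add_left) auto
  moreover have "mat_inner (Z * D) D = mat_inner D (Z * D)" "mat_inner (D * Z') D = mat_inner D (D * Z')"
    using Zs Z' D by (auto intro!: mat_inner_comm)
  ultimately have le: "l * mat_inner D D \<le> mat_inner D E" using bound[OF D] by linarith
  have "(l * mat_inner D D)\<^sup>2 \<le> (mat_inner D E)\<^sup>2"
    using le l mat_inner_self_ge_0[of D] by (intro power_mono) auto
  also have "\<dots> \<le> mat_inner D D * mat_inner E E" by (rule mat_inner_Cauchy_Schwarz[OF D E])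
  finally have main: "mat_inner D D * (l\<^sup>2 * mat_inner D D) \<le> mat_inner D D * mat_inner E E"
    by (simp add: power2_eq_square mult_ac)
  show ?thesis
  proof (cases "mat_inner D D = 0")
    case True
    then show ?thesis using mat_inner_self_ge_0[of E] by (simp add: E_def)
  next
    case False
    then have "0 < mat_inner D D" using mat_inner_self_ge_0[of D] by linarith
    then show ?thesis using main by (simp add: E_def)
  qed
qed

lemma sylvester_injective:
  assumes "pos_def q Z" "pos_def q Z'" "D \<in> carrier_mat q q" "Z * D + D * Z' = 0\<^sub>m q q"
  shows "D = 0\<^sub>m q q"
proof -
  obtain l where l: "0 < l" "\<And>D m. D \<in> carrier_mat m q \<Longrightarrow> l * mat_inner D D \<le> mat_inner D (D * Z')"
    using pos_def_lower_bound[OF assms(2)] by blast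
  have "l\<^sup>2 * mat_inner D D \<le> mat_inner (0\<^sub>m q q) (0\<^sub>m q q)"
    using sylvester_bound[OF assms(1) pos_def_sym(1)[OF assms(2)] l assms(3)] assms(4) by simp
  then have "l\<^sup>2 * mat_inner D D \<le> 0" using mat_inner_zero_right[of "0\<^sub>m q q"] by simp
  then have "mat_inner D D \<le> 0" using l(1) by (simp add: mult_le_0_iff)
  then have "mat_inner D D = 0" using mat_inner_self_ge_0[of D] by linarith
  from mat_inner_self_eq_0[OF this] show ?thesis using assms(3) by simp
qed

text \<open>The choice is immaterial for positive definite S: two such roots differ by a solution of
  a homogeneous Sylvester equation, which vanishes by \<open>sylvester_injective\<close>.\<close>

definition pd_sqrt :: "nat \<Rightarrow> real mat \<Rightarrow> real mat" where
  "pd_sqrt q S = (SOME Z. pos_def q Z \<and> Z * Z = S)"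

lemma pd_sqrt:
  assumes "pos_def q S"
  shows "pos_def q (pd_sqrt q S)" "pd_sqrt q S * pd_sqrt q S = S"
  using someI_ex[OF pos_def_sqrt_exists[OF assms]] by (auto simp: pd_sqrt_def)

text \<open>The noncommutative difference of squares. It turns the difference of two roots into the
  solution of a Sylvester equation.\<close>

lemma square_diff_sylvester:
  fixes Z Z' :: "'a::ring mat"
  assumes "Z \<in> carrier_mat q q" "Z' \<in> carrier_mat q q"
  shows "Z * (Z - Z') + (Z - Z') * Z' = Z * Z - Z' * Z'"
  using assms by (simp add: mat_distrib) (intro eq_matI, auto)

text \<open>A perturbation of Frobenius norm below the lower bound l cannot destroy positivity; the
  radius is l^2 because \<open>mat_inner\<close> measures the squared norm.\<close>

lemma pos_def_open:
  assumes "pos_def q S"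
  obtains e where "0 < e" "\<And>S'. S' \<in> carrier_mat q q \<Longrightarrow> S'\<^sup>T = S' \<Longrightarrow>
      mat_inner (S' - S) (S' - S) < e \<Longrightarrow> pos_def q S'"
proof -
  obtain l where l: "0 < l" "\<And>D m. D \<in> carrier_mat m q \<Longrightarrow> l * mat_inner D D \<le> mat_inner D (D * S)"
    using pos_def_lower_bound[OF assms] by blast
  note S = pos_def_sym[OF assms]
  show thesis
  proof (rule that[of "l\<^sup>2"])
    show "0 < l\<^sup>2" using l(1) by simp
    fix S' :: "real mat" assume S': "S' \<in> carrier_mat q q" "S'\<^sup>T = S'" "mat_inner (S' - S) (S' - S) < l\<^sup>2"
    define E where "E = S' - S"
    have E: "E \<in> carrier_mat q q" using S S' by (auto simp: E_def)
    show "pos_def q S'"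
    proof (rule pos_defI[OF S'(1,2)])
      fix D :: "real mat" assume D: "D \<in> carrier_mat 1 q" "D \<noteq> 0\<^sub>m 1 q"
      then have "mat_inner D D \<noteq> 0" using mat_inner_self_eq_0[of D] by auto
      then have D0: "0 < mat_inner D D" using mat_inner_self_ge_0[of D] by linarith
      text \<open>For a row vector, \<open>D E D\<^sup>T\<close> is the inner product of \<open>E\<close> with \<open>D\<^sup>T D\<close>.\<close>
      have DD: "mat_inner (D\<^sup>T * D) (D\<^sup>T * D) = (mat_inner D D)\<^sup>2"
      proof -
        have *: "mat_inner D D = (\<Sum>j<q. D $$ (0, j) * D $$ (0, j))"
          using D by (simp add: mat_inner_sum[where n=1 and q=q])
        have "mat_inner (D\<^sup>T * D) (D\<^sup>T * D) = (\<Sum>j<q. \<Sum>i<q. (D $$ (0, i) * D $$ (0, j)) * (D $$ (0, i) * D $$ (0, j)))"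
          using D by (simp add: mat_inner_sum[where n=q and q=q] scalar_prod_def)
        also have "\<dots> = (\<Sum>j<q. \<Sum>i<q. (D $$ (0, j) * D $$ (0, j)) * (D $$ (0, i) * D $$ (0, i)))"
          by (simp add: mult_ac)
        also have "\<dots> = (mat_inner D D)\<^sup>2"
          by (simp add: * power2_eq_square sum_product)
        finally show ?thesis .
      qed
      have "mat_inner D (D * E) = mat_inner (D\<^sup>T * D) E"
        using D E by (subst mat_inner_mult_left) auto
      then have "(mat_inner D (D * E))\<^sup>2 \<le> (mat_inner D D)\<^sup>2 * mat_inner E E"
        using mat_inner_Cauchy_Schwarz[of "D\<^sup>T * D" q q E] D E by (simp add: DD)
      also have "\<dots> < (mat_inner D D)\<^sup>2 * l\<^sup>2"
        using D0 S'(3) by (intro mult_strict_left_mono) (auto simp: E_def)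
      finally have "(mat_inner D (D * E))\<^sup>2 < (mat_inner D D * l)\<^sup>2" by (simp add: power_mult_distrib)
      then have "\<bar>mat_inner D (D * E)\<bar> < mat_inner D D * l"
        using D0 l(1) by (metis abs_of_pos mult_pos_pos power2_abs power2_less_imp_less abs_ge_zero less_imp_le)
      moreover have "mat_inner D (D * S') = mat_inner D (D * S) + mat_inner D (D * E)"
      proof -
        have "S' = S + E" using S S' by (auto simp: E_def intro!: eq_matI)
        then have "D * S' = D * S + D * E" using D S E by (simp add: mat_mult_add)
        then have "mat_inner D (D * S') = mat_inner (D * S + D * E) D"
          using D S E by (subst mat_inner_comm) auto
        also have "\<dots> = mat_inner (D * S) D + mat_inner (D * E) D"
          using D S E by (intro mat_inner_add_left) auto
        also have "mat_inner (D * S) D = mat_inner D (D * S)" using D S by (intro mat_inner_comm) auto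
        also have "mat_inner (D * E) D = mat_inner D (D * E)" using D E by (intro mat_inner_comm) auto
        finally show ?thesis .
      qed
      ultimately show "0 < mat_inner D (D * S')"
        using l(2)[OF D(1)] by (simp add: mult.commute)
    qed
  qed
qed

section \<open>Minimal rotations between frames\<close>

text \<open>\<open>W\<close> has zero columns at the vanishing angles, where the direction of rotation is undetermined.\<close>

locale principal_frame =
  fixes n q :: nat and U W :: "real mat" and \<theta> :: "nat \<Rightarrow> real"
  assumes U: "U \<in> carrier_mat n q" and W: "W \<in> carrier_mat n q"
    and UU: "U\<^sup>T * U = 1\<^sub>m q" and UW: "U\<^sup>T * W = 0\<^sub>m q q"
    and WW: "W\<^sup>T * W = mat_diag q (\<lambda>k. if \<theta> k = 0 then 0 else 1)"
    and \<theta>: "\<And>k. k < q \<Longrightarrow> 0 \<le> \<theta> k" "\<And>k. k < q \<Longrightarrow> \<theta> k < pi / 2"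
begin

lemma dims [simp]: "dim_row U = n" "dim_col U = q" "dim_row W = n" "dim_col W = q"
  using U W by auto

lemma WU: "W\<^sup>T * U = 0\<^sub>m q q"
  using arg_cong[OF UW, of transpose_mat] by (simp add: mat_transpose)

lemma assoc_simps:
  assumes "dim_row X = q"
  shows "U\<^sup>T * (U * X) = X" "U\<^sup>T * (W * X) = 0\<^sub>m q (dim_col X)" "W\<^sup>T * (U * X) = 0\<^sub>m q (dim_col X)"
    "W\<^sup>T * (W * X) = mat_diag q (\<lambda>k. if \<theta> k = 0 then 0 else 1) * X"
  using assms mat_mult_assoc_eq[OF UU, of X] mat_mult_assoc_eq[OF UW, of X]
    mat_mult_assoc_eq[OF WU, of X] mat_mult_assoc_eq[OF WW, of X] by simp_all

text \<open>Columns of squared length 0 are 0: the defect T satisfies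
  \<open>T\<^sup>T * T = 0\<close>.\<close>

lemma W_support: "W * mat_diag q (\<lambda>k. if \<theta> k = 0 then 0 else 1) = W"
proof -
  let ?e = "mat_diag q (\<lambda>k. if \<theta> k = 0 then 0 else 1 :: real)"
  define T where "T = W - W * ?e"
  have ee: "?e * ?e = ?e" unfolding mat_diag_diag by (intro eq_matI) auto
  have "T\<^sup>T * T = 0\<^sub>m q q"
    unfolding T_def by (simp add: mat_transpose mat_distrib WW assoc_simps ee del: mat_diag_diag)
  then have "mat_inner T T = sum_list (diag_mat (0\<^sub>m q q))" unfolding mat_inner_def by simp
  then have "mat_inner T T = 0" by (simp add: sum_list_replicate)
  then have T: "T = 0\<^sub>m n q" using mat_inner_self_eq_0[of T] by (simp add: T_def)
  show ?thesis
  proof (rule eq_matI)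
    fix i j assume "i < dim_row W" "j < dim_col W"
    then show "(W * ?e) $$ (i, j) = W $$ (i, j)"
      using arg_cong[OF T, of "\<lambda>M. M $$ (i, j)"] by (simp add: T_def del: index_mult_mat(1))
  qed auto
qed

text \<open>In the plane of the k-th columns of U and W this is the infinitesimal rotation from U
  towards W with speed \<open>\<theta> k\<close>; it is zero on the orthogonal complement of all
  these columns.\<close>

definition gen :: "real mat" where
  "gen = W * mat_diag q \<theta> * U\<^sup>T - U * mat_diag q \<theta> * W\<^sup>T"

lemma gen_carrier: "gen \<in> carrier_mat n n"
  by (auto simp: gen_def)

lemma gen_dims [simp]: "dim_row gen = n" "dim_col gen = n"
  using gen_carrier by auto

lemma gen_skew: "gen\<^sup>T = - gen"
  unfolding gen_def by (simp add: mat_transpose mat_mult_assoc) (intro eq_matI, auto)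

lemma gen_U: "gen * U = W * mat_diag q \<theta>"
  unfolding gen_def by (simp add: mat_distrib UU WU)

lemma theta_support: "mat_diag q \<theta> * mat_diag q (\<lambda>k. if \<theta> k = 0 then 0 else 1) = mat_diag q \<theta>"
  unfolding mat_diag_diag by (intro eq_matI) auto

lemma gen_W: "gen * W = - (U * mat_diag q \<theta>)"
  unfolding gen_def by (simp add: mat_distrib WW UW theta_support del: mat_diag_diag) (intro eq_matI, auto)

lemma gen_U_assoc: "dim_row X = q \<Longrightarrow> gen * (U * X) = W * (mat_diag q \<theta> * X)"
  using mat_mult_assoc_eq[OF gen_U, of X] by (simp add: mat_mult_assoc)

lemma gen_W_assoc: "dim_row X = q \<Longrightarrow> gen * (W * X) = - (U * (mat_diag q \<theta> * X))"
  using mat_mult_assoc_eq[OF gen_W, of X] by (simp add: mat_mult_assoc)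

lemma has_mat_derivative_diag:
  assumes "\<And>k. k < q \<Longrightarrow> ((\<lambda>t. d t k) has_real_derivative d' k) (at t)"
  shows "has_mat_derivative (\<lambda>t. mat_diag q (d t)) (mat_diag q d') t"
  using assms by (intro has_mat_derivativeI[of _ q q]) auto

text \<open>With all angles scaled by t, both sides solve X' = \<open>gen\<close> X with initial
  value U; uniqueness replaces a summation of the series.\<close>

lemma exp_gen_U: "mat_exp gen * U = U * mat_diag q (\<lambda>k. cos (\<theta> k)) + W * mat_diag q (\<lambda>k. sin (\<theta> k))"
proof -
  let ?c = "\<lambda>t. mat_diag q (\<lambda>k. cos (t * \<theta> k))" and ?s = "\<lambda>t. mat_diag q (\<lambda>k. sin (t * \<theta> k))"
  define F where "F t = U * ?c t + W * ?s t" for t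
  have "has_mat_derivative F (gen * F t) t" for t
  proof -
    have "has_mat_derivative F (U * mat_diag q (\<lambda>k. - (\<theta> k * sin (t * \<theta> k))) + W * mat_diag q (\<lambda>k. \<theta> k * cos (t * \<theta> k))) t"
      unfolding F_def[abs_def]
      by (intro has_mat_derivative_add has_mat_derivative_const_mult has_mat_derivative_diag)
        (auto intro!: derivative_eq_intros)
    moreover have "gen * F t = U * mat_diag q (\<lambda>k. - (\<theta> k * sin (t * \<theta> k))) + W * mat_diag q (\<lambda>k. \<theta> k * cos (t * \<theta> k))"
    proof -
      have "gen * F t = W * (mat_diag q \<theta> * ?c t) - U * (mat_diag q \<theta> * ?s t)"
        unfolding F_def by (simp add: mat_mult_add gen_U_assoc gen_W_assoc del: mat_diag_diag) (intro eq_matI, auto)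
      also have "\<dots> = U * mat_diag q (\<lambda>k. - (\<theta> k * sin (t * \<theta> k))) + W * mat_diag q (\<lambda>k. \<theta> k * cos (t * \<theta> k))"
        by (intro eq_matI) (auto simp: mult_mat_diag_index simp del: index_mult_mat(1))
      finally show ?thesis .
    qed
    ultimately show ?thesis by simp
  qed
  from mat_exp_skew_ode_unique[OF gen_carrier gen_skew this, of 1]
  have "F 1 = mat_exp gen * F 0" by simp
  moreover have "F 0 = U"
    unfolding F_def by (intro eq_matI) (auto simp: mult_mat_diag_index simp del: index_mult_mat(1))
  ultimately show ?thesis by (simp add: F_def)
qed

text \<open>The operator norm is at most the largest angle: \<open>gen\<close> exchanges the
  components of X along U and W with factors \<open>\<theta> k\<close>, and Bessel's inequality
  bounds these components by X.\<close>

lemma gen_norm_bound: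
  assumes m: "0 \<le> m" "\<And>k. k < q \<Longrightarrow> \<theta> k \<le> m" and X: "X \<in> carrier_mat n 1"
  shows "mat_inner (gen * X) (gen * X) \<le> m\<^sup>2 * mat_inner X X"
proof -
  let ?T = "mat_diag q \<theta>" and ?e = "mat_diag q (\<lambda>k. if \<theta> k = 0 then 0 else 1 :: real)"
  have dX [simp]: "dim_row X = n" "dim_col X = 1" using X by auto
  define a where "a = U\<^sup>T * X"
  define b where "b = W\<^sup>T * X"
  have dab [simp]: "dim_row a = q" "dim_col a = 1" "dim_row b = q" "dim_col b = 1" by (auto simp: a_def b_def)
  \<comment> \<open>The entries of b at vanishing angles are 0, since the columns of W are 0
    there.\<close>
  have eb: "?e * b = b"
  proof -
    have "?e * W\<^sup>T = W\<^sup>T" using arg_cong[OF W_support, of transpose_mat] by (simp add: mat_transpose)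
    then show ?thesis unfolding b_def by (simp add: mat_mult_assoc[symmetric])
  qed
  have inner_minus: "mat_inner (P - R) (P - R) = mat_inner P P - 2 * mat_inner P R + mat_inner R R"
    if "dim_row P = k" "dim_col P = 1" "dim_row R = k" "dim_col R = 1" for P R k
    using that by (simp add: mat_inner_sum[where n=k and q=1] algebra_simps sum.distrib sum_subtractf sum_distrib_left)
  have gX: "gen * X = W * (?T * a) - U * (?T * b)"
    unfolding gen_def a_def b_def by (simp add: mat_distrib)
  have "mat_inner (gen * X) (gen * X) = mat_inner (W * (?T * a)) (W * (?T * a)) - 2 * mat_inner (W * (?T * a)) (U * (?T * b))
      + mat_inner (U * (?T * b)) (U * (?T * b))"
    unfolding gX by (rule inner_minus[of _ n]) auto
  also have "mat_inner (W * (?T * a)) (W * (?T * a)) = mat_inner (?T * a) (?T * a)"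
  proof -
    have eT: "?e * (?T * a) = ?T * a"
      by (intro eq_matI) (auto simp: mat_diag_mult_index simp del: index_mult_mat(1))
    show ?thesis by (subst mat_inner_mult_left) (auto simp: assoc_simps eT simp del: mat_diag_diag)
  qed
  also have "mat_inner (W * (?T * a)) (U * (?T * b)) = 0"
    using mat_inner_zero_right[of "?T * a"] by (subst mat_inner_mult_left) (auto simp: assoc_simps)
  also have "mat_inner (U * (?T * b)) (U * (?T * b)) = mat_inner (?T * b) (?T * b)"
    by (subst mat_inner_mult_left) (auto simp: assoc_simps)
  finally have 1: "mat_inner (gen * X) (gen * X) = mat_inner (?T * a) (?T * a) + mat_inner (?T * b) (?T * b)" by simp
  have T_le: "mat_inner (?T * y) (?T * y) \<le> m\<^sup>2 * mat_inner y y" if y: "dim_row y = q" "dim_col y = 1" for y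
  proof -
    have "mat_inner (?T * y) (?T * y) = (\<Sum>k<q. (\<theta> k)\<^sup>2 * (y $$ (k, 0) * y $$ (k, 0)))"
      using y by (simp add: mat_inner_sum[where n=q and q=1] mat_diag_mult_index power2_eq_square mult_ac
          del: index_mult_mat(1))
    also have "\<dots> \<le> (\<Sum>k<q. m\<^sup>2 * (y $$ (k, 0) * y $$ (k, 0)))"
      using m \<theta> by (intro sum_mono mult_right_mono power_mono) auto
    also have "\<dots> = m\<^sup>2 * mat_inner y y"
      using y by (simp add: mat_inner_sum[where n=q and q=1] sum_distrib_left)
    finally show ?thesis .
  qed
  have bessel: "mat_inner a a + mat_inner b b \<le> mat_inner X X"
  proof -
    define R where "R = U * a + W * b"
    have dR [simp]: "dim_row R = n" "dim_col R = 1" by (auto simp: R_def)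
    have "0 \<le> mat_inner (X - R) (X - R)" by (rule mat_inner_self_ge_0)
    also have "\<dots> = mat_inner X X - 2 * mat_inner X R + mat_inner R R"
      by (rule inner_minus[of _ n]) auto
    also have "mat_inner X R = mat_inner R X" by (intro mat_inner_comm) auto
    also have "mat_inner R X = mat_inner (U * a) X + mat_inner (W * b) X"
      unfolding R_def by (intro mat_inner_add_left) auto
    also have "mat_inner (U * a) X = mat_inner a a"
      by (subst mat_inner_mult_left) (auto simp: a_def)
    also have "mat_inner (W * b) X = mat_inner b b"
      by (subst mat_inner_mult_left) (auto simp: b_def)
    also have "mat_inner R R = mat_inner (U * a) R + mat_inner (W * b) R"
      by (subst (1) R_def, intro mat_inner_add_left) auto
    also have "mat_inner (U * a) R = mat_inner a (U\<^sup>T * R)" by (intro mat_inner_mult_left) auto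
    also have "U\<^sup>T * R = a" by (simp add: R_def mat_mult_add assoc_simps)
    also have "mat_inner (W * b) R = mat_inner b (W\<^sup>T * R)" by (intro mat_inner_mult_left) auto
    also have "W\<^sup>T * R = b" by (simp add: R_def mat_mult_add assoc_simps eb)
    finally show ?thesis by simp
  qed
  have "mat_inner (gen * X) (gen * X) \<le> m\<^sup>2 * (mat_inner a a + mat_inner b b)"
    using T_le[of a] T_le[of b] by (simp add: 1 algebra_simps)
  also have "\<dots> \<le> m\<^sup>2 * mat_inner X X" using bessel by (intro mult_left_mono) auto
  finally show ?thesis .
qed

text \<open>An eigenvalue z satisfies |z| <= 2 max \<theta> < pi. The real norm bound is applied to
  the real and the imaginary part of the eigenvector separately and the squares are added.\<close>

lemma gen_eigenvalue_strip:
  assumes "eigenvalue (cmat (2 \<cdot>\<^sub>m gen)) z"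
  shows "\<bar>Im z\<bar> < pi"
proof -
  obtain x where x: "x \<in> carrier_vec n" "x \<noteq> 0\<^sub>v n" "cmat (2 \<cdot>\<^sub>m gen) *\<^sub>v x = z \<cdot>\<^sub>v x"
    using assms unfolding eigenvalue_def eigenvector_def by auto
  define a where "a = mat n 1 (\<lambda>(i, j). Re (x $ i))"
  define b where "b = mat n 1 (\<lambda>(i, j). Im (x $ i))"
  have ab: "a \<in> carrier_mat n 1" "b \<in> carrier_mat n 1" by (auto simp: a_def b_def)
  have ev: "(\<Sum>j<n. complex_of_real (2 * gen $$ (i, j)) * x $ j) = z * x $ i" if "i < n" for i
    using arg_cong[OF x(3), of "\<lambda>v. v $ i"] that x(1)
    by (simp add: mat_mult_vec_index_sum del: index_mult_mat_vec)
  have sq: "4 * ((gen * a) $$ (i, 0))\<^sup>2 + 4 * ((gen * b) $$ (i, 0))\<^sup>2 = (cmod z)\<^sup>2 * ((a $$ (i, 0))\<^sup>2 + (b $$ (i, 0))\<^sup>2)"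
    if i: "i < n" for i
  proof -
    have re_im: "Re (complex_of_real r * y) = r * Re y" "Im (complex_of_real r * y) = r * Im y" for r y
      by simp_all
    have "Re (z * x $ i) = 2 * (gen * a) $$ (i, 0)" "Im (z * x $ i) = 2 * (gen * b) $$ (i, 0)"
      using i by (simp_all add: ev[OF i, symmetric] mat_mult_index_sum a_def b_def sum_distrib_left mult.assoc re_im
          del: index_mult_mat(1) times_complex.sel of_real_mult)
    then have "(cmod (z * x $ i))\<^sup>2 = 4 * ((gen * a) $$ (i, 0))\<^sup>2 + 4 * ((gen * b) $$ (i, 0))\<^sup>2"
      by (simp add: cmod_power2 power_mult_distrib del: times_complex.sel)
    moreover have "(cmod (z * x $ i))\<^sup>2 = (cmod z)\<^sup>2 * ((a $$ (i, 0))\<^sup>2 + (b $$ (i, 0))\<^sup>2)"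
      using i by (simp add: norm_mult power_mult_distrib cmod_power2[of "x $ i"] a_def b_def)
    ultimately show ?thesis by simp
  qed
  have inner: "mat_inner y y = (\<Sum>i<n. (y $$ (i, 0))\<^sup>2)" if "y \<in> carrier_mat n 1" for y
    using that by (simp add: mat_inner_sum[where n=n and q=1] power2_eq_square)
  have eq: "4 * mat_inner (gen * a) (gen * a) + 4 * mat_inner (gen * b) (gen * b) =
      (cmod z)\<^sup>2 * (mat_inner a a + mat_inner b b)"
  proof -
    have "4 * mat_inner (gen * a) (gen * a) + 4 * mat_inner (gen * b) (gen * b) =
        (\<Sum>i<n. 4 * ((gen * a) $$ (i, 0))\<^sup>2 + 4 * ((gen * b) $$ (i, 0))\<^sup>2)"
      using ab gen_carrier
      by (simp add: inner sum.distrib sum_distrib_left del: index_mult_mat(1))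
    also have "\<dots> = (\<Sum>i<n. (cmod z)\<^sup>2 * ((a $$ (i, 0))\<^sup>2 + (b $$ (i, 0))\<^sup>2))"
      by (intro sum.cong) (auto simp only: sq lessThan_iff)
    also have "\<dots> = (cmod z)\<^sup>2 * (mat_inner a a + mat_inner b b)"
      using ab by (simp add: inner sum_distrib_left[symmetric] sum.distrib)
    finally show ?thesis .
  qed
  obtain k where k: "k < n" "x $ k \<noteq> 0" using x(1,2) by (metis carrier_vecD eq_vecI index_zero_vec)
  have pos: "0 < mat_inner a a + mat_inner b b"
  proof -
    have "0 < (a $$ (k, 0))\<^sup>2 + (b $$ (k, 0))\<^sup>2"
      using k by (simp add: a_def b_def complex_eq_iff sum_power2_gt_zero_iff)
    then show ?thesis
      using mat_entry_le_mat_inner[OF ab(1) k(1), of 0] mat_entry_le_mat_inner[OF ab(2) k(1), of 0] by simp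
  qed
  \<comment> \<open>The inserted 0 covers q = 0 and makes m nonnegative.\<close>
  define m where "m = Max (insert 0 (\<theta> ` {..<q}))"
  have m: "0 \<le> m" "\<And>k. k < q \<Longrightarrow> \<theta> k \<le> m" unfolding m_def by (auto intro: Max_ge)
  have mpi: "m < pi / 2" unfolding m_def using \<theta> by (subst Max_less_iff) auto
  have "(cmod z)\<^sup>2 * (mat_inner a a + mat_inner b b) \<le> 4 * (m\<^sup>2 * mat_inner a a) + 4 * (m\<^sup>2 * mat_inner b b)"
    unfolding eq[symmetric]
    using gen_norm_bound[OF m ab(1)] gen_norm_bound[OF m ab(2)] by linarith
  also have "\<dots> = (2 * m)\<^sup>2 * (mat_inner a a + mat_inner b b)"
    by (simp add: power_mult_distrib algebra_simps)
  finally have "(cmod z)\<^sup>2 \<le> (2 * m)\<^sup>2" using pos by simp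
  then have "cmod z \<le> 2 * m" by (rule power2_le_imp_le) (use m(1) in simp)
  then show ?thesis using mpi abs_Im_le_cmod[of z] by linarith
qed

text \<open>X is an arbitrary competitor for the principal logarithm. Each complex eigenvector of
  \<open>2 \<cdot>\<^sub>m gen\<close> is one of \<open>mat_exp X\<close>, hence, by the strip
  condition, one of X with the same eigenvalue. These eigenvectors span the space, so the two
  matrices coincide.\<close>

lemma principal_log_agrees:
  assumes X: "X \<in> carrier_mat n n"
    and exp_eq: "mat_exp X = mat_exp (2 \<cdot>\<^sub>m gen)"
    and strip: "\<And>z. eigenvalue (cmat X) z \<Longrightarrow> \<bar>Im z\<bar> < pi"
  shows "X = 2 \<cdot>\<^sub>m gen"
proof -
  have gen2: "2 \<cdot>\<^sub>m gen \<in> carrier_mat n n" using gen_carrier by simp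
  have eigvec: "cmat X *\<^sub>v v = \<zeta> \<cdot>\<^sub>v v"
    if "v \<in> carrier_vec n" "cmat (2 \<cdot>\<^sub>m gen) *\<^sub>v v = \<zeta> \<cdot>\<^sub>v v" "\<bar>Im \<zeta>\<bar> < pi" for v \<zeta>
  proof (rule mat_exp_eigenvector_strip[OF X strip that(1) _ that(3)])
    show "cmat (mat_exp X) *\<^sub>v v = exp \<zeta> \<cdot>\<^sub>v v"
      unfolding exp_eq by (rule mat_exp_eigenvector[OF gen2 that(1,2)])
  qed
  text \<open>The complex eigenvectors \<open>u\<^sub>k - i w\<^sub>k\<close> turn into the real statement that \<open>X\<close> and \<open>2 gen\<close>
    agree on the columns of \<open>U\<close> and \<open>W\<close>.\<close>
  have XUW: "(X * U) $$ (i, k) = 2 * (W * mat_diag q \<theta>) $$ (i, k)"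
    "(X * W) $$ (i, k) = - 2 * (U * mat_diag q \<theta>) $$ (i, k)" if i: "i < n" and k: "k < q" for i k
  proof -
    define v where "v = vec n (\<lambda>i. Complex (U $$ (i, k)) (- W $$ (i, k)))"
    define \<zeta> where "\<zeta> = Complex 0 (2 * \<theta> k)"
    have v: "v \<in> carrier_vec n" by (simp add: v_def)
    have mult: "(cmat A *\<^sub>v v) $ i = Complex ((A * U) $$ (i, k)) (- ((A * W) $$ (i, k)))"
      if "A \<in> carrier_mat n n" "i < n" for A i
    proof -
      have "(cmat A *\<^sub>v v) $ i = (\<Sum>j<n. complex_of_real (A $$ (i, j)) * v $ j)"
        using that v by (simp add: mat_mult_vec_index_sum del: index_mult_mat_vec)
      also have "\<dots> = Complex (\<Sum>j<n. A $$ (i, j) * U $$ (j, k)) (\<Sum>j<n. - (A $$ (i, j) * W $$ (j, k)))"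
        by (simp add: complex_eq_iff v_def)
      also have "\<dots> = Complex ((A * U) $$ (i, k)) (- ((A * W) $$ (i, k)))"
        using that k by (simp add: mat_mult_index_sum sum_negf del: index_mult_mat(1))
      finally show ?thesis .
    qed
    have \<zeta>v: "(\<zeta> \<cdot>\<^sub>v v) $ i = Complex (2 * (U $$ (i, k) * 0 + W $$ (i, k) * \<theta> k)) (2 * (U $$ (i, k) * \<theta> k))"
      if "i < n" for i
      using that by (simp add: v_def \<zeta>_def complex_eq_iff)
    have "cmat (2 \<cdot>\<^sub>m gen) *\<^sub>v v = \<zeta> \<cdot>\<^sub>v v"
    proof (rule eq_vecI)
      fix i assume "i < dim_vec (\<zeta> \<cdot>\<^sub>v v)"
      then have i: "i < n" by (simp add: v_def)
      have "(cmat (2 \<cdot>\<^sub>m gen) *\<^sub>v v) $ i = Complex (2 * (W * mat_diag q \<theta>) $$ (i, k)) (2 * (U * mat_diag q \<theta>) $$ (i, k))"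
        unfolding mult[OF gen2 i] using i k
        by (simp add: mat_smult_mult gen_U gen_W del: index_mult_mat(1))
      then show "(cmat (2 \<cdot>\<^sub>m gen) *\<^sub>v v) $ i = (\<zeta> \<cdot>\<^sub>v v) $ i"
        unfolding \<zeta>v[OF i] using i k by (simp add: mult_mat_diag_index del: index_mult_mat(1))
    qed (simp add: v_def)
    moreover have "\<bar>Im \<zeta>\<bar> < pi" using \<theta>[OF k] by (simp add: \<zeta>_def)
    ultimately have "cmat X *\<^sub>v v = \<zeta> \<cdot>\<^sub>v v" using eigvec[OF v] by blast
    then have "Complex ((X * U) $$ (i, k)) (- ((X * W) $$ (i, k))) =
        Complex (2 * (U $$ (i, k) * 0 + W $$ (i, k) * \<theta> k)) (2 * (U $$ (i, k) * \<theta> k))"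
      using mult[OF X i] \<zeta>v[OF i] by simp
    then show "(X * U) $$ (i, k) = 2 * (W * mat_diag q \<theta>) $$ (i, k)"
      "(X * W) $$ (i, k) = - 2 * (U * mat_diag q \<theta>) $$ (i, k)"
      using i k by (simp_all add: mult_mat_diag_index del: index_mult_mat(1))
  qed
  have XU: "X * U = 2 \<cdot>\<^sub>m gen * U" and XW: "X * W = 2 \<cdot>\<^sub>m gen * W"
    using X XUW by (auto simp: mat_smult_mult gen_U gen_W intro!: eq_matI simp del: index_mult_mat(1))
  \<comment> \<open>The orthogonal projection onto the complement of the columns of U and W. Its
    columns are annihilated by \<open>gen\<close> and serve as vectors for the eigenvalue 0.\<close>
  define T where "T = 1\<^sub>m n - (U * U\<^sup>T + W * W\<^sup>T)"
  have T: "T \<in> carrier_mat n n" by (auto simp: T_def)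
  have dT [simp]: "dim_row T = n" "dim_col T = n" using T by auto
  have genT: "gen * T = 0\<^sub>m n n"
    unfolding T_def
    by (simp add: mat_distrib gen_U_assoc gen_W_assoc) (simp add: gen_def mat_distrib, intro eq_matI, auto)
  have XT: "X * T = 0\<^sub>m n n"
  proof (rule eq_matI)
    fix i j assume "i < dim_row (0\<^sub>m n n :: real mat)" "j < dim_col (0\<^sub>m n n :: real mat)"
    then have ij: "i < n" "j < n" by auto
    define v where "v = vec n (\<lambda>i. complex_of_real (T $$ (i, j)))"
    have v: "v \<in> carrier_vec n" by (simp add: v_def)
    have mult: "(cmat A *\<^sub>v v) $ i = complex_of_real ((A * T) $$ (i, j))"
      if "A \<in> carrier_mat n n" "i < n" for A i
      using that v ij
      by (simp add: mat_mult_vec_index_sum mat_mult_index_sum v_def del: index_mult_mat_vec index_mult_mat(1))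
    have "cmat (2 \<cdot>\<^sub>m gen) *\<^sub>v v = 0 \<cdot>\<^sub>v v"
    proof (rule eq_vecI)
      fix i assume "i < dim_vec (0 \<cdot>\<^sub>v v)"
      then have i: "i < n" by (simp add: v_def)
      show "(cmat (2 \<cdot>\<^sub>m gen) *\<^sub>v v) $ i = (0 \<cdot>\<^sub>v v) $ i"
        unfolding mult[OF gen2 i] using i ij v by (simp add: mat_smult_mult genT)
    qed (simp add: v_def)
    then have "cmat X *\<^sub>v v = 0 \<cdot>\<^sub>v v" by (intro eigvec v) auto
    then show "(X * T) $$ (i, j) = 0\<^sub>m n n $$ (i, j)"
      using mult[OF X ij(1)] v ij by (simp del: index_mult_mat_vec index_mult_mat(1))
  qed (use X in auto)
  have split: "A = A * U * U\<^sup>T + A * W * W\<^sup>T" if A: "A \<in> carrier_mat n n" and AT: "A * T = 0\<^sub>m n n" for A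
  proof -
    have "A * T = A - (A * U * U\<^sup>T + A * W * W\<^sup>T)"
      unfolding T_def using A by (simp add: mat_distrib)
    then have eq: "A - (A * U * U\<^sup>T + A * W * W\<^sup>T) = 0\<^sub>m n n" using AT by simp
    show ?thesis
    proof (rule eq_matI)
      fix i j assume "i < dim_row (A * U * U\<^sup>T + A * W * W\<^sup>T)" "j < dim_col (A * U * U\<^sup>T + A * W * W\<^sup>T)"
      then show "A $$ (i, j) = (A * U * U\<^sup>T + A * W * W\<^sup>T) $$ (i, j)"
        using arg_cong[OF eq, of "\<lambda>M. M $$ (i, j)"] A by (simp del: index_mult_mat(1))
    qed (use A in auto)
  qed
  have gen2T: "2 \<cdot>\<^sub>m gen * T = 0\<^sub>m n n" by (simp add: mat_smult_mult genT)
  show ?thesis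
    using split[OF X XT] split[OF gen2 gen2T] XU XW by metis
qed

lemma mat_log_exp_gen: "mat_log (mat_exp (2 \<cdot>\<^sub>m gen)) = 2 \<cdot>\<^sub>m gen"
  unfolding mat_log_def is_principal_log_def
  by (rule the_equality) (use gen_carrier gen_eigenvalue_strip principal_log_agrees in auto)

end

text \<open>Diagonalizing \<open>U\<^sup>T * Y\<close> aligns the two frames. Its eigenvalues are
  the cosines of the principal angles, positive and hence with angles below pi/2; the part N of the
  rotated Y orthogonal to U has mutually orthogonal columns whose lengths are the sines.\<close>

lemma principal_frame_exists:
  assumes U: "U \<in> stiefel n q" and Y: "Y \<in> stiefel n q" and S: "pos_def q (U\<^sup>T * Y)"
  obtains V W \<theta> where "V \<in> carrier_mat q q" "V\<^sup>T * V = 1\<^sub>m q" "V * V\<^sup>T = 1\<^sub>m q"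
    "principal_frame n q (U * V) W \<theta>"
    "Y * V = U * V * mat_diag q (\<lambda>k. cos (\<theta> k)) + W * mat_diag q (\<lambda>k. sin (\<theta> k))"
proof -
  note U' = stiefelD[OF U] and Y' = stiefelD[OF Y]
  obtain V s where V: "V \<in> carrier_mat q q" "V\<^sup>T * V = 1\<^sub>m q" "V * V\<^sup>T = 1\<^sub>m q" and s0: "\<And>k. k < q \<Longrightarrow> 0 < s k"
    and Sd: "U\<^sup>T * Y = V * mat_diag q s * V\<^sup>T" using pos_defE[OF S] by metis
  define U1 where "U1 = U * V"
  define Y1 where "Y1 = Y * V"
  have d [simp]: "dim_row U1 = n" "dim_col U1 = q" "dim_row Y1 = n" "dim_col Y1 = q"
    using U' Y' V by (auto simp: U1_def Y1_def)
  have VVX: "V\<^sup>T * (V * X) = X" if "dim_row X = q" for X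
    using mat_mult_assoc_eq[OF V(2), of X] V that by simp
  have UU: "U1\<^sup>T * U1 = 1\<^sub>m q"
    using U' V mat_mult_assoc_eq[OF U'(2), of V] by (simp add: U1_def mat_transpose mat_mult_assoc)
  have YY: "Y1\<^sup>T * Y1 = 1\<^sub>m q"
    using Y' V mat_mult_assoc_eq[OF Y'(2), of V] by (simp add: Y1_def mat_transpose mat_mult_assoc)
  have UY: "U1\<^sup>T * Y1 = mat_diag q s"
    using U' Y' V mat_mult_assoc_eq[OF Sd, of V]
    by (simp add: U1_def Y1_def mat_transpose mat_mult_assoc VVX)
  have YU: "Y1\<^sup>T * U1 = mat_diag q s"
    using arg_cong[OF UY, of transpose_mat] by (simp add: mat_transpose)
  have UUX: "U1\<^sup>T * (U1 * X) = X" if "dim_row X = q" for X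
    using mat_mult_assoc_eq[OF UU, of X] that by simp
  have YUX: "Y1\<^sup>T * (U1 * X) = mat_diag q s * X" if "dim_row X = q" for X
    using mat_mult_assoc_eq[OF YU, of X] that by simp
  define N where "N = Y1 - U1 * mat_diag q s"
  have dN [simp]: "dim_row N = n" "dim_col N = q" by (auto simp: N_def)
  have UN: "U1\<^sup>T * N = 0\<^sub>m q q" by (simp add: N_def mat_distrib UY UUX)
  have NN: "N\<^sup>T * N = mat_diag q (\<lambda>k. 1 - s k * s k)"
    by (simp add: N_def mat_transpose mat_distrib YY UUX YUX UY) (intro eq_matI, auto simp: mat_diag_def)
  have NN_col: "(\<Sum>i<n. N $$ (i, k) * N $$ (i, k)) = 1 - s k * s k" if "k < q" for k
    using arg_cong[OF NN, of "\<lambda>M. M $$ (k, k)"] that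
    by (simp add: mat_mult_index_sum del: index_mult_mat(1))
  \<comment> \<open>Otherwise the k-th column of N would have negative squared length.\<close>
  have s1: "s k \<le> 1" if k: "k < q" for k
  proof -
    have "0 \<le> (\<Sum>i<n. N $$ (i, k) * N $$ (i, k))" by (intro sum_nonneg) auto
    then have "s k * s k \<le> 1" using NN_col[OF k] by simp
    then have "(s k)\<^sup>2 \<le> 1\<^sup>2" by (simp add: power2_eq_square)
    then show ?thesis by (rule power2_le_imp_le) simp
  qed
  define \<theta> where "\<theta> k = arccos (s k)" for k
  have cos: "cos (\<theta> k) = s k" if "k < q" for k
    using s0[OF that] s1[OF that] by (simp add: \<theta>_def)
  have th: "0 \<le> \<theta> k" "\<theta> k < pi / 2" if k: "k < q" for k
  proof -
    show "0 \<le> \<theta> k" using s0[OF k] s1[OF k] by (auto simp: \<theta>_def intro: arccos_lbound)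
    have "arccos (s k) < arccos 0" using s0[OF k] s1[OF k] by (intro arccos_less_arccos) auto
    then show "\<theta> k < pi / 2" by (simp add: \<theta>_def)
  qed
  have sin_sq: "sin (\<theta> k) * sin (\<theta> k) = 1 - s k * s k" if "k < q" for k
    using sin_cos_squared_add[of "\<theta> k"] by (simp add: cos[OF that] power2_eq_square algebra_simps)
  have sin0: "sin (\<theta> k) = 0 \<longleftrightarrow> \<theta> k = 0" if k: "k < q" for k
    using sin_gt_zero[of "\<theta> k"] th[OF k] pi_gt_zero by fastforce
  \<comment> \<open>Division by zero gives 0, so W receives zero columns exactly at the vanishing
    angles.\<close>
  define W where "W = N * mat_diag q (\<lambda>k. 1 / sin (\<theta> k))"
  have dW [simp]: "dim_row W = n" "dim_col W = q" by (auto simp: W_def)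
  have UW: "U1\<^sup>T * W = 0\<^sub>m q q"
    using mat_mult_assoc_eq[OF UN] by (simp add: W_def)
  have WW: "W\<^sup>T * W = mat_diag q (\<lambda>k. if \<theta> k = 0 then 0 else 1)"
  proof -
    have "W\<^sup>T * W = mat_diag q (\<lambda>k. 1 / sin (\<theta> k)) * (mat_diag q (\<lambda>k. 1 - s k * s k) * mat_diag q (\<lambda>k. 1 / sin (\<theta> k)))"
      using mat_mult_assoc_eq[OF NN] by (simp add: W_def mat_transpose mat_mult_assoc)
    also have "\<dots> = mat_diag q (\<lambda>k. if \<theta> k = 0 then 0 else 1)"
      unfolding mat_diag_diag
      by (intro eq_matI) (auto simp: sin_sq[symmetric] sin0)
    finally show ?thesis .
  qed
  have NW: "N = W * mat_diag q (\<lambda>k. sin (\<theta> k))"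
  proof (rule eq_matI)
    fix i k assume "i < dim_row (W * mat_diag q (\<lambda>k. sin (\<theta> k)))" "k < dim_col (W * mat_diag q (\<lambda>k. sin (\<theta> k)))"
    then have ik: "i < n" "k < q" by auto
    have "(W * mat_diag q (\<lambda>k. sin (\<theta> k))) $$ (i, k) = N $$ (i, k) * (1 / sin (\<theta> k)) * sin (\<theta> k)"
      using ik by (simp add: W_def mult_mat_diag_index del: index_mult_mat(1))
    also have "\<dots> = N $$ (i, k)"
    proof (cases "sin (\<theta> k) = 0")
      case True
      then have "(\<Sum>i<n. N $$ (i, k) * N $$ (i, k)) = 0" using NN_col[OF ik(2)] sin_sq[OF ik(2)] by simp
      then have "\<forall>i\<in>{..<n}. N $$ (i, k) * N $$ (i, k) = 0"
        by (subst (asm) sum_nonneg_eq_0_iff) auto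
      then show ?thesis using ik by simp
    qed simp
    finally show "N $$ (i, k) = (W * mat_diag q (\<lambda>k. sin (\<theta> k))) $$ (i, k)" by simp
  qed auto
  have "principal_frame n q U1 W \<theta>"
    by unfold_locales (use UU UW WW th in auto)
  moreover have "Y1 = U1 * mat_diag q (\<lambda>k. cos (\<theta> k)) + W * mat_diag q (\<lambda>k. sin (\<theta> k))"
  proof -
    have "mat_diag q (\<lambda>k. cos (\<theta> k)) = mat_diag q s" by (intro eq_matI) (auto simp: cos)
    then show ?thesis unfolding NW[symmetric] by (auto simp: N_def intro!: eq_matI)
  qed
  ultimately show thesis using that V unfolding U1_def Y1_def by blast
qed

text \<open>The generator belongs to the rotated frame \<open>U * V\<close> and is expressed through
  U again. With P = \<open>U * U\<^sup>T\<close>, the equation \<Omega> = \<Omega> P + P \<Omega>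
  says that \<Omega> maps the range of P into its complement and vice versa.\<close>

lemma minimal_rotation_generator:
  assumes U: "U \<in> stiefel n q" and Y: "Y \<in> stiefel n q" and S: "pos_def q (U\<^sup>T * Y)"
  obtains \<Omega> C where "\<Omega> \<in> carrier_mat n n" "\<Omega>\<^sup>T = - \<Omega>" "mat_exp \<Omega> * U = Y"
    "U\<^sup>T * (\<Omega> * U) = 0\<^sub>m q q" "C \<in> carrier_mat q q" "C\<^sup>T = C" "\<Omega> * (\<Omega> * U) = - (U * C)"
    "\<Omega> = \<Omega> * (U * U\<^sup>T) + U * U\<^sup>T * \<Omega>"
    "mat_log (mat_exp (2 \<cdot>\<^sub>m \<Omega>)) = 2 \<cdot>\<^sub>m \<Omega>"
proof -
  note U' = stiefelD[OF U] and Y' = stiefelD[OF Y]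
  obtain V W \<theta> where V: "V \<in> carrier_mat q q" "V\<^sup>T * V = 1\<^sub>m q" "V * V\<^sup>T = 1\<^sub>m q"
    and frame: "principal_frame n q (U * V) W \<theta>"
    and YV: "Y * V = U * V * mat_diag q (\<lambda>k. cos (\<theta> k)) + W * mat_diag q (\<lambda>k. sin (\<theta> k))"
    using principal_frame_exists[OF assms] by metis
  define U1 where "U1 = U * V"
  interpret principal_frame n q U1 W \<theta> using frame by (simp add: U1_def)
  have UV: "U1 * V\<^sup>T = U" using V U' by (simp add: U1_def mat_mult_assoc)
  have U1U1: "U1 * U1\<^sup>T = U * U\<^sup>T"
    using V U' mat_mult_assoc_eq[OF V(3), of "U\<^sup>T"] by (simp add: U1_def mat_transpose mat_mult_assoc)
  let ?T = "mat_diag q \<theta>"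
  have dV [simp]: "dim_row V = q" "dim_col V = q" using V by auto
  show thesis
  proof (rule that[of gen "V * (?T * ?T) * V\<^sup>T"])
    show "mat_exp gen * U = Y"
    proof -
      have "mat_exp gen * U1 = Y * V" using exp_gen_U YV by (simp only: U1_def)
      then have "mat_exp gen * U1 * V\<^sup>T = Y * V * V\<^sup>T" by simp
      then show ?thesis using V Y' UV by (simp add: mat_mult_assoc)
    qed
    have gU: "gen * U = W * (?T * V\<^sup>T)" using gen_U_assoc[of "V\<^sup>T"] UV by simp
    show "U\<^sup>T * (gen * U) = 0\<^sub>m q q"
    proof -
      have "U\<^sup>T = V * U1\<^sup>T" using arg_cong[OF UV, of transpose_mat] by (simp add: mat_transpose)
      then show ?thesis unfolding gU by (simp add: mat_mult_assoc assoc_simps)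
    qed
    show "gen * (gen * U) = - (U * (V * (?T * ?T) * V\<^sup>T))"
    proof -
      have "U1 * X = U * (V * X)" if "dim_row X = q" for X
        using U' that by (simp add: U1_def mat_mult_assoc)
      then show ?thesis unfolding gU using U' by (simp add: gen_W_assoc mat_mult_assoc del: mat_diag_diag)
    qed
    show "gen = gen * (U * U\<^sup>T) + U * U\<^sup>T * gen"
    proof -
      have "gen * (U1 * U1\<^sup>T) = W * ?T * U1\<^sup>T" by (simp add: gen_U_assoc mat_mult_assoc)
      moreover have "U1 * U1\<^sup>T * gen = - (U1 * ?T * W\<^sup>T)"
        unfolding gen_def
        by (simp add: mat_distrib assoc_simps) (intro eq_matI, auto)
      ultimately show ?thesis unfolding U1U1[symmetric] by (simp add: gen_def) (intro eq_matI, auto)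
    qed
  qed (auto simp: gen_carrier gen_skew mat_log_exp_gen mat_transpose mat_mult_assoc)
qed

text \<open>The reflection J = I - 2P anticommutes with \<Omega>, so
  \<open>E * J = J * E\<^sup>T\<close> for E = exp \<Omega>. Since I - 2R is
  \<open>E * J * E\<^sup>T\<close>, its product with J is E^2, whose logarithm is 2\<Omega>.\<close>

lemma grassmann_log_eq:
  assumes U: "U \<in> stiefel n q" and \<Omega>: "\<Omega> \<in> carrier_mat n n" "\<Omega>\<^sup>T = - \<Omega>"
    and Y: "mat_exp \<Omega> * U = Y"
    and off: "\<Omega> = \<Omega> * (U * U\<^sup>T) + U * U\<^sup>T * \<Omega>"
    and log: "mat_log (mat_exp (2 \<cdot>\<^sub>m \<Omega>)) = 2 \<cdot>\<^sub>m \<Omega>"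
  shows "grassmann_log n (U * U\<^sup>T) (Y * Y\<^sup>T) = \<Omega> * (U * U\<^sup>T) - U * U\<^sup>T * \<Omega>"
proof -
  note U' = stiefelD[OF U]
  define P where "P = U * U\<^sup>T"
  define E where "E = mat_exp \<Omega>"
  define J where "J = 1\<^sub>m n - 2 \<cdot>\<^sub>m P"
  have d [simp]: "dim_row P = n" "dim_col P = n" "dim_row E = n" "dim_col E = n" "dim_row J = n" "dim_col J = n"
    "dim_row \<Omega> = n" "dim_col \<Omega> = n"
    using U' \<Omega> by (auto simp: P_def E_def J_def)
  have PP: "P * P = P" using U' mat_mult_assoc_eq[OF U'(2), of "U\<^sup>T"] by (simp add: P_def mat_mult_assoc)
  have JJ: "J * J = 1\<^sub>m n" unfolding J_def by (simp add: mat_distrib PP) (intro eq_matI, auto)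
  have "E\<^sup>T * E = 1\<^sub>m n" using mat_exp_skew_orthogonal[OF \<Omega>, of 1] by (simp add: E_def)
  then have EET: "E * E\<^sup>T = 1\<^sub>m n" by (intro orthogonal_mat_right_inverse) auto
  have ET: "E\<^sup>T = mat_exp (- \<Omega>)" unfolding E_def mat_exp_transpose[OF \<Omega>(1)] \<Omega>(2) ..
  have off': "\<Omega> = \<Omega> * P + P * \<Omega>" using off by (simp add: P_def)
  have "\<Omega> * J = J * (- \<Omega>)"
  proof (rule eq_matI)
    fix i j assume "i < dim_row (J * (- \<Omega>))" "j < dim_col (J * (- \<Omega>))"
    then have ij: "i < n" "j < n" by auto
    have "\<Omega> $$ (i, j) = (\<Omega> * P) $$ (i, j) + (P * \<Omega>) $$ (i, j)"
      using arg_cong[OF off', of "\<lambda>M. M $$ (i, j)"] ij by (simp del: index_mult_mat(1))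
    then show "(\<Omega> * J) $$ (i, j) = (J * (- \<Omega>)) $$ (i, j)"
      using ij by (simp add: J_def mat_distrib del: index_mult_mat(1))
  qed auto
  then have EJ: "E * J = J * E\<^sup>T"
    unfolding ET unfolding E_def using \<Omega> by (intro mat_exp_intertwine[of _ n _ n]) auto
  have "Y * Y\<^sup>T = E * P * E\<^sup>T"
    unfolding Y[symmetric] using U' by (simp add: E_def[symmetric] P_def mat_transpose mat_mult_assoc)
  then have "1\<^sub>m n - 2 \<cdot>\<^sub>m (Y * Y\<^sup>T) = E * J * E\<^sup>T"
    using EET by (simp add: J_def mat_distrib)
  then have "(1\<^sub>m n - 2 \<cdot>\<^sub>m (Y * Y\<^sup>T)) * (1\<^sub>m n - 2 \<cdot>\<^sub>m P) = E * J * E\<^sup>T * J"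
    by (simp add: J_def)
  also have "\<dots> = E * (J * E\<^sup>T) * J" by (simp add: mat_mult_assoc)
  also have "\<dots> = E * (E * J) * J" by (simp only: EJ)
  also have "\<dots> = E * E" using JJ by (simp add: mat_mult_assoc)
  also have "\<dots> = mat_exp (2 \<cdot>\<^sub>m \<Omega>)" unfolding E_def mat_exp_skew_double[OF \<Omega>] ..
  finally have "mat_log ((1\<^sub>m n - 2 \<cdot>\<^sub>m (Y * Y\<^sup>T)) * (1\<^sub>m n - 2 \<cdot>\<^sub>m P)) = 2 \<cdot>\<^sub>m \<Omega>" using log by simp
  moreover have "(1 / 2) \<cdot>\<^sub>m (2 \<cdot>\<^sub>m \<Omega>) = \<Omega>" by (intro eq_matI) auto
  ultimately show ?thesis unfolding grassmann_log_def P_def by simp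
qed

lemma index_join_cols_two:
  assumes "dim_row A = n" "dim_row B = n" "i < n" "j < dim_col A + dim_col B"
  shows "join_cols n [A, B] $$ (i, j) = (if j < dim_col A then A $$ (i, j) else B $$ (i, j - dim_col A))"
  using assms by (auto simp: join_cols_def mat_of_cols_index nth_append)

lemma join_cols_two_dims [simp]:
  "dim_row (join_cols n [A, B]) = n" "dim_col (join_cols n [A, B]) = dim_col A + dim_col B"
  by (auto simp: join_cols_def)

text \<open>The lower blocks have no rows; this form makes the multiplication rule for four-block
  matrices applicable.\<close>

lemma join_cols_two_block:
  assumes "dim_row A = n" "dim_row B = n"
  shows "join_cols n [A, B] = four_block_mat A B (0\<^sub>m 0 (dim_col A)) (0\<^sub>m 0 (dim_col B))"
  using assms by (intro eq_matI) (auto simp: index_join_cols_two)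

text \<open>\<Omega> maps U to \<Omega>U and \<Omega>U to -UC, so on the joined columns G it acts by
  the 2q x 2q matrix K. The first q columns of G exp K are then exp \<Omega> applied to U, and the
  final factor is exp 0.\<close>

theorem holonomy_of_aligned_frames:
  assumes U: "U \<in> stiefel n q" and Y: "Y \<in> stiefel n q" and S: "pos_def q (U\<^sup>T * Y)"
  defines "\<Delta> \<equiv> grassmann_log n (U * U\<^sup>T) (Y * Y\<^sup>T)"
  shows "holonomy n q (U * U\<^sup>T) (Y * Y\<^sup>T) U = Y"
    and "join_cols n [U, \<Delta> * U] * mat_exp (four_block_mat (U\<^sup>T * \<Delta> * U) (- (U\<^sup>T * (\<Delta> * \<Delta>) * U)) (1\<^sub>m q) (U\<^sup>T * \<Delta> * U))
      * (1\<^sub>m q @\<^sub>r 0\<^sub>m q q) * mat_exp (- (U\<^sup>T * \<Delta> * U)) = Y"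
proof -
  note U' = stiefelD[OF U] and Y' = stiefelD[OF Y]
  obtain \<Omega> C where \<Omega>: "\<Omega> \<in> carrier_mat n n" "\<Omega>\<^sup>T = - \<Omega>" and exp: "mat_exp \<Omega> * U = Y"
    and hor: "U\<^sup>T * (\<Omega> * U) = 0\<^sub>m q q" and C: "C \<in> carrier_mat q q" "C\<^sup>T = C"
    and \<Omega>\<Omega>: "\<Omega> * (\<Omega> * U) = - (U * C)"
    and off: "\<Omega> = \<Omega> * (U * U\<^sup>T) + U * U\<^sup>T * \<Omega>" and log: "mat_log (mat_exp (2 \<cdot>\<^sub>m \<Omega>)) = 2 \<cdot>\<^sub>m \<Omega>"
    using minimal_rotation_generator[OF U Y S] by metis
  have \<Delta>: "\<Delta> = \<Omega> * (U * U\<^sup>T) - U * U\<^sup>T * \<Omega>"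
    unfolding \<Delta>_def by (rule grassmann_log_eq[OF U \<Omega> exp off log])
  have d [simp]: "dim_row \<Omega> = n" "dim_col \<Omega> = n" "dim_row \<Delta> = n" "dim_col \<Delta> = n"
    "dim_row C = q" "dim_col C = q"
    using \<Omega> U' C by (auto simp: \<Delta>)
  have \<Delta>U: "\<Delta> * U = \<Omega> * U" using U' by (simp add: \<Delta> mat_distrib hor)
  show "holonomy n q (U * U\<^sup>T) (Y * Y\<^sup>T) U = Y"
    unfolding holonomy_def horizontal_lift_def \<Delta>_def[symmetric] \<Delta>U
    using riem_exp_stiefel_horizontal[OF \<Omega> U C \<Omega>\<Omega> hor] exp by simp
  have A: "U\<^sup>T * \<Delta> * U = 0\<^sub>m q q" using U' by (simp add: mat_mult_assoc \<Delta>U hor)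
  \<comment> \<open>The sign is opposite to that of \<open>\<Omega> * (\<Omega> * U)\<close>:
    \<Delta> agrees with \<Omega> on the range of U and with -\<Omega> on its complement, which
    contains the columns of \<Omega>U.\<close>
  have "\<Delta> * (\<Omega> * U) = U * C"
  proof -
    have "\<Delta> * (\<Omega> * U) = \<Omega> * (U * (U\<^sup>T * (\<Omega> * U))) - U * (U\<^sup>T * (\<Omega> * (\<Omega> * U)))"
      using U' by (simp add: \<Delta> mat_distrib)
    also have "\<dots> = 0\<^sub>m n q - - (U * (U\<^sup>T * (U * C)))" unfolding hor \<Omega>\<Omega> using U' by simp
    also have "\<dots> = U * (U\<^sup>T * (U * C))"
      using U' by (intro eq_matI) (auto simp del: index_mult_mat(1))
    also have "U\<^sup>T * (U * C) = C" using U' mat_mult_assoc_eq[OF U'(2), of C] by simp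
    finally show ?thesis .
  qed
  then have C_eq: "U\<^sup>T * (\<Delta> * \<Delta>) * U = C"
    using U' mat_mult_assoc_eq[OF U'(2), of C] by (simp add: mat_mult_assoc \<Delta>U)
  define K where "K = four_block_mat (0\<^sub>m q q) (- C) (1\<^sub>m q) (0\<^sub>m q q)"
  have K: "K \<in> carrier_mat (q + q) (q + q)" using C by (simp add: K_def)
  define B where "B = \<Omega> * U"
  have dB [simp]: "dim_row B = n" "dim_col B = q" using U' by (auto simp: B_def)
  define G where "G = join_cols n [U, B]"
  have dG: "G \<in> carrier_mat n (q + q)" using U' by (auto simp: G_def)
  have G_block: "G = four_block_mat U B (0\<^sub>m 0 q) (0\<^sub>m 0 q)"
    unfolding G_def using U' by (subst join_cols_two_block) auto
  have "\<Omega> * G = G * K"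
  proof -
    have cB: "B \<in> carrier_mat n q" and cC: "- C \<in> carrier_mat q q" using C by auto
    have "G * K = four_block_mat (U * 0\<^sub>m q q + B * 1\<^sub>m q) (U * - C + B * 0\<^sub>m q q)
        (0\<^sub>m 0 q * 0\<^sub>m q q + 0\<^sub>m 0 q * 1\<^sub>m q) (0\<^sub>m 0 q * - C + 0\<^sub>m 0 q * 0\<^sub>m q q)"
      unfolding G_block K_def
      by (rule mult_four_block_mat[OF U'(1) cB zero_carrier_mat zero_carrier_mat zero_carrier_mat cC
            one_carrier_mat zero_carrier_mat])
    also have "\<dots> = four_block_mat B (- (U * C)) (0\<^sub>m 0 q) (0\<^sub>m 0 q)"
      using U'(3,4) by (intro cong_four_block_mat) simp_all
    finally have "G * K = four_block_mat B (- (U * C)) (0\<^sub>m 0 q) (0\<^sub>m 0 q)" .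
    moreover have "\<Omega> * G = join_cols n [\<Omega> * U, \<Omega> * B]"
      using U' dG
      by (intro eq_matI)
        (auto simp: index_join_cols_two G_def mat_mult_index_sum simp del: index_mult_mat(1))
    moreover have "\<Omega> * B = - (U * C)" unfolding B_def by (rule \<Omega>\<Omega>)
    ultimately show ?thesis
      using U' by (simp add: B_def[symmetric]) (subst join_cols_two_block, auto)
  qed
  from mat_exp_intertwine[OF \<Omega>(1) K dG this] have GK: "G * mat_exp K = mat_exp \<Omega> * G" by simp
  have G_first: "G * (1\<^sub>m q @\<^sub>r 0\<^sub>m q q) = U"
  proof -
    have cB: "B \<in> carrier_mat n q" by auto
    have "G * (1\<^sub>m q @\<^sub>r 0\<^sub>m q q) = four_block_mat (U * 1\<^sub>m q + B * 0\<^sub>m q q) (U * 0\<^sub>m q 0 + B * 0\<^sub>m q 0)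
        (0\<^sub>m 0 q * 1\<^sub>m q + 0\<^sub>m 0 q * 0\<^sub>m q q) (0\<^sub>m 0 q * 0\<^sub>m q 0 + 0\<^sub>m 0 q * 0\<^sub>m q 0)"
      unfolding G_block append_rows_def index_one_mat index_zero_mat
      by (rule mult_four_block_mat[OF U'(1) cB zero_carrier_mat zero_carrier_mat one_carrier_mat
            zero_carrier_mat zero_carrier_mat zero_carrier_mat])
    also have "\<dots> = U" using U'(3,4) by (intro eq_matI) auto
    finally show ?thesis .
  qed
  have dI [simp]: "dim_row (1\<^sub>m q @\<^sub>r 0\<^sub>m q q :: real mat) = q + q" "dim_col (1\<^sub>m q @\<^sub>r 0\<^sub>m q q :: real mat) = q"
    by (auto simp: append_rows_def)
  have "- (0\<^sub>m q q :: real mat) = 0\<^sub>m q q" by (intro eq_matI) auto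
  moreover have "G * mat_exp K * (1\<^sub>m q @\<^sub>r 0\<^sub>m q q) = Y"
    unfolding GK using dG exp G_first by (simp add: mat_mult_assoc)
  ultimately show "join_cols n [U, \<Delta> * U] * mat_exp (four_block_mat (U\<^sup>T * \<Delta> * U) (- (U\<^sup>T * (\<Delta> * \<Delta>) * U)) (1\<^sub>m q) (U\<^sup>T * \<Delta> * U))
      * (1\<^sub>m q @\<^sub>r 0\<^sub>m q q) * mat_exp (- (U\<^sup>T * \<Delta> * U)) = Y"
    unfolding A C_eq \<Delta>U K_def[symmetric] B_def[symmetric] G_def[symmetric] using Y' by simp
qed

section \<open>Grassmannians and cut loci\<close>

text \<open>The adjugate formula keeps every entry rational in the entries of A, which places
  inverses in an algebra of coordinate functions.\<close>

definition det_inverse :: "real mat \<Rightarrow> real mat" where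
  "det_inverse A = (1 / det A) \<cdot>\<^sub>m adj_mat A"

lemma det_inverse:
  assumes A: "A \<in> carrier_mat n n" and "det A \<noteq> 0"
  shows "det_inverse A \<in> carrier_mat n n" "A * det_inverse A = 1\<^sub>m n" "det_inverse A * A = 1\<^sub>m n"
proof -
  note adj = adj_mat[OF A]
  have [simp]: "dim_row (adj_mat A) = n" "dim_col (adj_mat A) = n" "dim_row A = n" "dim_col A = n"
    using adj A by auto
  have *: "(1 / det A) \<cdot>\<^sub>m (det A \<cdot>\<^sub>m 1\<^sub>m n) = 1\<^sub>m n"
    using assms(2) by (intro eq_matI) auto
  show "det_inverse A \<in> carrier_mat n n" by (auto simp: det_inverse_def)
  show "A * det_inverse A = 1\<^sub>m n"
    by (simp add: det_inverse_def mat_mult_smult adj * del: smult_carrier_mat)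
  show "det_inverse A * A = 1\<^sub>m n"
    by (simp add: det_inverse_def mat_smult_mult adj *)
qed

lemma stiefel_rank:
  assumes "Y \<in> stiefel n m"
  shows "vec_space.rank n Y = m"
proof -
  note Y = stiefelD[OF assms]
  interpret vec_space "TYPE(real)" n .
  have col: "(\<Sum>i<n. Y $$ (i, a) * Y $$ (i, b)) = (if a = b then 1 else 0)" if "a < m" "b < m" for a b
    using arg_cong[OF Y(2), of "\<lambda>M. M $$ (a, b)"] that Y(3,4)
    by (simp add: mat_mult_index_sum del: index_mult_mat(1))
  have dist: "distinct (cols Y)"
  proof (rule ccontr)
    assume "\<not> distinct (cols Y)"
    then obtain a b where ab: "a \<noteq> b" "a < m" "b < m" "col Y a = col Y b"
      using Y unfolding distinct_conv_nth by auto
    have "Y $$ (i, a) = Y $$ (i, b)" if "i < n" for i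
      using arg_cong[OF ab(4), of "\<lambda>v. v $ i"] that ab(2,3) Y(3,4) by simp
    then have "(\<Sum>i<n. Y $$ (i, a) * Y $$ (i, b)) = (\<Sum>i<n. Y $$ (i, a) * Y $$ (i, a))" by simp
    then show False using col[of a b] col[of a a] ab by simp
  qed
  moreover have "lin_indpt (set (cols Y))"
  proof
    assume "lin_dep (set (cols Y))"
    then obtain v where v: "v \<in> carrier_vec m" "v \<noteq> 0\<^sub>v m" "Y *\<^sub>v v = 0\<^sub>v n"
      using lin_depE[OF Y(1) _ dist] by blast
    have "Y\<^sup>T * Y *\<^sub>v v = Y\<^sup>T *\<^sub>v 0\<^sub>v n" using Y(3,4) v by (simp add: mat_mult_vec_assoc)
    also have "\<dots> = 0\<^sub>v m" using Y(3,4) by (intro eq_vecI) auto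
    finally show False unfolding Y(2) using v by simp
  qed
  ultimately show ?thesis using lin_indpt_full_rank[OF Y(1)] by simp
qed

text \<open>Y and \<open>Y * Y\<^sup>T\<close> have the same column space:
  \<open>Y\<^sup>T * Y = 1\<close> recovers every Y x as an image under the projection.\<close>

lemma rank_stiefel_proj:
  assumes "Y \<in> stiefel n m"
  shows "vec_space.rank n (Y * Y\<^sup>T) = m"
proof -
  note Y = stiefelD[OF assms]
  interpret vec_space "TYPE(real)" n .
  have R: "Y * Y\<^sup>T \<in> carrier_mat n n" using Y by auto
  have "col_space (Y * Y\<^sup>T) = col_space Y"
  proof -
    have "\<exists>x'\<in>carrier_vec m. Y *\<^sub>v x' = Y * Y\<^sup>T *\<^sub>v x" if "x \<in> carrier_vec n" for x
      using that Y by (intro bexI[of _ "Y\<^sup>T *\<^sub>v x"]) (auto simp: mat_mult_vec_assoc)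
    moreover have "\<exists>x'\<in>carrier_vec n. Y * Y\<^sup>T *\<^sub>v x' = Y *\<^sub>v x" if x: "x \<in> carrier_vec m" for x
    proof (rule bexI[of _ "Y *\<^sub>v x"])
      have "Y * Y\<^sup>T *\<^sub>v (Y *\<^sub>v x) = Y *\<^sub>v (Y\<^sup>T * Y *\<^sub>v x)"
        using x Y(3,4) by (simp add: mat_mult_vec_assoc)
      then show "Y * Y\<^sup>T *\<^sub>v (Y *\<^sub>v x) = Y *\<^sub>v x" unfolding Y(2) using x by simp
    qed (use x Y in auto)
    ultimately show ?thesis
      unfolding col_space_eq[OF R] col_space_eq[OF Y(1)] using Y(3,4)
      by (auto simp del: assoc_mult_mat_vec)
  qed
  then show ?thesis using stiefel_rank[OF assms] unfolding rank_def col_space_def by simp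
qed

text \<open>A symmetric idempotent has eigenvalues 0 and 1 only. The eigenvectors for 1 form the
  frame, and comparing ranks shows that there are q of them.\<close>

lemma grassmann_stiefel:
  assumes "R \<in> grassmann n q"
  obtains Y where "Y \<in> stiefel n q" "R = Y * Y\<^sup>T"
proof -
  have R: "R \<in> carrier_mat n n" "R * R = R" "R\<^sup>T = R" "vec_space.rank n R = q"
    using assms by (auto simp: grassmann_def)
  obtain V d where V: "V \<in> carrier_mat n n" "V\<^sup>T * V = 1\<^sub>m n" and Rd: "R = V * mat_diag n d * V\<^sup>T"
    using real_spectral_theorem[OF R(1,3)] by blast
  have VVX: "V\<^sup>T * (V * X) = X" if "dim_row X = n" for X
    using mat_mult_assoc_eq[OF V(2), of X] V that by simp
  have "mat_diag n d = V\<^sup>T * (R * V)" using V by (simp add: Rd mat_mult_assoc VVX)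
  moreover have "V\<^sup>T * (R * R * V) = mat_diag n d * mat_diag n d"
    using V by (simp add: Rd mat_mult_assoc VVX)
  ultimately have dd: "mat_diag n d * mat_diag n d = mat_diag n d" using R(2) by simp
  have d01: "d k = 0 \<or> d k = 1" if "k < n" for k
    using arg_cong[OF dd, of "\<lambda>M. M $$ (k, k)"] that by simp
  define ks where "ks = filter (\<lambda>k. d k = 1) [0..<n]"
  define m where "m = length ks"
  have ks: "ks ! j < n" "d (ks ! j) = 1" if "j < m" for j
    using nth_mem[of j ks] that unfolding ks_def m_def by auto
  have dist: "distinct ks" by (simp add: ks_def)
  define Y where "Y = mat n m (\<lambda>(i, j). V $$ (i, ks ! j))"
  have col: "(\<Sum>i<n. V $$ (i, a) * V $$ (i, b)) = (if a = b then 1 else 0)" if "a < n" "b < n" for a b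
    using arg_cong[OF V(2), of "\<lambda>M. M $$ (a, b)"] that V(1)
    by (simp add: mat_mult_index_sum del: index_mult_mat(1))
  have Y: "Y \<in> stiefel n m"
    unfolding stiefel_def
  proof (intro CollectI conjI eq_matI)
    fix i j assume "i < dim_row (1\<^sub>m m :: real mat)" "j < dim_col (1\<^sub>m m :: real mat)"
    then have ij: "i < m" "j < m" by auto
    then show "(Y\<^sup>T * Y) $$ (i, j) = 1\<^sub>m m $$ (i, j)"
      using ks col[of "ks ! i" "ks ! j"] dist
      by (simp add: Y_def mat_mult_index_sum nth_eq_iff_index_eq m_def[symmetric] del: index_mult_mat(1))
  qed (auto simp: Y_def)
  have "R = Y * Y\<^sup>T"
  proof (rule eq_matI)
    fix i j assume "i < dim_row (Y * Y\<^sup>T)" "j < dim_col (Y * Y\<^sup>T)"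
    then have ij: "i < n" "j < n" by (auto simp: Y_def)
    have "R $$ (i, j) = (\<Sum>k<n. (V * mat_diag n d) $$ (i, k) * V\<^sup>T $$ (k, j))"
      unfolding Rd using ij V by (subst mat_mult_index_sum) auto
    also have "\<dots> = (\<Sum>k<n. V $$ (i, k) * d k * V $$ (j, k))"
      using ij V by (simp add: mult_mat_diag_index del: index_mult_mat(1))
    also have "\<dots> = (\<Sum>k | k < n \<and> d k = 1. V $$ (i, k) * V $$ (j, k))"
      using d01 by (intro sum.mono_neutral_cong_right) auto
    also have "\<dots> = (\<Sum>k\<in>set ks. V $$ (i, k) * V $$ (j, k))"
      by (intro sum.cong) (auto simp: ks_def)
    also have "\<dots> = (\<Sum>l<m. V $$ (i, ks ! l) * V $$ (j, ks ! l))"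
      unfolding m_def
      by (rule sum.reindex_bij_betw[OF bij_betw_nth[OF dist refl refl],
            of "\<lambda>k. V $$ (i, k) * V $$ (j, k)", symmetric])
    also have "\<dots> = (Y * Y\<^sup>T) $$ (i, j)"
      using ij by (simp add: Y_def mat_mult_index_sum del: index_mult_mat(1))
    finally show "R $$ (i, j) = (Y * Y\<^sup>T) $$ (i, j)" .
  qed (use R in \<open>auto simp: Y_def\<close>)
  moreover have "m = q" using rank_stiefel_proj[OF Y] R(4) calculation by simp
  ultimately show thesis using that Y by blast
qed

lemma stiefel_same_projection:
  assumes U: "U \<in> stiefel n q" and U': "U' \<in> stiefel n q" and eq: "U' * U'\<^sup>T = U * U\<^sup>T"
  shows "U' = U * (U\<^sup>T * U')" "(U\<^sup>T * U')\<^sup>T * (U\<^sup>T * U') = 1\<^sub>m q"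
proof -
  note d = stiefelD[OF U] stiefelD[OF U']
  have "U' = U' * U'\<^sup>T * U'" using d by (simp add: mat_mult_assoc)
  also have "\<dots> = U * (U\<^sup>T * U')" unfolding eq using d by (simp add: mat_mult_assoc)
  finally show *: "U' = U * (U\<^sup>T * U')" .
  have "(U\<^sup>T * U')\<^sup>T * (U\<^sup>T * U') = U'\<^sup>T * (U * (U\<^sup>T * U'))"
    using d by (simp add: mat_transpose mat_mult_assoc)
  also have "\<dots> = U'\<^sup>T * U'" by (simp only: *[symmetric])
  finally show "(U\<^sup>T * U')\<^sup>T * (U\<^sup>T * U') = 1\<^sub>m q" using d by simp
qed

text \<open>\<open>det (U\<^sup>T * R * U)\<close> is the square of
  \<open>det (U\<^sup>T * Y)\<close> for any frame Y of R, and an orthogonal change of U does not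
  alter it. So a rank condition quantified over frames becomes a polynomial condition on R.\<close>

lemma cut_locus_iff_det:
  assumes U: "U \<in> stiefel n q" and R: "R \<in> grassmann n q"
  shows "R \<in> cut_locus n q (U * U\<^sup>T) \<longleftrightarrow> det (U\<^sup>T * R * U) = 0"
proof
  note dU = stiefelD[OF U]
  have det_sq: "det (U'\<^sup>T * (Y * Y\<^sup>T) * U') = (det (U'\<^sup>T * Y))\<^sup>2" if "U' \<in> stiefel n q" "Y \<in> stiefel n q" for U' Y
  proof -
    note d = stiefelD[OF that(1)] stiefelD[OF that(2)]
    have "U'\<^sup>T * (Y * Y\<^sup>T) * U' = (U'\<^sup>T * Y) * (U'\<^sup>T * Y)\<^sup>T" using d by (simp add: mat_transpose mat_mult_assoc)
    moreover have "U'\<^sup>T * Y \<in> carrier_mat q q" using d by auto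
    ultimately show ?thesis
      by (simp add: det_mult[of _ q] det_transpose[of _ q] power2_eq_square)
  qed
  {
    assume "R \<in> cut_locus n q (U * U\<^sup>T)"
    then obtain Y U' where Y: "Y \<in> stiefel n q" "R = Y * Y\<^sup>T" and U': "U' \<in> stiefel n q" "U' * U'\<^sup>T = U * U\<^sup>T"
      and rank: "vec_space.rank q (U'\<^sup>T * Y) < q"
      by (auto simp: cut_locus_def stiefel_proj_def)
    note d = stiefelD[OF U'(1)] stiefelD[OF Y(1)]
    define Q where "Q = U\<^sup>T * U'"
    have Q: "Q \<in> carrier_mat q q" using d dU by (auto simp: Q_def)
    have UQ: "U' = U * Q" "Q\<^sup>T * Q = 1\<^sub>m q"
      using stiefel_same_projection[OF U U'] by (simp_all add: Q_def)
    have "U'\<^sup>T * Y \<in> carrier_mat q q" using d by auto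
    then have "det (U'\<^sup>T * Y) = 0" using vec_space.det_rank_iff[of "U'\<^sup>T * Y" q] rank by auto
    then have "det (U'\<^sup>T * R * U') = 0" using det_sq[OF U'(1) Y(1)] Y(2) by simp
    moreover have "U'\<^sup>T * R * U' = Q\<^sup>T * (U\<^sup>T * R * U) * Q"
      using dU Q d unfolding UQ(1) Y(2) by (simp add: mat_transpose mat_mult_assoc)
    moreover have "U\<^sup>T * R * U \<in> carrier_mat q q" using dU d Y by auto
    ultimately have "det Q\<^sup>T * det (U\<^sup>T * R * U) * det Q = 0"
      using Q by (simp add: det_mult[of _ q])
    moreover have "det Q\<^sup>T * det Q = 1" using det_mult[of "Q\<^sup>T" q Q] Q UQ(2) by simp
    ultimately show "det (U\<^sup>T * R * U) = 0" by auto
  }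
  {
    assume det: "det (U\<^sup>T * R * U) = 0"
    obtain Y where Y: "Y \<in> stiefel n q" "R = Y * Y\<^sup>T" using grassmann_stiefel[OF R] by blast
    have "det (U\<^sup>T * Y) = 0" using det_sq[OF U Y(1)] det Y(2) by simp
    moreover have "U\<^sup>T * Y \<in> carrier_mat q q" using dU stiefelD[OF Y(1)] by auto
    ultimately have "vec_space.rank q (U\<^sup>T * Y) < q" using vec_space.det_zero_low_rank by blast
    then show "R \<in> cut_locus n q (U * U\<^sup>T)"
      unfolding cut_locus_def stiefel_proj_def using Y U by blast
  }
qed

text \<open>The quadratic form at a row D is the squared norm of \<open>D * U\<^sup>T * R\<close>.
  If that vanishes, D lies in the left kernel of an invertible matrix.\<close>

lemma compression_pos_def:
  assumes U: "U \<in> stiefel n q" and R: "R \<in> grassmann n q" and det: "det (U\<^sup>T * R * U) \<noteq> 0"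
  shows "pos_def q (U\<^sup>T * R * U)"
proof (rule pos_defI)
  note dU = stiefelD[OF U]
  have R': "R \<in> carrier_mat n n" "R * R = R" "R\<^sup>T = R" using R by (auto simp: grassmann_def)
  let ?S = "U\<^sup>T * R * U"
  show S: "?S \<in> carrier_mat q q" using dU R' by auto
  show "?S\<^sup>T = ?S" using dU R' by (simp add: mat_transpose mat_mult_assoc)
  fix D :: "real mat" assume D: "D \<in> carrier_mat 1 q" "D \<noteq> 0\<^sub>m 1 q"
  define G where "G = D * U\<^sup>T * R"
  have dG: "dim_row G = 1" "dim_col G = n" using D dU R' by (auto simp: G_def)
  have RRX: "R * (R * X) = R * X" if "dim_row X = n" for X
    using mat_mult_assoc_eq[OF R'(2), of X] R' that by simp
  have DS: "D * ?S = G * (U\<^sup>T * R)\<^sup>T"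
    using D dU R' by (simp add: G_def mat_transpose mat_mult_assoc RRX)
  have "mat_inner D (D * ?S) = mat_inner (D * ?S) D" using D S by (intro mat_inner_comm) auto
  also have "\<dots> = mat_inner G (D * (U\<^sup>T * R))"
    unfolding DS using D dU R' dG by (subst mat_inner_mult_right) auto
  also have "\<dots> = mat_inner G G" using D dU R' by (simp add: G_def mat_mult_assoc)
  finally have eq: "mat_inner D (D * ?S) = mat_inner G G" .
  moreover have "mat_inner G G \<noteq> 0"
  proof
    assume "mat_inner G G = 0"
    then have "G = 0\<^sub>m 1 n" using mat_inner_self_eq_0[of G] dG by simp
    then have "D * ?S = 0\<^sub>m 1 q" unfolding DS using dU R' by simp
    then have "D * ?S * det_inverse ?S = 0\<^sub>m 1 q"
      using det_inverse(1)[OF S det] by simp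
    then have "D = 0\<^sub>m 1 q"
      using D S det_inverse[OF S det] by (simp add: mat_mult_assoc del: mult_carrier_mat)
    then show False using D by simp
  qed
  ultimately show "0 < mat_inner D (D * ?S)" using mat_inner_self_ge_0[of G] by linarith
qed

text \<open>The aligned representative \<open>R U (U\<^sup>T R U)\<^sup>-\<^sup>1\<^sup>/\<^sup>2\<close> of \<open>R\<close> is the polar factor of \<open>R U\<close>.\<close>

lemma aligned_representative:
  assumes U: "U \<in> stiefel n q" and R: "R \<in> grassmann n q" and det: "det (U\<^sup>T * R * U) \<noteq> 0"
  defines "Y \<equiv> R * U * det_inverse (pd_sqrt q (U\<^sup>T * R * U))"
  shows "Y \<in> stiefel n q" "Y * Y\<^sup>T = R" "pos_def q (U\<^sup>T * Y)"
proof -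
  note dU = stiefelD[OF U]
  obtain Y0 where Y0: "Y0 \<in> stiefel n q" "R = Y0 * Y0\<^sup>T" using grassmann_stiefel[OF R] by blast
  note dY0 = stiefelD[OF Y0(1)]
  have R': "R \<in> carrier_mat n n" "R * R = R" "R\<^sup>T = R" using R by (auto simp: grassmann_def)
  define Z where "Z = pd_sqrt q (U\<^sup>T * R * U)"
  have Z: "pos_def q Z" "Z * Z = U\<^sup>T * R * U"
    using pd_sqrt[OF compression_pos_def[OF U R det]] by (auto simp: Z_def)
  note Z' = pos_def_sym[OF Z(1)]
  define I where "I = det_inverse Z"
  have I: "I \<in> carrier_mat q q" "Z * I = 1\<^sub>m q" "I * Z = 1\<^sub>m q"
    using det_inverse[OF Z'(1) pos_def_det[OF Z(1)]] by (auto simp: I_def)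
  have d [simp]: "dim_row U = n" "dim_col U = q" "dim_row R = n" "dim_col R = n"
    "dim_row Z = q" "dim_col Z = q" "dim_row I = q" "dim_col I = q" "dim_row Y0 = n" "dim_col Y0 = q"
    using dU R' Z' I dY0 by auto
  have Y: "Y = R * (U * I)" unfolding Y_def Z_def[symmetric] I_def[symmetric] by (simp add: mat_mult_assoc)
  have ZI: "Z * (I * X) = X" "I * (Z * X) = X" if "dim_row X = q" for X
    using mat_mult_assoc_eq[OF I(2), of X] mat_mult_assoc_eq[OF I(3), of X] that by simp_all
  have URU: "U\<^sup>T * (R * (U * X)) = Z * (Z * X)" if "dim_row X = q" for X
    using mat_mult_assoc_eq[OF Z(2)[symmetric], of X] that by (simp add: mat_mult_assoc)
  have IT: "I\<^sup>T = I"
  proof -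
    have "I\<^sup>T * Z = 1\<^sub>m q" using arg_cong[OF I(2), of transpose_mat] Z'(2) by (simp add: mat_transpose)
    then have "I\<^sup>T * Z * I = I" by simp
    then show ?thesis by (simp add: mat_mult_assoc I(2))
  qed
  have RRX: "R * (R * X) = R * X" if "dim_row X = n" for X
    using mat_mult_assoc_eq[OF R'(2), of X] that by simp
  have "U\<^sup>T * Y = Z" unfolding Y by (simp add: URU I(2))
  then show "pos_def q (U\<^sup>T * Y)" using Z by simp
  have "Y\<^sup>T * Y = 1\<^sub>m q"
    unfolding Y by (simp add: mat_transpose mat_mult_assoc IT R'(3) RRX URU ZI I)
  then show Yst: "Y \<in> stiefel n q" by (auto simp: stiefel_def Y)
  \<comment> \<open>Q is square, so \<open>Q\<^sup>T * Q = 1\<close> also yields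
    \<open>Q * Q\<^sup>T = 1\<close>; this shows that Y spans the whole range of R.\<close>
  define Q where "Q = Y0\<^sup>T * (U * I)"
  have Q: "Q \<in> carrier_mat q q" by (auto simp: Q_def)
  have YQ: "Y = Y0 * Q" unfolding Y Q_def Y0(2) by (simp add: mat_mult_assoc)
  have "Q\<^sup>T * Q = Y\<^sup>T * Y"
    unfolding YQ using Q mat_mult_assoc_eq[OF dY0(2), of Q] by (simp add: mat_transpose mat_mult_assoc)
  then have "Q * Q\<^sup>T = 1\<^sub>m q" using stiefelD(2)[OF Yst] by (intro orthogonal_mat_right_inverse[OF Q]) simp
  then show "Y * Y\<^sup>T = R"
    unfolding YQ using Q mat_mult_assoc_eq[of Q "Q\<^sup>T" "1\<^sub>m q" "Y0\<^sup>T"]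
    by (simp add: mat_transpose mat_mult_assoc Y0(2))
qed

text \<open>Two expressions for one frame: the first contains neither exponential nor logarithm and
  is the source of smoothness, the last is the explicit formula.\<close>

lemma holonomy_outside_cut_locus:
  assumes U: "U \<in> stiefel n q" and R: "R \<in> grassmann n q" and cut: "R \<notin> cut_locus n q (U * U\<^sup>T)"
  defines "\<Delta> \<equiv> grassmann_log n (U * U\<^sup>T) R" and "H \<equiv> holonomy n q (U * U\<^sup>T) R U"
  shows "H = R * U * det_inverse (pd_sqrt q (U\<^sup>T * R * U))" "H \<in> stiefel n q" "H * H\<^sup>T = R"
    "join_cols n [U, \<Delta> * U] * mat_exp (four_block_mat (U\<^sup>T * \<Delta> * U) (- (U\<^sup>T * (\<Delta> * \<Delta>) * U)) (1\<^sub>m q) (U\<^sup>T * \<Delta> * U))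
      * (1\<^sub>m q @\<^sub>r 0\<^sub>m q q) * mat_exp (- (U\<^sup>T * \<Delta> * U)) = H"
proof -
  have det: "det (U\<^sup>T * R * U) \<noteq> 0" using cut cut_locus_iff_det[OF U R] by simp
  define Y where "Y = R * U * det_inverse (pd_sqrt q (U\<^sup>T * R * U))"
  note Y = aligned_representative[OF U R det, folded Y_def]
  note hol = holonomy_of_aligned_frames[OF U Y(1,3)]
  have "H = Y" using hol(1) Y(2) by (simp add: H_def)
  then show "H = R * U * det_inverse (pd_sqrt q (U\<^sup>T * R * U))" "H \<in> stiefel n q" "H * H\<^sup>T = R"
    "join_cols n [U, \<Delta> * U] * mat_exp (four_block_mat (U\<^sup>T * \<Delta> * U) (- (U\<^sup>T * (\<Delta> * \<Delta>) * U)) (1\<^sub>m q) (U\<^sup>T * \<Delta> * U))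
      * (1\<^sub>m q @\<^sub>r 0\<^sub>m q q) * mat_exp (- (U\<^sup>T * \<Delta> * U)) = H"
    using Y hol(2) by (simp_all add: Y_def \<Delta>_def)
qed

section \<open>Differentially closed algebras of coordinate functions\<close>

text \<open>Rational expressions in the coordinates and in extra generators G, with W guarding
  against zero denominators. Being generated inductively, the class allows continuity and
  differentiability to be proved by induction on the construction of a function.\<close>

inductive coord_algebra ::
  "'i set \<Rightarrow> ('i \<Rightarrow> real) set \<Rightarrow> (('i \<Rightarrow> real) \<Rightarrow> real) set \<Rightarrow> (('i \<Rightarrow> real) \<Rightarrow> real) \<Rightarrow> bool"
  for I W G where
  const: "coord_algebra I W G (\<lambda>_. c)"
| coord: "i \<in> I \<Longrightarrow> coord_algebra I W G (\<lambda>x. x i)"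
| gen: "g \<in> G \<Longrightarrow> coord_algebra I W G g"
| add: "coord_algebra I W G f \<Longrightarrow> coord_algebra I W G g \<Longrightarrow> coord_algebra I W G (\<lambda>x. f x + g x)"
| mult: "coord_algebra I W G f \<Longrightarrow> coord_algebra I W G g \<Longrightarrow> coord_algebra I W G (\<lambda>x. f x * g x)"
| inverse: "coord_algebra I W G f \<Longrightarrow> (\<And>x. x \<in> W \<Longrightarrow> f x \<noteq> 0) \<Longrightarrow>
    coord_algebra I W G (\<lambda>x. inverse (f x))"

lemma coord_algebra_sum:
  assumes "finite A" "\<And>a. a \<in> A \<Longrightarrow> coord_algebra I W G (f a)"
  shows "coord_algebra I W G (\<lambda>x. \<Sum>a\<in>A. f a x)"
  using assms by (induction A rule: finite_induct) (auto intro: coord_algebra.intros)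

lemma coord_algebra_prod:
  assumes "finite A" "\<And>a. a \<in> A \<Longrightarrow> coord_algebra I W G (f a)"
  shows "coord_algebra I W G (\<lambda>x. \<Prod>a\<in>A. f a x)"
  using assms by (induction A rule: finite_induct) (auto intro: coord_algebra.intros)

lemma coord_algebra_det:
  assumes "\<And>x. M x \<in> carrier_mat n n"
    and "\<And>a b. a < n \<Longrightarrow> b < n \<Longrightarrow> coord_algebra I W G (\<lambda>x. M x $$ (a, b))"
  shows "coord_algebra I W G (\<lambda>x. det (M x))"
proof -
  have "(\<lambda>x. det (M x)) = (\<lambda>x. \<Sum>p | p permutes {0..<n}. signof p * (\<Prod>i = 0..<n. M x $$ (i, p i)))"
    using det_def'[OF assms(1)] by auto
  moreover have "coord_algebra I W G (\<lambda>x. \<Sum>p | p permutes {0..<n}. signof p * (\<Prod>i = 0..<n. M x $$ (i, p i)))"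
    by (intro coord_algebra_sum coord_algebra.mult coord_algebra.const coord_algebra_prod assms(2))
      (auto simp: finite_permutations permutes_in_image)
  ultimately show ?thesis by simp
qed

lemma coord_algebra_mat_mult:
  assumes "\<And>x. M x \<in> carrier_mat n k" "\<And>x. N x \<in> carrier_mat k m" "a < n" "b < m"
    and "\<And>a b. a < n \<Longrightarrow> b < k \<Longrightarrow> coord_algebra I W G (\<lambda>x. M x $$ (a, b))"
    and "\<And>a b. a < k \<Longrightarrow> b < m \<Longrightarrow> coord_algebra I W G (\<lambda>x. N x $$ (a, b))"
  shows "coord_algebra I W G (\<lambda>x. (M x * N x) $$ (a, b))"
proof -
  have dims: "dim_row (M x) = n" "dim_col (M x) = k" "dim_row (N x) = k" "dim_col (N x) = m" for x
    using assms(1,2)[of x] by auto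
  have "(\<lambda>x. (M x * N x) $$ (a, b)) = (\<lambda>x. \<Sum>l<k. M x $$ (a, l) * N x $$ (l, b))"
    using assms(3,4) dims by (intro ext) (simp add: mat_mult_index_sum del: index_mult_mat(1))
  moreover have "coord_algebra I W G (\<lambda>x. \<Sum>l<k. M x $$ (a, l) * N x $$ (l, b))"
    using assms by (intro coord_algebra_sum coord_algebra.mult) auto
  ultimately show ?thesis by simp
qed

text \<open>Through \<open>insert_index\<close> each entry of the minor is an entry of A at a fixed
  position, so membership of the entries in the algebra passes to the minor.\<close>

lemma index_adj_mat:
  assumes "A \<in> carrier_mat n n" "i < n" "j < n"
  shows "adj_mat A $$ (i, j) = (-1) ^ (j + i) *
    det (mat (n - 1) (n - 1) (\<lambda>(r, c). A $$ (insert_index j r, insert_index i c)))"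
proof -
  have "mat_delete A j i = mat (n - 1) (n - 1) (\<lambda>(r, c). A $$ (insert_index j r, insert_index i c))"
    using assms by (auto simp: mat_delete_def insert_index_def)
  then show ?thesis using assms by (simp add: adj_mat_def cofactor_def)
qed

lemma coord_algebra_det_inverse:
  assumes M: "\<And>x. M x \<in> carrier_mat n n" and ab: "a < n" "b < n"
    and alg: "\<And>a b. a < n \<Longrightarrow> b < n \<Longrightarrow> coord_algebra I W G (\<lambda>x. M x $$ (a, b))"
    and det: "\<And>x. x \<in> W \<Longrightarrow> det (M x) \<noteq> 0"
  shows "coord_algebra I W G (\<lambda>x. det_inverse (M x) $$ (a, b))"
proof -
  have "(\<lambda>x. det_inverse (M x) $$ (a, b)) = (\<lambda>x. inverse (det (M x)) * ((-1) ^ (b + a) *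
      det (mat (n - 1) (n - 1) (\<lambda>(r, c). M x $$ (insert_index b r, insert_index a c)))))"
  proof
    fix x
    have "dim_row (adj_mat (M x)) = n" "dim_col (adj_mat (M x)) = n" using adj_mat(1)[OF M, of x] by auto
    then show "det_inverse (M x) $$ (a, b) = inverse (det (M x)) * ((-1) ^ (b + a) *
      det (mat (n - 1) (n - 1) (\<lambda>(r, c). M x $$ (insert_index b r, insert_index a c))))"
      using ab by (simp add: det_inverse_def index_adj_mat[OF M] divide_inverse)
  qed
  moreover have "coord_algebra I W G (\<lambda>x. inverse (det (M x)) * ((-1) ^ (b + a) *
      det (mat (n - 1) (n - 1) (\<lambda>(r, c). M x $$ (insert_index b r, insert_index a c)))))"
  proof (intro coord_algebra.mult coord_algebra.inverse[OF coord_algebra_det[OF M alg] det] coord_algebra.const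
      coord_algebra_det[of _ "n - 1"])
    fix r c assume rc: "r < n - 1" "c < n - 1"
    then have "insert_index b r < n" "insert_index a c < n" by (auto simp: insert_index_def)
    from alg[OF this] rc show "coord_algebra I W G (\<lambda>x. mat (n - 1) (n - 1)
        (\<lambda>(r, c). M x $$ (insert_index b r, insert_index a c)) $$ (r, c))"
      by simp
  qed auto
  ultimately show ?thesis by simp
qed

lemma coord_algebra_continuous:
  assumes f: "coord_algebra I W G f"
    and gens: "\<And>g. g \<in> G \<Longrightarrow> continuous_map (subtopology (coord_space I) W) euclideanreal g"
  shows "continuous_map (subtopology (coord_space I) W) euclideanreal f"
  using f
proof induction
  case (coord i)
  then show ?case
    by (intro continuous_map_from_subtopology continuous_map_product_projection)
next
  case (inverse f)
  then show ?case by (intro continuous_map_real_inverse) auto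
qed (simp_all add: gens continuous_map_add continuous_map_real_mult)

lemma coord_algebra_partial_derivative:
  assumes f: "coord_algebra I W G f"
    and gens: "\<And>g. g \<in> G \<Longrightarrow> \<exists>g'. coord_algebra I W G g' \<and>
      (\<forall>x\<in>W. ((\<lambda>t. g (x(i := t))) has_real_derivative g' x) (at (x i)))"
  shows "\<exists>f'. coord_algebra I W G f' \<and>
      (\<forall>x\<in>W. ((\<lambda>t. f (x(i := t))) has_real_derivative f' x) (at (x i)))"
  using f
proof induction
  case (const c)
  show ?case by (rule exI[of _ "\<lambda>_. 0"]) (auto intro: coord_algebra.const)
next
  case (coord j)
  show ?case
  proof (cases "j = i")
    case True
    then show ?thesis
      by (intro exI[of _ "\<lambda>_. 1"]) (auto intro: coord_algebra.const)
  next
    case False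
    then show ?thesis by (intro exI[of _ "\<lambda>_. 0"]) (auto intro: coord_algebra.const)
  qed
next
  case (gen g)
  then show ?case by (rule gens)
next
  case (add f g)
  then obtain f' g' where f': "coord_algebra I W G f'" "coord_algebra I W G g'"
    "\<And>x. x \<in> W \<Longrightarrow> ((\<lambda>t. f (x(i := t))) has_real_derivative f' x) (at (x i))"
    "\<And>x. x \<in> W \<Longrightarrow> ((\<lambda>t. g (x(i := t))) has_real_derivative g' x) (at (x i))" by blast
  have "((\<lambda>t. f (x(i := t)) + g (x(i := t))) has_real_derivative f' x + g' x) (at (x i))"
    if "x \<in> W" for x
    using DERIV_add[OF f'(3,4)[OF that]] .
  moreover have "coord_algebra I W G (\<lambda>x. f' x + g' x)" using f' by (intro coord_algebra.add)
  ultimately show ?case by blast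
next
  case (mult f g)
  then obtain f' g' where f': "coord_algebra I W G f'" "coord_algebra I W G g'"
    "\<And>x. x \<in> W \<Longrightarrow> ((\<lambda>t. f (x(i := t))) has_real_derivative f' x) (at (x i))"
    "\<And>x. x \<in> W \<Longrightarrow> ((\<lambda>t. g (x(i := t))) has_real_derivative g' x) (at (x i))" by blast
  have "((\<lambda>t. f (x(i := t)) * g (x(i := t))) has_real_derivative f' x * g x + g' x * f x) (at (x i))"
    if "x \<in> W" for x
    using DERIV_mult[OF f'(3,4)[OF that]] by simp
  moreover have "coord_algebra I W G (\<lambda>x. f' x * g x + g' x * f x)"
    using f' mult by (intro coord_algebra.add coord_algebra.mult)
  ultimately show ?case by blast
next
  case (inverse f)
  then obtain f' where f': "coord_algebra I W G f'"
    "\<And>x. x \<in> W \<Longrightarrow> ((\<lambda>t. f (x(i := t))) has_real_derivative f' x) (at (x i))" by blast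
  have "((\<lambda>t. inverse (f (x(i := t)))) has_real_derivative - 1 * (inverse (f x) * f' x * inverse (f x))) (at (x i))"
    if "x \<in> W" for x
    using DERIV_inverse'[OF f'(2)[OF that]] inverse.hyps(2)[OF that] by simp
  moreover have "coord_algebra I W G (\<lambda>x. - 1 * (inverse (f x) * f' x * inverse (f x)))"
    using f' inverse.hyps by (intro coord_algebra.mult coord_algebra.const coord_algebra.inverse)
  ultimately show ?case by blast
qed

text \<open>An algebra of continuous functions that is closed under partial derivatives consists of smooth
  functions; closure needs to be checked only on the generators.\<close>

lemma coord_algebra_smooth:
  assumes f: "coord_algebra I W G f"
    and cont: "\<And>g. g \<in> G \<Longrightarrow> continuous_map (subtopology (coord_space I) W) euclideanreal g"
    and gens: "\<And>g i. g \<in> G \<Longrightarrow> i \<in> I \<Longrightarrow> \<exists>g'. coord_algebra I W G g' \<and>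
      (\<forall>x\<in>W. ((\<lambda>t. g (x(i := t))) has_real_derivative g' x) (at (x i)))"
  shows "Ck_on k I W f"
  using f
\<comment> \<open>f varies because the induction hypothesis is applied to its partial
  derivatives.\<close>
proof (induction k arbitrary: f)
  case 0
  then show ?case using coord_algebra_continuous cont by auto
next
  case (Suc k)
  have "\<exists>f'. Ck_on k I W f' \<and> (\<forall>x\<in>W. ((\<lambda>t. f (x(i := t))) has_real_derivative f' x) (at (x i)))"
    if "i \<in> I" for i
    using coord_algebra_partial_derivative[OF Suc.prems gens] that Suc.IH by metis
  then show ?case using coord_algebra_continuous[OF Suc.prems cont] by simp
qed

section \<open>Limits along coordinate lines\<close>

lemma continuous_map_coord_line:
  assumes x: "x \<in> topspace (coord_space I)" and i: "i \<in> I"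
  shows "continuous_map euclideanreal (coord_space I) (\<lambda>t. x(i := t))"
  unfolding continuous_map_componentwise
proof (intro conjI ballI)
  show "(\<lambda>t. x(i := t)) ` topspace euclideanreal \<subseteq> extensional I"
    using x i by (auto simp: PiE_def extensional_def)
  fix k assume "k \<in> I"
  show "continuous_map euclideanreal euclideanreal (\<lambda>t. (x(i := t)) k)"
    by (cases "k = i") (auto intro: continuous_intros)
qed

lemma open_coord_line:
  assumes W: "openin (coord_space I) W" and x: "x \<in> W" and i: "i \<in> I"
  shows "open {t. x(i := t) \<in> W}"
proof -
  have "x \<in> topspace (coord_space I)" using W x openin_subset by blast
  from openin_continuous_map_preimage[OF continuous_map_coord_line[OF this i] W]
  show ?thesis by simp
qed

text \<open>Partial derivatives are taken along t -> x(i := t); this passes from continuity in the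
  product topology to limits on the real line.\<close>

lemma tendsto_coord_line:
  assumes W: "openin (coord_space I) W" and x: "x \<in> W" and i: "i \<in> I"
    and f: "continuous_map (subtopology (coord_space I) W) euclideanreal f"
  shows "((\<lambda>t. f (x(i := t))) \<longlongrightarrow> f x) (at (x i))"
proof -
  define T where "T = {t. x(i := t) \<in> W}"
  have T: "open T" "x i \<in> T" using open_coord_line[OF W x i] x by (auto simp: T_def)
  have "x \<in> topspace (coord_space I)" using W x openin_subset by blast
  then have "continuous_map (top_of_set T) (subtopology (coord_space I) W) (\<lambda>t. x(i := t))"
    using continuous_map_coord_line[OF _ i]
    by (auto simp: continuous_map_in_subtopology T_def intro: continuous_map_from_subtopology)
  from continuous_map_compose[OF this f]
  have "continuous_on T (\<lambda>t. f (x(i := t)))" by (simp add: o_def)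
  then have "continuous (at (x i)) (\<lambda>t. f (x(i := t)))"
    using T by (simp add: continuous_on_eq_continuous_at)
  then show ?thesis by (simp add: continuous_at)
qed

lemma tendsto_det:
  fixes M :: "'b \<Rightarrow> real mat"
  assumes M: "\<And>t. M t \<in> carrier_mat n n" and L: "L \<in> carrier_mat n n"
    and lim: "\<And>a b. a < n \<Longrightarrow> b < n \<Longrightarrow> ((\<lambda>t. M t $$ (a, b)) \<longlongrightarrow> L $$ (a, b)) F"
  shows "((\<lambda>t. det (M t)) \<longlongrightarrow> det L) F"
  unfolding det_def'[OF M] det_def'[OF L]
  by (intro tendsto_sum tendsto_mult tendsto_const tendsto_prod lim) (auto simp: permutes_in_image)

lemma tendsto_det_inverse:
  fixes M :: "'b \<Rightarrow> real mat"
  assumes M: "\<And>t. M t \<in> carrier_mat n n" and L: "L \<in> carrier_mat n n" and det: "det L \<noteq> 0"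
    and lim: "\<And>a b. a < n \<Longrightarrow> b < n \<Longrightarrow> ((\<lambda>t. M t $$ (a, b)) \<longlongrightarrow> L $$ (a, b)) F"
    and ab: "a < n" "b < n"
  shows "((\<lambda>t. det_inverse (M t) $$ (a, b)) \<longlongrightarrow> det_inverse L $$ (a, b)) F"
proof -
  have eq: "det_inverse A $$ (a, b) = inverse (det A) * ((-1) ^ (b + a) *
      det (mat (n - 1) (n - 1) (\<lambda>(r, c). A $$ (insert_index b r, insert_index a c))))"
    if "A \<in> carrier_mat n n" for A
    using that adj_mat(1)[OF that] ab by (simp add: det_inverse_def index_adj_mat divide_inverse)
  show ?thesis
    unfolding eq[OF M] eq[OF L]
  proof (intro tendsto_mult tendsto_const tendsto_inverse tendsto_det[OF M L] lim det tendsto_det[of _ "n - 1"])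
    fix r c assume rc: "r < n - 1" "c < n - 1"
    then have "insert_index b r < n" "insert_index a c < n" by (auto simp: insert_index_def)
    from lim[OF this] rc show "((\<lambda>t. mat (n - 1) (n - 1) (\<lambda>(r, c). M t $$ (insert_index b r, insert_index a c)) $$ (r, c)) \<longlongrightarrow>
        mat (n - 1) (n - 1) (\<lambda>(r, c). L $$ (insert_index b r, insert_index a c)) $$ (r, c)) F"
      by simp
  qed auto
qed

section \<open>The Sylvester operator as a matrix\<close>

lemma pair_index_less:
  assumes "a < q" "b < q"
  shows "a * q + b < q * (q::nat)"
proof -
  have "a * q + b < (a + 1) * q" using assms by simp
  also have "\<dots> \<le> q * q" using assms by (intro mult_right_mono) auto
  finally show ?thesis .
qed

lemma div_mod_less: "s < q * q \<Longrightarrow> s div q < q" "s < q * q \<Longrightarrow> s mod q < (q::nat)"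
  by (metis less_mult_imp_div_less) (metis mod_less_divisor not_less0 mult_is_0 gr0I)

lemma sum_div_mod:
  fixes f :: "nat \<Rightarrow> nat \<Rightarrow> 'a::comm_monoid_add"
  shows "(\<Sum>s<q * q. f (s div q) (s mod q)) = (\<Sum>c<q. \<Sum>d<q. f c d)"
proof -
  have "(\<Sum>c<q. \<Sum>d<q. f c d) = (\<Sum>(c, d)\<in>{..<q} \<times> {..<q}. f c d)"
    by (rule sum.cartesian_product)
  also have "\<dots> = (\<Sum>s<q * q. f (s div q) (s mod q))"
  proof (rule sum.reindex_bij_witness[of _ "\<lambda>s. (s div q, s mod q)" "\<lambda>(c, d). c * q + d"]; clarsimp)
    fix c d assume "c < q" "d < q"
    then show "c * q + d < q * q" by (rule pair_index_less)
  next
    fix s assume "s < q * q"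
    then show "s div q < q \<and> s mod q < q" by (simp add: div_mod_less)
  qed
  finally show ?thesis ..
qed

definition mat_to_vec :: "nat \<Rightarrow> real mat \<Rightarrow> real vec" where
  "mat_to_vec q D = vec (q * q) (\<lambda>s. D $$ (s div q, s mod q))"

text \<open>The operator D -> Z D + D Z' in row-major order, that is
  \<open>Z \<otimes> I + I \<otimes> Z'\<^sup>T\<close>, with the pair (a, b) coded as
  \<open>a * q + b\<close>.\<close>

definition sylvester_mat :: "nat \<Rightarrow> real mat \<Rightarrow> real mat \<Rightarrow> real mat" where
  "sylvester_mat q Z Z' = mat (q * q) (q * q) (\<lambda>(r, s).
     (if r mod q = s mod q then Z $$ (r div q, s div q) else 0) +
     (if r div q = s div q then Z' $$ (s mod q, r mod q) else 0))"

lemma sylvester_mat_carrier [simp]: "sylvester_mat q Z Z' \<in> carrier_mat (q * q) (q * q)"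
  by (simp add: sylvester_mat_def)

lemma sylvester_mat_mult:
  assumes "Z \<in> carrier_mat q q" "Z' \<in> carrier_mat q q" "D \<in> carrier_mat q q"
  shows "sylvester_mat q Z Z' *\<^sub>v mat_to_vec q D = mat_to_vec q (Z * D + D * Z')"
proof (rule eq_vecI)
  fix r assume "r < dim_vec (mat_to_vec q (Z * D + D * Z'))"
  then have r: "r < q * q" by (simp add: mat_to_vec_def)
  define a where "a = r div q"
  define b where "b = r mod q"
  have ab: "a < q" "b < q" using div_mod_less[OF r] by (auto simp: a_def b_def)
  have "(sylvester_mat q Z Z' *\<^sub>v mat_to_vec q D) $ r = (\<Sum>s<q * q.
      ((if b = s mod q then Z $$ (a, s div q) else 0) + (if a = s div q then Z' $$ (s mod q, b) else 0)) * D $$ (s div q, s mod q))"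
    unfolding a_def b_def
    using r by (simp add: mat_mult_vec_index_sum sylvester_mat_def mat_to_vec_def del: index_mult_mat_vec)
  also have "\<dots> = (\<Sum>c<q. \<Sum>d<q. ((if b = d then Z $$ (a, c) else 0) + (if a = c then Z' $$ (d, b) else 0)) * D $$ (c, d))"
    by (rule sum_div_mod[of "\<lambda>c d. ((if b = d then Z $$ (a, c) else 0) + (if a = c then Z' $$ (d, b) else 0)) * D $$ (c, d)"])
  also have "\<dots> = (\<Sum>c<q. \<Sum>d<q. if b = d then Z $$ (a, c) * D $$ (c, d) else 0) +
      (\<Sum>c<q. \<Sum>d<q. if a = c then D $$ (c, d) * Z' $$ (d, b) else 0)"
    unfolding sum.distrib[symmetric] by (intro sum.cong) (auto simp: algebra_simps)
  also have "(\<Sum>c<q. \<Sum>d<q. if b = d then Z $$ (a, c) * D $$ (c, d) else 0) = (\<Sum>c<q. Z $$ (a, c) * D $$ (c, b))"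
    using ab by simp
  also have "(\<Sum>c<q. \<Sum>d<q. if a = c then D $$ (c, d) * Z' $$ (d, b) else 0) = (\<Sum>d<q. D $$ (a, d) * Z' $$ (d, b))"
    using ab by (subst sum.swap) simp
  finally show "(sylvester_mat q Z Z' *\<^sub>v mat_to_vec q D) $ r = mat_to_vec q (Z * D + D * Z') $ r"
    using r ab assms
    by (simp add: mat_to_vec_def a_def[symmetric] b_def[symmetric] mat_mult_index_sum del: index_mult_mat(1))
qed (simp add: mat_to_vec_def sylvester_mat_def)

text \<open>A kernel vector, folded back into a square matrix, solves the homogeneous Sylvester
  equation.\<close>

lemma sylvester_mat_det:
  assumes Z: "pos_def q Z" "pos_def q Z'"
  shows "det (sylvester_mat q Z Z') \<noteq> 0"
proof
  assume "det (sylvester_mat q Z Z') = 0"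
  then obtain v where v: "v \<in> carrier_vec (q * q)" "v \<noteq> 0\<^sub>v (q * q)" "sylvester_mat q Z Z' *\<^sub>v v = 0\<^sub>v (q * q)"
    using det_0_iff_vec_prod_zero_field[OF sylvester_mat_carrier] by blast
  note d = pos_def_sym(1)[OF Z(1)] pos_def_sym(1)[OF Z(2)]
  define D where "D = mat q q (\<lambda>(a, b). v $ (a * q + b))"
  have D: "D \<in> carrier_mat q q" by (simp add: D_def)
  have vD: "mat_to_vec q D = v"
    using v(1) by (intro eq_vecI) (auto simp: mat_to_vec_def D_def div_mod_less)
  have eq: "mat_to_vec q (Z * D + D * Z') = 0\<^sub>v (q * q)"
    using sylvester_mat_mult[OF d D] v(3) vD by simp
  have "Z * D + D * Z' = 0\<^sub>m q q"
  proof (rule eq_matI)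
    fix a b assume "a < dim_row (0\<^sub>m q q :: real mat)" "b < dim_col (0\<^sub>m q q :: real mat)"
    then have ab: "a < q" "b < q" by auto
    then have "a * q + b < q * q" by (rule pair_index_less)
    then show "(Z * D + D * Z') $$ (a, b) = 0\<^sub>m q q $$ (a, b)"
      using arg_cong[OF eq, of "\<lambda>v. v $ (a * q + b)"] ab
      by (simp add: mat_to_vec_def del: index_mult_mat(1) index_add_mat(1))
  qed (use d D in auto)
  then have "D = 0\<^sub>m q q" by (rule sylvester_injective[OF Z D])
  then have "v = 0\<^sub>v (q * q)"
    unfolding vD[symmetric] by (intro eq_vecI) (auto simp: mat_to_vec_def div_mod_less)
  then show False using v(2) by simp
qed

text \<open>Cramer's rule: the solution becomes rational in the entries of Z, Z' and E, hence
  continuous in them and a member of any algebra that contains them.\<close>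

lemma sylvester_solution:
  assumes Z: "pos_def q Z" "pos_def q Z'" and D: "D \<in> carrier_mat q q" and E: "Z * D + D * Z' = E"
    and ab: "a < q" "b < q"
  shows "D $$ (a, b) = (\<Sum>s<q * q. det_inverse (sylvester_mat q Z Z') $$ (a * q + b, s) * E $$ (s div q, s mod q))"
proof -
  note d = pos_def_sym(1)[OF Z(1)] pos_def_sym(1)[OF Z(2)]
  let ?K = "sylvester_mat q Z Z'"
  note inv = det_inverse[OF sylvester_mat_carrier sylvester_mat_det[OF Z]]
  have v: "mat_to_vec q D \<in> carrier_vec (q * q)" for D by (simp add: mat_to_vec_def)
  have dim: "dim_row (det_inverse ?K) = q * q" "dim_col (det_inverse ?K) = q * q" "dim_row ?K = q * q" "dim_col ?K = q * q"
    using inv(1) by (auto simp: sylvester_mat_def)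
  have r: "a * q + b < q * q" by (rule pair_index_less[OF ab])
  have "det_inverse ?K *\<^sub>v mat_to_vec q E = det_inverse ?K *\<^sub>v (?K *\<^sub>v mat_to_vec q D)"
    using sylvester_mat_mult[OF d D] E by simp
  also have "\<dots> = det_inverse ?K * ?K *\<^sub>v mat_to_vec q D"
    using dim by (simp add: mat_mult_vec_assoc mat_to_vec_def)
  also have "\<dots> = mat_to_vec q D" unfolding inv(3) using v by simp
  finally have eq: "det_inverse ?K *\<^sub>v mat_to_vec q E = mat_to_vec q D" .
  have "D $$ (a, b) = mat_to_vec q D $ (a * q + b)"
    using r ab by (simp add: mat_to_vec_def)
  also have "\<dots> = (det_inverse ?K *\<^sub>v mat_to_vec q E) $ (a * q + b)" by (simp only: eq)
  also have "\<dots> = (\<Sum>s<q * q. det_inverse ?K $$ (a * q + b, s) * E $$ (s div q, s mod q))"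
    using r dim by (simp add: mat_mult_vec_index_sum mat_to_vec_def del: index_mult_mat_vec)
  finally show ?thesis .
qed

section \<open>Smoothness of the positive definite square root\<close>

text \<open>The difference of the roots solves a Sylvester equation with right-hand side S - S0. The
  constant is taken from the root of S0 only, so one estimate serves all S.\<close>

lemma pd_sqrt_lipschitz:
  assumes S0: "pos_def q S0"
  obtains l where "0 < l" "\<And>S a b. pos_def q S \<Longrightarrow> a < q \<Longrightarrow> b < q \<Longrightarrow>
    \<bar>pd_sqrt q S $$ (a, b) - pd_sqrt q S0 $$ (a, b)\<bar> \<le> sqrt (mat_inner (S - S0) (S - S0)) / l"
proof -
  note Z0 = pd_sqrt[OF S0]
  note d0 = pos_def_sym(1)[OF Z0(1)]
  obtain l where l: "0 < l"
    "\<And>D m. D \<in> carrier_mat m q \<Longrightarrow> l * mat_inner D D \<le> mat_inner D (D * pd_sqrt q S0)"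
    using pos_def_lower_bound[OF Z0(1)] by blast
  show thesis
  proof (rule that[OF l(1)])
    fix S a b assume S: "pos_def q S" and ab: "a < q" "b < q"
    note Z = pd_sqrt[OF S]
    note d = pos_def_sym(1)[OF Z(1)]
    define D where "D = pd_sqrt q S - pd_sqrt q S0"
    have D: "D \<in> carrier_mat q q" using d0 by (simp add: D_def minus_carrier_mat)
    have "pd_sqrt q S * D + D * pd_sqrt q S0 = S - S0"
      unfolding D_def square_diff_sylvester[OF d d0] Z(2) Z0(2) by (rule refl)
    then have "l\<^sup>2 * mat_inner D D \<le> mat_inner (S - S0) (S - S0)"
      using sylvester_bound[OF Z(1) d0 l D] by simp
    moreover have "l\<^sup>2 * (D $$ (a, b))\<^sup>2 \<le> l\<^sup>2 * mat_inner D D"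
      using mat_entry_le_mat_inner[OF D ab] by (intro mult_left_mono) auto
    ultimately have "(l * \<bar>D $$ (a, b)\<bar>)\<^sup>2 \<le> mat_inner (S - S0) (S - S0)"
      by (simp add: power_mult_distrib)
    then have "l * \<bar>D $$ (a, b)\<bar> \<le> sqrt (mat_inner (S - S0) (S - S0))" by (rule real_le_rsqrt)
    then have "\<bar>D $$ (a, b)\<bar> \<le> sqrt (mat_inner (S - S0) (S - S0)) / l"
      using l(1) by (simp add: field_simps)
    then show "\<bar>pd_sqrt q S $$ (a, b) - pd_sqrt q S0 $$ (a, b)\<bar> \<le> sqrt (mat_inner (S - S0) (S - S0)) / l"
      using ab d d0 by (simp add: D_def)
  qed
qed

text \<open>S is affine along each coordinate line with the constant slope \<open>E i\<close>, so
  its difference quotients are exact; on W it is positive definite.\<close>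

locale pd_sqrt_family =
  fixes I :: "'i set" and W :: "('i \<Rightarrow> real) set" and q :: nat
    and S :: "('i \<Rightarrow> real) \<Rightarrow> real mat" and E :: "'i \<Rightarrow> real mat"
  assumes openW: "openin (coord_space I) W"
    and S_carrier: "S x \<in> carrier_mat q q" and E_carrier: "E i \<in> carrier_mat q q"
    and S_pos_def: "x \<in> W \<Longrightarrow> pos_def q (S x)"
    and S_line: "i \<in> I \<Longrightarrow> S (x(i := t)) = S x + (t - x i) \<cdot>\<^sub>m E i"
    and S_continuous: "a < q \<Longrightarrow> b < q \<Longrightarrow> continuous_map (coord_space I) euclideanreal (\<lambda>x. S x $$ (a, b))"
begin

text \<open>Rebuilt from entries in order to fix the dimensions: outside W nothing is known about
  the choice in \<open>pd_sqrt\<close>, whereas the algebra lemmas ask for the carrier at every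
  x.\<close>

definition root :: "('i \<Rightarrow> real) \<Rightarrow> real mat" where
  "root x = mat q q (\<lambda>(a, b). pd_sqrt q (S x) $$ (a, b))"

definition root_entries :: "(('i \<Rightarrow> real) \<Rightarrow> real) set" where
  "root_entries = {\<lambda>x. root x $$ (a, b) | a b. a < q \<and> b < q}"

lemma root_carrier [simp]: "root x \<in> carrier_mat q q"
  by (simp add: root_def)

lemma root_eq:
  assumes "x \<in> W"
  shows "root x = pd_sqrt q (S x)"
  using pos_def_sym(1)[OF pd_sqrt(1)[OF S_pos_def[OF assms]]]
  by (intro eq_matI) (auto simp: root_def)

lemma root_pos_def: "x \<in> W \<Longrightarrow> pos_def q (root x)"
  using pd_sqrt(1)[OF S_pos_def] root_eq by simp

lemma root_square: "x \<in> W \<Longrightarrow> root x * root x = S x"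
  using pd_sqrt(2)[OF S_pos_def] root_eq by simp

lemma root_algebra: "a < q \<Longrightarrow> b < q \<Longrightarrow> coord_algebra I W root_entries (\<lambda>x. root x $$ (a, b))"
  by (rule coord_algebra.gen) (auto simp: root_entries_def)

text \<open>At a given point the Lipschitz estimate dominates the change of the root by h, which
  tends to 0 with the change of S.\<close>

lemma root_continuous:
  assumes ab: "a < q" "b < q"
  shows "continuous_map (subtopology (coord_space I) W) euclideanreal (\<lambda>x. root x $$ (a, b))"
  unfolding continuous_map_atin limitin_canonical_iff
proof
  let ?X = "subtopology (coord_space I) W"
  fix x0 assume x0: "x0 \<in> topspace ?X"
  then have W0: "x0 \<in> W" by auto
  obtain l where l: "0 < l" "\<And>M a b. pos_def q M \<Longrightarrow> a < q \<Longrightarrow> b < q \<Longrightarrow>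
    \<bar>pd_sqrt q M $$ (a, b) - pd_sqrt q (S x0) $$ (a, b)\<bar> \<le> sqrt (mat_inner (M - S x0) (M - S x0)) / l"
    using pd_sqrt_lipschitz[OF S_pos_def[OF W0]] by blast
  define h where "h x = sqrt (\<Sum>j<q. \<Sum>i<q. (S x $$ (i, j) - S x0 $$ (i, j)) * (S x $$ (i, j) - S x0 $$ (i, j))) / l" for x
  have dS: "dim_row (S x) = q" "dim_col (S x) = q" for x using S_carrier[of x] by auto
  have "((\<lambda>x. S x $$ (i, j)) \<longlongrightarrow> S x0 $$ (i, j)) (atin ?X x0)" if "i < q" "j < q" for i j
    using continuous_map_from_subtopology[OF S_continuous[OF that], of W] x0
    by (simp add: continuous_map_atin)
  then have "(h \<longlongrightarrow> sqrt (\<Sum>j<q. \<Sum>i<q. (S x0 $$ (i, j) - S x0 $$ (i, j)) * (S x0 $$ (i, j) - S x0 $$ (i, j))) / l) (atin ?X x0)"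
    unfolding h_def[abs_def] using l(1) by (intro tendsto_intros) auto
  then have h0: "(h \<longlongrightarrow> 0) (atin ?X x0)" by simp
  have "\<forall>\<^sub>F x in atin ?X x0. norm (root x $$ (a, b) - root x0 $$ (a, b)) \<le> norm (h x) * 1"
    unfolding eventually_atin
  proof (intro disjI2 exI[of _ "topspace ?X"] conjI ballI)
    fix x assume "x \<in> topspace ?X - {x0}"
    then have xW: "x \<in> W" by auto
    have "norm (root x $$ (a, b) - root x0 $$ (a, b)) \<le> h x"
      using l(2)[OF S_pos_def[OF xW] ab] dS
      by (simp add: root_eq xW W0 h_def mat_inner_sum[where n=q and q=q])
    then show "norm (root x $$ (a, b) - root x0 $$ (a, b)) \<le> norm (h x) * 1" by simp
  qed (use x0 openin_topspace in blast)+
  then have "((\<lambda>x. root x $$ (a, b) - root x0 $$ (a, b)) \<longlongrightarrow> 0) (atin ?X x0)"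
    by (rule tendsto_0_le[OF h0])
  then show "((\<lambda>x. root x $$ (a, b)) \<longlongrightarrow> root x0 $$ (a, b)) (atin ?X x0)"
    by (simp add: LIM_zero_iff)
qed

lemma root_line_tendsto:
  assumes "x \<in> W" "i \<in> I" "a < q" "b < q"
  shows "((\<lambda>t. root (x(i := t)) $$ (a, b)) \<longlongrightarrow> root x $$ (a, b)) (at (x i))"
  using tendsto_coord_line[OF openW assms(1,2) root_continuous[OF assms(3,4)]] .

text \<open>Along a coordinate line the square of the root is affine, so its difference quotients solve a
  Sylvester equation exactly, and differentiability follows from continuity.\<close>

lemma root_difference_quotient:
  assumes x: "x \<in> W" and y: "x(i := t) \<in> W" and i: "i \<in> I" and t: "t \<noteq> x i" and ab: "a < q" "b < q"
  shows "(root (x(i := t)) $$ (a, b) - root x $$ (a, b)) / (t - x i) =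
    (\<Sum>s<q * q. det_inverse (sylvester_mat q (root (x(i := t))) (root x)) $$ (a * q + b, s) * E i $$ (s div q, s mod q))"
proof -
  define Z where "Z = root x"
  define Z' where "Z' = root (x(i := t))"
  have d: "Z \<in> carrier_mat q q" "Z' \<in> carrier_mat q q" by (simp_all add: Z_def Z'_def)
  have dd: "dim_row Z = q" "dim_col Z = q" "dim_row Z' = q" "dim_col Z' = q" using d by auto
  define D where "D = (1 / (t - x i)) \<cdot>\<^sub>m (Z' - Z)"
  have D: "D \<in> carrier_mat q q" using d by (simp add: D_def minus_carrier_mat)
  have dE: "dim_row (E i) = q" "dim_col (E i) = q" and dS: "dim_row (S x) = q" "dim_col (S x) = q"
    using E_carrier[of i] S_carrier[of x] by auto
  have "Z' * D + D * Z = (1 / (t - x i)) \<cdot>\<^sub>m (Z' * (Z' - Z)) + (1 / (t - x i)) \<cdot>\<^sub>m ((Z' - Z) * Z)"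
    using dd by (simp add: D_def mat_mult_smult mat_smult_mult)
  also have "\<dots> = (1 / (t - x i)) \<cdot>\<^sub>m (Z' * (Z' - Z) + (Z' - Z) * Z)"
    using dd by (intro eq_matI) (auto simp: distrib_left simp del: index_mult_mat(1))
  also have "Z' * (Z' - Z) + (Z' - Z) * Z = S (x(i := t)) - S x"
    unfolding square_diff_sylvester[OF d(2,1)] using root_square[OF x] root_square[OF y]
    by (simp add: Z_def Z'_def)
  also have "S (x(i := t)) - S x = (t - x i) \<cdot>\<^sub>m E i"
    unfolding S_line[OF i] using dE dS by (intro eq_matI) auto
  also have "(1 / (t - x i)) \<cdot>\<^sub>m ((t - x i) \<cdot>\<^sub>m E i) = E i"
    using t by (intro eq_matI) auto
  finally have "Z' * D + D * Z = E i" .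
  from sylvester_solution[OF _ _ D this ab] root_pos_def[OF x] root_pos_def[OF y]
  have "D $$ (a, b) = (\<Sum>s<q * q. det_inverse (sylvester_mat q Z' Z) $$ (a * q + b, s) * E i $$ (s div q, s mod q))"
    by (simp add: Z_def Z'_def)
  then show ?thesis using ab dd by (simp add: D_def Z_def Z'_def)
qed

text \<open>Away from \<open>x i\<close> the difference quotient equals \<open>?Q\<close>. Its limit
  exists because the root is continuous and the Sylvester determinant is nonzero at x.\<close>

lemma root_has_derivative:
  assumes x: "x \<in> W" and i: "i \<in> I" and ab: "a < q" "b < q"
  shows "((\<lambda>t. root (x(i := t)) $$ (a, b)) has_real_derivative
    (\<Sum>s<q * q. det_inverse (sylvester_mat q (root x) (root x)) $$ (a * q + b, s) * E i $$ (s div q, s mod q))) (at (x i))"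
proof -
  let ?Q = "\<lambda>t. \<Sum>s<q * q. det_inverse (sylvester_mat q (root (x(i := t))) (root x)) $$ (a * q + b, s) * E i $$ (s div q, s mod q)"
  have lim: "(?Q \<longlongrightarrow> (\<Sum>s<q * q. det_inverse (sylvester_mat q (root x) (root x)) $$ (a * q + b, s) * E i $$ (s div q, s mod q))) (at (x i))"
  proof (intro tendsto_sum tendsto_mult tendsto_const tendsto_det_inverse[OF sylvester_mat_carrier sylvester_mat_carrier]
      sylvester_mat_det root_pos_def x pair_index_less ab)
    fix r s assume rs: "r < q * q" "s < q * q"
    have "((\<lambda>t. (if r mod q = s mod q then root (x(i := t)) $$ (r div q, s div q) else 0) +
       (if r div q = s div q then root x $$ (s mod q, r mod q) else 0)) \<longlongrightarrow>
       (if r mod q = s mod q then root x $$ (r div q, s div q) else 0) +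
       (if r div q = s div q then root x $$ (s mod q, r mod q) else 0)) (at (x i))"
      using root_line_tendsto[OF x i] div_mod_less[OF rs(1)] div_mod_less[OF rs(2)]
      by (intro tendsto_add) auto
    then show "((\<lambda>t. sylvester_mat q (root (x(i := t))) (root x) $$ (r, s)) \<longlongrightarrow>
        sylvester_mat q (root x) (root x) $$ (r, s)) (at (x i))"
      using rs by (simp add: sylvester_mat_def)
  qed auto
  have T: "open {t. x(i := t) \<in> W}" "x i \<in> {t. x(i := t) \<in> W}"
    using open_coord_line[OF openW x i] x by auto
  have "\<forall>\<^sub>F t in at (x i). t \<in> {t. x(i := t) \<in> W} \<and> t \<noteq> x i"
    using eventually_at_topological T by blast
  then have "\<forall>\<^sub>F t in at (x i). ?Q t = (root (x(i := t)) $$ (a, b) - root x $$ (a, b)) / (t - x i)"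
    by eventually_elim (use root_difference_quotient[OF x _ i _ ab] in auto)
  from Lim_transform_eventually[OF lim this] show ?thesis
    by (simp add: has_field_derivative_iff)
qed

text \<open>The derivative is rational in the entries of the root itself, so differentiating the
  generators does not lead out of the algebra.\<close>

lemma root_derivative_algebra:
  assumes "a < q" "b < q"
  shows "coord_algebra I W root_entries (\<lambda>x. \<Sum>s<q * q.
    det_inverse (sylvester_mat q (root x) (root x)) $$ (a * q + b, s) * E i $$ (s div q, s mod q))"
proof (intro coord_algebra_sum coord_algebra.mult coord_algebra.const
    coord_algebra_det_inverse[OF sylvester_mat_carrier] sylvester_mat_det root_pos_def pair_index_less assms)
  fix r s assume rs: "r < q * q" "s < q * q"
  have ite: "coord_algebra I W root_entries (\<lambda>x. if P then f x else 0)"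
    if "coord_algebra I W root_entries f" for P f
    using that by (cases P) (auto intro: coord_algebra.const)
  have "coord_algebra I W root_entries (\<lambda>x. (if r mod q = s mod q then root x $$ (r div q, s div q) else 0) +
       (if r div q = s div q then root x $$ (s mod q, r mod q) else 0))"
    using div_mod_less[OF rs(1)] div_mod_less[OF rs(2)]
    by (intro coord_algebra.add ite root_algebra)
  then show "coord_algebra I W root_entries (\<lambda>x. sylvester_mat q (root x) (root x) $$ (r, s))"
    using rs by (simp add: sylvester_mat_def)
qed auto

theorem root_algebra_smooth:
  assumes "coord_algebra I W root_entries f"
  shows "Ck_on k I W f"
proof (rule coord_algebra_smooth[OF assms])
  fix g assume "g \<in> root_entries"
  then obtain a b where ab: "a < q" "b < q" and g: "g = (\<lambda>x. root x $$ (a, b))"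
    by (auto simp: root_entries_def)
  show "continuous_map (subtopology (coord_space I) W) euclideanreal g"
    unfolding g by (rule root_continuous[OF ab])
  fix i assume i: "i \<in> I"
  show "\<exists>g'. coord_algebra I W root_entries g' \<and>
      (\<forall>x\<in>W. ((\<lambda>t. g (x(i := t))) has_real_derivative g' x) (at (x i)))"
    unfolding g using root_derivative_algebra[OF ab, of i] root_has_derivative[OF _ i ab] by blast
qed

end

section \<open>Flags and block columns\<close>

abbreviation block_start :: "nat list \<Rightarrow> nat \<Rightarrow> nat" where
  "block_start qs i \<equiv> sum_list (take i qs)"

lemma block_index_exists:
  "a < sum_list qs \<Longrightarrow> \<exists>i<length qs. \<exists>b<qs ! i. a = block_start qs i + b"
proof (induction qs arbitrary: a)
  case (Cons q qs)
  show ?case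
  proof (cases "a < q")
    case True
    then show ?thesis by (intro exI[of _ 0]) auto
  next
    case False
    then have "a - q < sum_list qs" using Cons.prems by simp
    then obtain i b where "i < length qs" "b < qs ! i" "a - q = block_start qs i + b"
      using Cons.IH by blast
    then show ?thesis using False by (intro exI[of _ "Suc i"]) auto
  qed
qed simp

lemma block_start_mono:
  assumes "i < j" "j \<le> length qs"
  shows "block_start qs i + qs ! i \<le> block_start qs j"
proof -
  have "block_start qs i + qs ! i = block_start qs (Suc i)"
    using assms by (simp add: take_Suc_conv_app_nth)
  also have "take j qs = take (Suc i) qs @ drop (Suc i) (take j qs)"
    using assms by (metis Suc_leI append_take_drop_id min.absorb1 take_take)
  then have "block_start qs (Suc i) \<le> block_start qs j" by (metis le_add1 sum_list_append)
  finally show ?thesis .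
qed

lemma block_index_less:
  assumes "i < length qs" "b < qs ! i"
  shows "block_start qs i + b < sum_list qs"
  using block_start_mono[of i "length qs" qs] assms by simp

lemma block_index_unique:
  assumes "i < length qs" "j < length qs" "b < qs ! i" "c < qs ! j"
  shows "block_start qs i + b = block_start qs j + c \<longleftrightarrow> i = j \<and> b = c"
  using block_start_mono[of i j qs] block_start_mono[of j i qs] assms
  by (cases i j rule: linorder_cases) auto

lemma concat_nth_block:
  "i < length xss \<Longrightarrow> b < length (xss ! i) \<Longrightarrow>
    concat xss ! (block_start (map length xss) i + b) = xss ! i ! b"
proof (induction xss arbitrary: i)
  case (Cons xs xss)
  then show ?case by (cases i) (auto simp: nth_append add.assoc)
qed simp

lemma index_join_cols:
  assumes len: "length Ms = length qs" and Ms: "\<And>i. i < length qs \<Longrightarrow> Ms ! i \<in> carrier_mat n (qs ! i)"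
  shows "join_cols n Ms \<in> carrier_mat n (sum_list qs)"
    and "a < n \<Longrightarrow> i < length qs \<Longrightarrow> b < qs ! i \<Longrightarrow>
      join_cols n Ms $$ (a, block_start qs i + b) = Ms ! i $$ (a, b)"
proof -
  have lens: "map length (map cols Ms) = qs"
    using len Ms by (intro nth_equalityI) auto
  then have total: "length (concat (map cols Ms)) = sum_list qs"
    by (simp add: length_concat)
  then show "join_cols n Ms \<in> carrier_mat n (sum_list qs)"
    by (intro carrier_matI) (simp_all add: join_cols_def)
  assume a: "a < n" and i: "i < length qs" and b: "b < qs ! i"
  have "concat (map cols Ms) ! (block_start qs i + b) = map cols Ms ! i ! b"
    using concat_nth_block[of i "map cols Ms" b] lens i b len Ms[OF i] by simp
  then show "join_cols n Ms $$ (a, block_start qs i + b) = Ms ! i $$ (a, b)"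
    using a i b len Ms[OF i] block_index_less[OF i b] total
    by (simp add: join_cols_def mat_of_cols_index)
qed

lemma col_block_join_cols:
  assumes "length Ms = length qs" "\<And>i. i < length qs \<Longrightarrow> Ms ! i \<in> carrier_mat n (qs ! i)"
    and "i < length qs"
  shows "col_block qs i (join_cols n Ms) = Ms ! i"
proof (rule eq_matI)
  have J: "dim_row (join_cols n Ms) = n" using index_join_cols(1)[of Ms qs n] assms by auto
  show "dim_row (col_block qs i (join_cols n Ms)) = dim_row (Ms ! i)"
    "dim_col (col_block qs i (join_cols n Ms)) = dim_col (Ms ! i)"
    using J assms(2)[OF assms(3)] by (auto simp: col_block_def)
  fix a b assume "a < dim_row (Ms ! i)" "b < dim_col (Ms ! i)"
  then have ab: "a < n" "b < qs ! i" using assms(2)[OF assms(3)] by auto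
  then show "col_block qs i (join_cols n Ms) $$ (a, b) = Ms ! i $$ (a, b)"
    using J index_join_cols(2)[OF assms(1,2) ab(1) assms(3) ab(2)] by (simp add: col_block_def)
qed

text \<open>L has one truth value per diagonal position. In this form block offsets become list
  positions, for which \<open>concat_nth_block\<close> is available.\<close>

lemma diag_block_indicator:
  fixes xs :: "(bool \<times> nat) list"
  defines "D \<equiv> diag_block_mat (map (\<lambda>(p, q). if p then 1\<^sub>m q else 0\<^sub>m q q) xs) :: real mat"
    and "L \<equiv> concat (map (\<lambda>(p, q). replicate q p) xs)"
  shows "D = mat_diag (length L) (\<lambda>a. if L ! a then 1 else 0)"
  unfolding D_def L_def
proof (induction xs)
  case Nil
  then show ?case by (auto intro!: eq_matI)
next
  case (Cons x xs)
  obtain p q where x: "x = (p, q)" by (cases x)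
  show ?case
    unfolding list.map diag_block_mat.simps Cons.IH x Let_def
    by (intro eq_matI) (auto simp: nth_append mat_diag_def)
qed

text \<open>\<open>standard_proj qs i\<close> selects the i-th column block, so each component of
  the projection depends on one block. The section property can therefore be checked block by
  block.\<close>

lemma flag_proj_nth:
  assumes Q: "Q \<in> carrier_mat n n" and n: "sum_list qs = n" and i: "i < length qs"
  shows "flag_proj qs Q ! i = col_block qs i Q * (col_block qs i Q)\<^sup>T"
proof -
  define xs where "xs = map (\<lambda>k. (k = i, qs ! k)) [0..<length qs]"
  define L where "L = concat (map (\<lambda>(p, q). replicate q p) xs)"
  have lens: "map length (map (\<lambda>(p, q). replicate q p) xs) = qs"
    unfolding xs_def by (intro nth_equalityI) auto
  then have len: "length L = n" using n by (simp add: L_def length_concat)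
  have "map (\<lambda>(p, q). if p then 1\<^sub>m q else 0\<^sub>m q q) xs =
      map (\<lambda>k. if k = i then 1\<^sub>m (qs ! k) else 0\<^sub>m (qs ! k) (qs ! k) :: real mat) [0..<length qs]"
    by (auto simp: xs_def)
  then have P: "standard_proj qs i = mat_diag n (\<lambda>a. if L ! a then 1 else 0)"
    using diag_block_indicator[of xs] len by (simp add: standard_proj_def L_def)
  have L: "L ! (block_start qs k + b) \<longleftrightarrow> k = i" if "k < length qs" "b < qs ! k" for k b
    using concat_nth_block[of k "map (\<lambda>(p, q). replicate q p) xs" b] that lens
    by (simp add: L_def xs_def)
  \<comment> \<open>The selected positions are exactly the columns of block i; this reindexes the
    sum over all columns.\<close>
  have img: "{c. c < n \<and> L ! c} = (\<lambda>d. block_start qs i + d) ` {..<qs ! i}"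
  proof (intro equalityI subsetI)
    fix c assume "c \<in> {c. c < n \<and> L ! c}"
    then obtain k b where "k < length qs" "b < qs ! k" "c = block_start qs k + b" "L ! c"
      using block_index_exists[of c qs] n by auto
    then show "c \<in> (\<lambda>d. block_start qs i + d) ` {..<qs ! i}" using L by auto
  next
    fix c assume "c \<in> (\<lambda>d. block_start qs i + d) ` {..<qs ! i}"
    then show "c \<in> {c. c < n \<and> L ! c}" using L[OF i] block_index_less[OF i] n by auto
  qed
  have "flag_proj qs Q ! i = Q * standard_proj qs i * Q\<^sup>T" using i by (simp add: flag_proj_def)
  also have "\<dots> = col_block qs i Q * (col_block qs i Q)\<^sup>T"
  proof (rule eq_matI)
    fix a b assume "a < dim_row (col_block qs i Q * (col_block qs i Q)\<^sup>T)"
      "b < dim_col (col_block qs i Q * (col_block qs i Q)\<^sup>T)"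
    then have ab: "a < n" "b < n" using Q by (auto simp: col_block_def)
    have "(Q * standard_proj qs i * Q\<^sup>T) $$ (a, b) = (\<Sum>c<n. (Q * standard_proj qs i) $$ (a, c) * Q\<^sup>T $$ (c, b))"
      using ab Q by (subst mat_mult_index_sum) (auto simp: P)
    also have "\<dots> = (\<Sum>c<n. if L ! c then Q $$ (a, c) * Q $$ (b, c) else 0)"
      unfolding P using ab Q
      by (intro sum.cong) (auto simp: mult_mat_diag_index simp del: index_mult_mat(1))
    also have "\<dots> = (\<Sum>c | c < n \<and> L ! c. Q $$ (a, c) * Q $$ (b, c))"
      by (intro sum.mono_neutral_cong_right) auto
    also have "\<dots> = (\<Sum>d<qs ! i. Q $$ (a, block_start qs i + d) * Q $$ (b, block_start qs i + d))"
      unfolding img by (subst sum.reindex) (auto simp: inj_on_def)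
    also have "\<dots> = (col_block qs i Q * (col_block qs i Q)\<^sup>T) $$ (a, b)"
      using ab Q by (simp add: mat_mult_index_sum col_block_def del: index_mult_mat(1))
    finally show "(Q * standard_proj qs i * Q\<^sup>T) $$ (a, b) = (col_block qs i Q * (col_block qs i Q)\<^sup>T) $$ (a, b)" .
  qed (use Q in \<open>auto simp: col_block_def\<close>)
  finally show ?thesis .
qed

lemma col_block_stiefel:
  assumes Q: "Q \<in> orthogonal_group n" and n: "sum_list qs = n" and i: "i < length qs"
  shows "col_block qs i Q \<in> stiefel n (qs ! i)"
  unfolding stiefel_def
proof (intro CollectI conjI eq_matI)
  have Q': "dim_row Q = n" "dim_col Q = n" "Q\<^sup>T * Q = 1\<^sub>m n" using Q by (auto simp: orthogonal_group_def)
  show "col_block qs i Q \<in> carrier_mat n (qs ! i)" using Q' by (simp add: col_block_def)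
  fix b c assume "b < dim_row (1\<^sub>m (qs ! i) :: real mat)" "c < dim_col (1\<^sub>m (qs ! i) :: real mat)"
  then have bc: "b < qs ! i" "c < qs ! i" by auto
  have idx: "block_start qs i + b < n" "block_start qs i + c < n"
    using block_index_less[OF i] bc n by auto
  have "((col_block qs i Q)\<^sup>T * col_block qs i Q) $$ (b, c) =
      (Q\<^sup>T * Q) $$ (block_start qs i + b, block_start qs i + c)"
    using bc idx Q'(1,2) by (simp add: mat_mult_index_sum col_block_def del: index_mult_mat(1))
  then show "((col_block qs i Q)\<^sup>T * col_block qs i Q) $$ (b, c) = 1\<^sub>m (qs ! i) $$ (b, c)"
    unfolding Q'(3) using bc idx by simp
qed (auto simp: col_block_def)

text \<open>Multiplying the vanishing product of two projections by the transposed first frame on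
  the left and the second frame on the right shows that columns of different blocks are
  orthogonal.\<close>

lemma join_cols_orthogonal:
  assumes n: "sum_list qs = n" and len: "length Ms = length qs"
    and Ms: "\<And>i. i < length qs \<Longrightarrow> Ms ! i \<in> stiefel n (qs ! i)"
    and orth: "\<And>i j. i < length qs \<Longrightarrow> j < length qs \<Longrightarrow> i \<noteq> j \<Longrightarrow>
      (Ms ! i * (Ms ! i)\<^sup>T) * (Ms ! j * (Ms ! j)\<^sup>T) = 0\<^sub>m n n"
  shows "join_cols n Ms \<in> orthogonal_group n"
proof -
  note J = index_join_cols[OF len stiefelD(1)[OF Ms]]
  have JC: "join_cols n Ms \<in> carrier_mat n n" using J(1) n by simp
  have MM: "(Ms ! i)\<^sup>T * Ms ! j = (if i = j then 1\<^sub>m (qs ! i) else 0\<^sub>m (qs ! i) (qs ! j))"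
    if ij: "i < length qs" "j < length qs" for i j
  proof (cases "i = j")
    case True
    then show ?thesis using stiefelD(2)[OF Ms[OF ij(1)]] by simp
  next
    case False
    note di = stiefelD[OF Ms[OF ij(1)]] and dj = stiefelD[OF Ms[OF ij(2)]]
    have "(Ms ! i)\<^sup>T * Ms ! j = (Ms ! i)\<^sup>T * ((Ms ! i * (Ms ! i)\<^sup>T) * (Ms ! j * (Ms ! j)\<^sup>T)) * Ms ! j"
      using di dj mat_mult_assoc_eq[OF di(2), of "(Ms ! i)\<^sup>T * Ms ! j"] by (simp add: mat_mult_assoc)
    then show ?thesis unfolding orth[OF ij False] using False di dj by simp
  qed
  have "(join_cols n Ms)\<^sup>T * join_cols n Ms = 1\<^sub>m n"
  proof (rule eq_matI)
    fix a b assume "a < dim_row (1\<^sub>m n :: real mat)" "b < dim_col (1\<^sub>m n :: real mat)"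
    then have ab: "a < sum_list qs" "b < sum_list qs" using n by auto
    obtain i c where ic: "i < length qs" "c < qs ! i" "a = block_start qs i + c"
      using block_index_exists[OF ab(1)] by blast
    obtain j d where jd: "j < length qs" "d < qs ! j" "b = block_start qs j + d"
      using block_index_exists[OF ab(2)] by blast
    note di = stiefelD[OF Ms[OF ic(1)]] and dj = stiefelD[OF Ms[OF jd(1)]]
    have "((join_cols n Ms)\<^sup>T * join_cols n Ms) $$ (a, b) = (\<Sum>k<n. join_cols n Ms $$ (k, a) * join_cols n Ms $$ (k, b))"
      using JC ab n by (simp add: mat_mult_index_sum del: index_mult_mat(1))
    also have "\<dots> = (\<Sum>k<n. Ms ! i $$ (k, c) * Ms ! j $$ (k, d))"
      using J(2) ic jd by simp
    also have "\<dots> = ((Ms ! i)\<^sup>T * Ms ! j) $$ (c, d)"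
      using di(3,4) dj(3,4) ic jd by (simp add: mat_mult_index_sum del: index_mult_mat(1))
    also have "\<dots> = 1\<^sub>m n $$ (a, b)"
      unfolding MM[OF ic(1) jd(1)] using ic jd ab n block_index_unique[OF ic(1) jd(1) ic(2) jd(2)] by auto
    finally show "((join_cols n Ms)\<^sup>T * join_cols n Ms) $$ (a, b) = 1\<^sub>m n $$ (a, b)" .
  qed (use JC in auto)
  then show ?thesis using JC by (simp add: orthogonal_group_def)
qed

section \<open>Coordinates of matrix tuples and the symmetrized compression\<close>

definition coord_mat :: "nat \<Rightarrow> nat \<Rightarrow> (nat \<times> nat \<times> nat \<Rightarrow> real) \<Rightarrow> real mat" where
  "coord_mat n k x = mat n n (\<lambda>(i, j). x (k, i, j))"

lemma coord_mat_carrier [simp]: "coord_mat n k x \<in> carrier_mat n n"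
  by (simp add: coord_mat_def)

lemma coord_mat_dims [simp]: "dim_row (coord_mat n k x) = n" "dim_col (coord_mat n k x) = n"
  by (simp_all add: coord_mat_def)

lemma coord_mat_tuple_coords:
  assumes "k < r" "Rs ! k \<in> carrier_mat n n"
  shows "coord_mat n k (tuple_coords r n Rs) = Rs ! k"
  using assms by (intro eq_matI) (auto simp: coord_mat_def tuple_coords_def coord_index_def)

lemma tuple_coords_topspace: "tuple_coords r n Rs \<in> topspace (coord_space (coord_index r n))"
  by (simp add: tuple_coords_def)

lemma coord_algebra_coord_mat:
  assumes "k < r" "a < n" "b < n"
  shows "coord_algebra (coord_index r n) W G (\<lambda>x. coord_mat n k x $$ (a, b))"
  using assms coord_algebra.coord[of "(k, a, b)" "coord_index r n" W G]
  by (simp add: coord_mat_def coord_index_def)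

lemma coord_algebra_continuous_space:
  assumes "coord_algebra I (topspace (coord_space I)) {} f"
  shows "continuous_map (coord_space I) euclideanreal f"
  using coord_algebra_continuous[OF assms] unfolding subtopology_topspace by simp

lemma section_domain_nth:
  assumes "Rs \<in> section_domain n qs Ps" "i < length qs"
  shows "Rs ! i \<in> grassmann n (qs ! i)" "Rs ! i \<notin> cut_locus n (qs ! i) (Ps ! i)"
    "Rs ! i \<in> carrier_mat n n" "(Rs ! i)\<^sup>T = Rs ! i"
  using assms by (auto simp: section_domain_def grassmann_def)

text \<open>Avoiding all the cut loci amounts to the nonvanishing of a single polynomial on the
  ambient space, the product of the block determinants.\<close>

lemma section_domain_open:
  assumes n: "sum_list qs = n" and Q: "Q \<in> orthogonal_group n"
  shows "open_in_flags n qs (section_domain n qs (flag_proj qs Q))"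
proof -
  let ?r = "length qs" and ?U = "\<lambda>i. col_block qs i Q"
  let ?I = "coord_index ?r n"
  define f where "f x = (\<Prod>i<?r. det ((?U i)\<^sup>T * coord_mat n i x * ?U i))" for x
  define W where "W = {x \<in> topspace (coord_space ?I). f x \<in> UNIV - {0}}"
  have Q': "Q \<in> carrier_mat n n" using Q by (simp add: orthogonal_group_def)
  have U: "?U i \<in> stiefel n (qs ! i)" if "i < ?r" for i by (rule col_block_stiefel[OF Q n that])
  have "coord_algebra ?I (topspace (coord_space ?I)) {} f"
    unfolding f_def[abs_def]
  proof (intro coord_algebra_prod)
    fix i assume "i \<in> {..<?r}"
    then have i: "i < ?r" by simp
    note dU = stiefelD[OF U[OF i]]
    show "coord_algebra ?I (topspace (coord_space ?I)) {} (\<lambda>x. det ((?U i)\<^sup>T * coord_mat n i x * ?U i))"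
    proof (rule coord_algebra_det[of _ "qs ! i"])
      fix a b assume ab: "a < qs ! i" "b < qs ! i"
      show "coord_algebra ?I (topspace (coord_space ?I)) {} (\<lambda>x. ((?U i)\<^sup>T * coord_mat n i x * ?U i) $$ (a, b))"
      proof (rule coord_algebra_mat_mult[of _ "qs ! i" n _ "qs ! i"])
        fix a b assume "a < qs ! i" "b < n"
        then show "coord_algebra ?I (topspace (coord_space ?I)) {} (\<lambda>x. ((?U i)\<^sup>T * coord_mat n i x) $$ (a, b))"
          using dU i by (intro coord_algebra_mat_mult[of _ "qs ! i" n _ n] coord_algebra.const coord_algebra_coord_mat) auto
      qed (use dU ab in \<open>auto intro: coord_algebra.const\<close>)
    qed (use dU in auto)
  qed auto
  then have "continuous_map (coord_space ?I) euclideanreal f" by (rule coord_algebra_continuous_space)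
  then have "openin (coord_space ?I) W"
    unfolding W_def by (rule openin_continuous_map_preimage) (simp add: open_delete)
  moreover have "section_domain n qs (flag_proj qs Q) = {Rs \<in> flag_manifold n qs. tuple_coords ?r n Rs \<in> W}"
  proof -
    have "Rs ! i \<notin> cut_locus n (qs ! i) (flag_proj qs Q ! i) \<longleftrightarrow> det ((?U i)\<^sup>T * Rs ! i * ?U i) \<noteq> 0"
      if "Rs \<in> flag_manifold n qs" "i < ?r" for Rs i
      using cut_locus_iff_det[OF U[OF that(2)], of "Rs ! i"] that flag_proj_nth[OF Q' n that(2)]
      by (simp add: flag_manifold_def)
    moreover have "coord_mat n i (tuple_coords ?r n Rs) = Rs ! i" if "Rs \<in> flag_manifold n qs" "i < ?r" for Rs i
      using that by (intro coord_mat_tuple_coords) (auto simp: flag_manifold_def grassmann_def)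
    ultimately show ?thesis
      using tuple_coords_topspace[of ?r n]
      unfolding section_domain_def W_def f_def by (auto simp: flag_manifold_def)
  qed
  ultimately show ?thesis unfolding open_in_flags_def by blast
qed

text \<open>Symmetrizing the matrix coordinate extends \<open>R \<mapsto> U\<^sup>T R U\<close> from the Grassmannian to a family of
  symmetric matrices on the whole ambient space.\<close>

definition compression :: "nat \<Rightarrow> nat \<Rightarrow> real mat \<Rightarrow> (nat \<times> nat \<times> nat \<Rightarrow> real) \<Rightarrow> real mat" where
  "compression n k U x = U\<^sup>T * ((1/2) \<cdot>\<^sub>m (coord_mat n k x + (coord_mat n k x)\<^sup>T)) * U"

lemma compression_carrier: "U \<in> carrier_mat n q \<Longrightarrow> compression n k U x \<in> carrier_mat q q"
  unfolding compression_def by (intro carrier_matI) auto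

lemma compression_sym: "U \<in> carrier_mat n q \<Longrightarrow> (compression n k U x)\<^sup>T = compression n k U x"
  unfolding compression_def
  by (simp add: mat_transpose mat_mult_assoc comm_add_mat[of "(coord_mat n k x)\<^sup>T" n n])

lemma compression_tuple_coords:
  assumes "U \<in> carrier_mat n q" "k < r" "Rs ! k \<in> carrier_mat n n" "(Rs ! k)\<^sup>T = Rs ! k"
  shows "compression n k U (tuple_coords r n Rs) = U\<^sup>T * Rs ! k * U"
proof -
  have "(1/2) \<cdot>\<^sub>m (Rs ! k + Rs ! k) = Rs ! k" using assms(3) by (intro eq_matI) auto
  then show ?thesis unfolding compression_def coord_mat_tuple_coords[OF assms(2,3)] assms(4) by simp
qed

text \<open>Compression is linear in the coordinates, so the slope in direction i is its value at
  the i-th unit coordinate function.\<close>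

lemma compression_line:
  assumes U: "U \<in> carrier_mat n q"
  shows "compression n k U (x(i := t)) = compression n k U x + (t - x i) \<cdot>\<^sub>m compression n k U (\<lambda>j. if j = i then 1 else 0)"
proof -
  let ?e = "\<lambda>j. if j = i then 1 else 0 :: real"
  define h where "h y = (1/2) \<cdot>\<^sub>m (coord_mat n k y + (coord_mat n k y)\<^sup>T)" for y
  have dh: "dim_row (h y) = n" "dim_col (h y) = n" for y by (auto simp: h_def)
  have "h (x(i := t)) = h x + (t - x i) \<cdot>\<^sub>m h ?e"
    unfolding h_def by (intro eq_matI) (auto simp: coord_mat_def field_simps)
  then have "U\<^sup>T * h (x(i := t)) * U = U\<^sup>T * h x * U + (t - x i) \<cdot>\<^sub>m (U\<^sup>T * h ?e * U)"
    using U dh by (simp add: mat_distrib)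
  then show ?thesis by (simp add: compression_def h_def)
qed

lemma compression_algebra:
  assumes U: "U \<in> carrier_mat n q" and k: "k < r" and ab: "a < q" "b < q"
  shows "coord_algebra (coord_index r n) W G (\<lambda>x. compression n k U x $$ (a, b))"
proof -
  let ?h = "\<lambda>x. (1/2) \<cdot>\<^sub>m (coord_mat n k x + (coord_mat n k x)\<^sup>T)"
  have h: "coord_algebra (coord_index r n) W G (\<lambda>x. ?h x $$ (a, b))" if "a < n" "b < n" for a b
  proof -
    have "coord_algebra (coord_index r n) W G (\<lambda>x. 1/2 * (coord_mat n k x $$ (a, b) + coord_mat n k x $$ (b, a)))"
      using that k by (intro coord_algebra.mult coord_algebra.const coord_algebra.add coord_algebra_coord_mat)
    then show ?thesis using that by simp
  qed
  have h_carrier: "?h x \<in> carrier_mat n n" for x by auto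
  show ?thesis
    unfolding compression_def
  proof (rule coord_algebra_mat_mult[of _ q n _ q])
    fix a b assume "a < q" "b < n"
    then show "coord_algebra (coord_index r n) W G (\<lambda>x. (U\<^sup>T * ?h x) $$ (a, b))"
      using U h h_carrier by (intro coord_algebra_mat_mult[of _ q n _ n] coord_algebra.const) auto
  qed (use U ab in \<open>auto intro: coord_algebra.const\<close>)
qed

text \<open>Positive definiteness of the symmetrized compression holds on an ambient neighbourhood
  of the base point. There the closed form is rational in the coordinates and the entries of the
  root.\<close>

lemma aligned_representative_smooth:
  assumes U: "U \<in> stiefel n q" and k: "k < r" and ab: "a < n" "b < q"
    and R0: "Rs0 ! k \<in> carrier_mat n n" "(Rs0 ! k)\<^sup>T = Rs0 ! k" and pd: "pos_def q (U\<^sup>T * Rs0 ! k * U)"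
  obtains W F where "openin (coord_space (coord_index r n)) W" "tuple_coords r n Rs0 \<in> W"
    "\<And>m. Ck_on m (coord_index r n) W F"
    "\<And>Rs. Rs ! k \<in> carrier_mat n n \<Longrightarrow> (Rs ! k)\<^sup>T = Rs ! k \<Longrightarrow> tuple_coords r n Rs \<in> W \<Longrightarrow>
      F (tuple_coords r n Rs) = (Rs ! k * U * det_inverse (pd_sqrt q (U\<^sup>T * Rs ! k * U))) $$ (a, b)"
proof -
  note dU = stiefelD[OF U]
  let ?I = "coord_index r n" and ?S = "compression n k U" and ?x0 = "tuple_coords r n Rs0"
  have S0: "?S ?x0 = U\<^sup>T * Rs0 ! k * U" by (rule compression_tuple_coords[OF dU(1) k R0])
  obtain e where e: "0 < e" "\<And>S'. S' \<in> carrier_mat q q \<Longrightarrow> S'\<^sup>T = S' \<Longrightarrow>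
      mat_inner (S' - ?S ?x0) (S' - ?S ?x0) < e \<Longrightarrow> pos_def q S'"
    using pos_def_open[OF pd] unfolding S0 by blast
  have S_carrier: "?S x \<in> carrier_mat q q" for x by (rule compression_carrier[OF dU(1)])
  have S_dims: "dim_row (?S x) = q" "dim_col (?S x) = q" for x using S_carrier[of x] by auto
  have S_cont: "continuous_map (coord_space ?I) euclideanreal (\<lambda>x. ?S x $$ (a, b))" if "a < q" "b < q" for a b
    by (rule coord_algebra_continuous_space[OF compression_algebra[OF dU(1) k that]])
  define h where "h x = mat_inner (?S x - ?S ?x0) (?S x - ?S ?x0)" for x
  have "continuous_map (coord_space ?I) euclideanreal h"
    unfolding h_def[abs_def]
    by (simp add: mat_inner_sum[where n=q and q=q] S_dims)
      (intro continuous_map_sum continuous_map_real_mult continuous_map_diff S_cont, auto)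
  \<comment> \<open>The distance is measured between compressions, where the radius e applies; W is
    the preimage of an open half-line under a continuous function.\<close>
  define W where "W = {x \<in> topspace (coord_space ?I). h x \<in> {..<e}}"
  have W: "openin (coord_space ?I) W"
    unfolding W_def
    by (rule openin_continuous_map_preimage[OF \<open>continuous_map (coord_space ?I) euclideanreal h\<close>]) simp
  have S_pd: "pos_def q (?S x)" if "x \<in> W" for x
    using that by (intro e S_carrier compression_sym[OF dU(1)]) (auto simp: W_def h_def)
  interpret pd_sqrt_family ?I W q ?S "\<lambda>i. ?S (\<lambda>j. if j = i then 1 else 0)"
    by unfold_locales (use W S_pd S_cont S_carrier compression_line[OF dU(1)] in auto)
  define F where "F x = (coord_mat n k x * U * det_inverse (root x)) $$ (a, b)" for x
  have inv: "det_inverse (root x) \<in> carrier_mat q q" for x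
    using adj_mat(1)[OF root_carrier] by (simp add: det_inverse_def)
  have "coord_algebra ?I W root_entries F"
    unfolding F_def[abs_def]
  proof (rule coord_algebra_mat_mult[of _ n q _ q])
    fix a b assume "a < n" "b < q"
    then show "coord_algebra ?I W root_entries (\<lambda>x. (coord_mat n k x * U) $$ (a, b))"
      using dU k by (intro coord_algebra_mat_mult[of _ n n _ q] coord_algebra.const coord_algebra_coord_mat) auto
  next
    fix a b assume "a < q" "b < q"
    then show "coord_algebra ?I W root_entries (\<lambda>x. det_inverse (root x) $$ (a, b))"
      using root_pos_def pos_def_det by (intro coord_algebra_det_inverse[of _ q] root_algebra) auto
  qed (use dU ab inv in auto)
  then have "Ck_on m ?I W F" for m by (rule root_algebra_smooth)
  moreover have "?x0 \<in> W"
    using e(1) tuple_coords_topspace[of r n Rs0] mat_inner_zero_right[of "0\<^sub>m q q"]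
    by (simp add: W_def h_def S_dims)
  moreover have "F (tuple_coords r n Rs) = (Rs ! k * U * det_inverse (pd_sqrt q (U\<^sup>T * Rs ! k * U))) $$ (a, b)"
    if "Rs ! k \<in> carrier_mat n n" "(Rs ! k)\<^sup>T = Rs ! k" "tuple_coords r n Rs \<in> W" for Rs
    unfolding F_def root_eq[OF that(3)] compression_tuple_coords[OF dU(1) k that(1,2)]
      coord_mat_tuple_coords[OF k that(1)] ..
  ultimately show thesis using that W by blast
qed

section \<open>Assembly of the blocks into a section\<close>

theorem proposition13:
  fixes n :: nat and qs :: "nat list" and Ps :: "real mat list" and Q :: "real mat"
  assumes "flag_type n qs"
    and "Ps \<in> flag_manifold n qs"
    and "Q \<in> orthogonal_group n" and "flag_proj qs Q = Ps"
  shows "smooth_local_section n qs (section_domain n qs Ps) (holonomy_section n qs Ps Q)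
    \<and> (\<forall>Rs \<in> section_domain n qs Ps. \<forall>i<length qs. \<forall>U \<in> stiefel n (qs ! i).
         stiefel_proj U = Ps ! i \<longrightarrow>
         (let q = qs ! i;
              \<Delta> = grassmann_log n (Ps ! i) (Rs ! i);
              A = U\<^sup>T * \<Delta> * U;
              C = U\<^sup>T * (\<Delta> * \<Delta>) * U
          in holonomy n q (Ps ! i) (Rs ! i) U =
               join_cols n [U, \<Delta> * U]
               * mat_exp (four_block_mat A (- C) (1\<^sub>m q) A)
               * (1\<^sub>m q @\<^sub>r 0\<^sub>m q q)
               * mat_exp (- A)))"

proof -
  let ?r = "length qs" and ?V = "section_domain n qs Ps" and ?U = "\<lambda>i. col_block qs i Q"
  have n: "sum_list qs = n" using assms(1) by (simp add: flag_type_def)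
  have Q: "Q \<in> carrier_mat n n" using assms(3) by (simp add: orthogonal_group_def)
  have U: "?U i \<in> stiefel n (qs ! i)" if "i < ?r" for i by (rule col_block_stiefel[OF assms(3) n that])
  have UP: "?U i * (?U i)\<^sup>T = Ps ! i" if "i < ?r" for i
    using flag_proj_nth[OF Q n that] assms(4) by simp
  have hol: "holonomy n (qs ! i) (Ps ! i) (Rs ! i) (?U i) =
      Rs ! i * ?U i * det_inverse (pd_sqrt (qs ! i) ((?U i)\<^sup>T * Rs ! i * ?U i))"
    "holonomy n (qs ! i) (Ps ! i) (Rs ! i) (?U i) \<in> stiefel n (qs ! i)"
    "holonomy n (qs ! i) (Ps ! i) (Rs ! i) (?U i) * (holonomy n (qs ! i) (Ps ! i) (Rs ! i) (?U i))\<^sup>T = Rs ! i"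
    if "Rs \<in> ?V" "i < ?r" for Rs i
    using holonomy_outside_cut_locus(1-3)[OF U[OF that(2)] section_domain_nth(1)[OF that]]
      section_domain_nth(2)[OF that] by (simp_all only: UP[OF that(2)] not_False_eq_True)
  define H where "H Rs = map (\<lambda>i. holonomy n (qs ! i) (Ps ! i) (Rs ! i) (?U i)) [0..<?r]" for Rs
  have S: "holonomy_section n qs Ps Q Rs = join_cols n (H Rs)" for Rs
    by (simp add: holonomy_section_def H_def)
  have H: "length (H Rs) = ?r" "i < ?r \<Longrightarrow> H Rs ! i = holonomy n (qs ! i) (Ps ! i) (Rs ! i) (?U i)" for Rs i
    by (simp_all add: H_def)
  have H_carrier: "H Rs ! i \<in> carrier_mat n (qs ! i)" if "Rs \<in> ?V" "i < ?r" for Rs i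
    using hol(2)[OF that] H that stiefelD(1) by simp
  have S_orth: "holonomy_section n qs Ps Q Rs \<in> orthogonal_group n" if Rs: "Rs \<in> ?V" for Rs
    unfolding S
  proof (rule join_cols_orthogonal[OF n])
    fix i j assume "i < ?r" "j < ?r" "i \<noteq> j"
    then show "H Rs ! i * (H Rs ! i)\<^sup>T * (H Rs ! j * (H Rs ! j)\<^sup>T) = 0\<^sub>m n n"
      using hol(3)[OF Rs] Rs by (simp add: H section_domain_def flag_manifold_def)
  qed (use H hol(2)[OF Rs] in auto)
  have S_proj: "flag_proj qs (holonomy_section n qs Ps Q Rs) = Rs" if Rs: "Rs \<in> ?V" for Rs
  proof (rule nth_equalityI)
    show "length (flag_proj qs (holonomy_section n qs Ps Q Rs)) = length Rs"
      using Rs by (simp add: flag_proj_def section_domain_def flag_manifold_def)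
    fix i assume "i < length (flag_proj qs (holonomy_section n qs Ps Q Rs))"
    then have i: "i < ?r" by (simp add: flag_proj_def)
    have carrier: "holonomy_section n qs Ps Q Rs \<in> carrier_mat n n"
      using S_orth[OF Rs] by (simp add: orthogonal_group_def)
    have "col_block qs i (holonomy_section n qs Ps Q Rs) = H Rs ! i"
      unfolding S by (rule col_block_join_cols[OF H(1) H_carrier[OF Rs] i])
    then show "flag_proj qs (holonomy_section n qs Ps Q Rs) ! i = Rs ! i"
      using flag_proj_nth[OF carrier n i] hol(3)[OF Rs i] H(2)[OF i] by simp
  qed
  have S_smooth: "smooth_mat_map_on ?r n ?V (holonomy_section n qs Ps Q)"
    unfolding smooth_mat_map_on_def
  proof (intro allI impI ballI)
    fix a c Rs0 assume a: "a < n" and c: "c < n" and Rs0: "Rs0 \<in> ?V"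
    \<comment> \<open>Column c is column b of block i, so the entry involves a single holonomy
      map.\<close>
    obtain i b where i: "i < ?r" and b: "b < qs ! i" and c_eq: "c = block_start qs i + b"
      using block_index_exists[of c qs] c n by auto
    have "det ((?U i)\<^sup>T * Rs0 ! i * ?U i) \<noteq> 0"
      using cut_locus_iff_det[OF U[OF i] section_domain_nth(1)[OF Rs0 i]]
        section_domain_nth(2)[OF Rs0 i] UP[OF i] by simp
    then have pd: "pos_def (qs ! i) ((?U i)\<^sup>T * Rs0 ! i * ?U i)"
      by (rule compression_pos_def[OF U[OF i] section_domain_nth(1)[OF Rs0 i]])
    obtain W F where W: "openin (coord_space (coord_index ?r n)) W" "tuple_coords ?r n Rs0 \<in> W"
      and F: "\<And>m. Ck_on m (coord_index ?r n) W F"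
      and eq: "\<And>Rs. Rs ! i \<in> carrier_mat n n \<Longrightarrow> (Rs ! i)\<^sup>T = Rs ! i \<Longrightarrow> tuple_coords ?r n Rs \<in> W \<Longrightarrow>
        F (tuple_coords ?r n Rs) = (Rs ! i * ?U i * det_inverse (pd_sqrt (qs ! i) ((?U i)\<^sup>T * Rs ! i * ?U i))) $$ (a, b)"
      using aligned_representative_smooth[OF U[OF i] i a b section_domain_nth(3,4)[OF Rs0 i] pd] by blast
    have "holonomy_section n qs Ps Q Rs $$ (a, c) = F (tuple_coords ?r n Rs)"
      if Rs: "Rs \<in> ?V" and W': "tuple_coords ?r n Rs \<in> W" for Rs
    proof -
      have "holonomy_section n qs Ps Q Rs $$ (a, c) = H Rs ! i $$ (a, b)"
        unfolding S c_eq by (rule index_join_cols(2)[OF H(1) H_carrier[OF Rs] a i b])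
      also have "\<dots> = F (tuple_coords ?r n Rs)"
        unfolding H(2)[OF i] hol(1)[OF Rs i] eq[OF section_domain_nth(3,4)[OF Rs i] W'] ..
      finally show ?thesis .
    qed
    then show "\<exists>W F. openin (coord_space (coord_index ?r n)) W \<and> tuple_coords ?r n Rs0 \<in> W \<and>
        (\<forall>k. Ck_on k (coord_index ?r n) W F) \<and>
        (\<forall>Rs\<in>?V. tuple_coords ?r n Rs \<in> W \<longrightarrow> holonomy_section n qs Ps Q Rs $$ (a, c) = F (tuple_coords ?r n Rs))"
      using W F by blast
  qed
  have "smooth_local_section n qs ?V (holonomy_section n qs Ps Q)"
    unfolding smooth_local_section_def
    using section_domain_open[OF n assms(3)] assms(4) S_orth S_smooth S_proj by auto
  moreover have "holonomy n (qs ! i) (Ps ! i) (Rs ! i) U =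
      join_cols n [U, \<Delta> * U] * mat_exp (four_block_mat (U\<^sup>T * \<Delta> * U) (- (U\<^sup>T * (\<Delta> * \<Delta>) * U)) (1\<^sub>m (qs ! i)) (U\<^sup>T * \<Delta> * U))
      * (1\<^sub>m (qs ! i) @\<^sub>r 0\<^sub>m (qs ! i) (qs ! i)) * mat_exp (- (U\<^sup>T * \<Delta> * U))"
    if "Rs \<in> ?V" "i < ?r" "U \<in> stiefel n (qs ! i)" "stiefel_proj U = Ps ! i" "\<Delta> = grassmann_log n (Ps ! i) (Rs ! i)"
    for Rs i U \<Delta>
  proof -
    have P: "U * U\<^sup>T = Ps ! i" using that(4) by (simp add: stiefel_proj_def)
    \<comment> \<open>U is an arbitrary frame of \<open>Ps ! i\<close> here; it inherits the
      condition because the cut locus depends on \<open>U * U\<^sup>T\<close> alone.\<close>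
    have "Rs ! i \<notin> cut_locus n (qs ! i) (U * U\<^sup>T)" using section_domain_nth(2)[OF that(1,2)] P by simp
    from holonomy_outside_cut_locus(4)[OF that(3) section_domain_nth(1)[OF that(1,2)] this]
    show ?thesis unfolding P that(5) by simp
  qed
  ultimately show ?thesis by (simp add: Let_def)
qed

end
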